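(* Let $R$ be a ring with unity, let $\mathcal{X}$ be a semibrick of left $R$-modules such that every $X\in\mathcal{X}$ has projective dimension at most one, and let $U,V$ be $R$-modules. Let $f:U_{\mathcal{X}}(\infty)\to V_{\mathcal{X}}(\infty)$ be a homomorphism such that $f(U)\subseteq V_{\mathcal{X}}(r)$ for some $r\in\mathbb{N}$, $r\ge1$. Then $f(U_{\mathcal{X}}(i))\subseteq V_{\mathcal{X}}(i+r-1)$ for all integers $i\ge1$. In particular, if $U$ and $V$ lie in $\mathrm{Filt}(\mathcal{X})$ and $U$ is $\mathcal{X}$-semisimple, then $f(U_{\mathcal{X}}(i))\subseteq V_{\mathcal{X}}(i)$ for all integers $i\ge1$ (for every homomorphism $f:U_{\mathcal{X}}(\infty)\to V_{\mathcal{X}}(\infty)$).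
   Context: A brick is a finitely presented left $R$-module whose endomorphism ring is a division ring. A semibrick is a class $\mathcal{X}$ of pairwise non-isomorphic bricks with $\mathrm{Hom}(X,X')=0$ for distinct $X,X'\in\mathcal{X}$. $\mathcal{X}$-universal sequences: let $Y$ be a module. For each $X\in\mathcal{X}$, $\mathrm{Ext}^1(X,Y)$ is a left $\mathrm{End}(X)$-module (acting by pull-back; compositions written from left to right). Choose a basis $(0\to Y\to M_{X,i}\to X\to 0)_{i\in I_X}$ over the division ring $\mathrm{End}(X)$. The $\mathcal{X}$-universal short exact sequence $0\to Y\to M\to\bigoplus_{X\in\mathcal{X}}X^{(I_X)}\to 0$ starting from $Y$ is the push-out of $0\to\bigoplus_{X}Y^{(I_X)}\to\bigoplus_{X,i}M_{X,i}\to\bigoplus_{X}X^{(I_X)}\to 0$ along the summation map $\bigoplus_X Y^{(I_X)}\to Y$. Define $Y_{\mathcal{X}}(1)=Y$ and let $Y_{\mathcal{X}}(i)\to Y_{\mathcal{X}}(i+1)$ be the monomorphism of an $\mathcal{X}$-universal sequence starting from $Y_{\mathcal{X}}(i)$; $Y_{\mathcal{X}}(\infty)$ is the direct limit, and all $Y_{\mathcal{X}}(i)$ are viewed as submodules of it. $\mathrm{Filt}(\mathcal{X})$ is the class of modules $M$ admitting an ascending chain of submodules $(M_\lambda,\lambda\le\mu)$ ($\mu$ an ordinal) with $M_0=0$, $M_\mu=M$, $M_\nu=\bigcup_{\lambda<\nu}M_\lambda$ for limit ordinals $\nu\le\mu$, and each $M_{\lambda+1}/M_\lambda$ isomorphic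 to a module in $\mathcal{X}$. A module is $\mathcal{X}$-semisimple if it is isomorphic to a direct sum of objects from $\mathcal{X}$ (repetitions allowed). *)

theory Defs
  imports "HOL-Algebra.AbelCoset" "HOL-Algebra.Module"
begin

section \<open>Left modules over a ring with unity\<close>

text \<open>
  The locale \<^locale>\<open>module\<close> of the library is restricted to commutative rings.  We keep its record
  type (whose fields for multiplication and unit are meaningless for modules) and its axioms, over
  an arbitrary ring.
\<close>

locale left_module = R?: ring R + M?: abelian_group M
  for R (structure) and M (structure) +
  assumes smult_closed [simp, intro]:
      "\<lbrakk>a \<in> carrier R; x \<in> carrier M\<rbrakk> \<Longrightarrow> a \<odot>\<^bsub>M\<^esub> x \<in> carrier M"
    and smult_l_distr:
      "\<lbrakk>a \<in> carrier R; b \<in> carrier R; x \<in> carrier M\<rbrakk> \<Longrightarrow>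
        (a \<oplus> b) \<odot>\<^bsub>M\<^esub> x = a \<odot>\<^bsub>M\<^esub> x \<oplus>\<^bsub>M\<^esub> b \<odot>\<^bsub>M\<^esub> x"
    and smult_r_distr:
      "\<lbrakk>a \<in> carrier R; x \<in> carrier M; y \<in> carrier M\<rbrakk> \<Longrightarrow>
        a \<odot>\<^bsub>M\<^esub> (x \<oplus>\<^bsub>M\<^esub> y) = a \<odot>\<^bsub>M\<^esub> x \<oplus>\<^bsub>M\<^esub> a \<odot>\<^bsub>M\<^esub> y"
    and smult_assoc1:
      "\<lbrakk>a \<in> carrier R; b \<in> carrier R; x \<in> carrier M\<rbrakk> \<Longrightarrow>
        (a \<otimes> b) \<odot>\<^bsub>M\<^esub> x = a \<odot>\<^bsub>M\<^esub> (b \<odot>\<^bsub>M\<^esub> x)"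
    and smult_one [simp]:
      "x \<in> carrier M \<Longrightarrow> \<one> \<odot>\<^bsub>M\<^esub> x = x"

definition lmod_hom ::
    "('a, 'k) ring_scheme \<Rightarrow> ('a, 'b) module \<Rightarrow> ('a, 'c) module \<Rightarrow> ('b \<Rightarrow> 'c) set" where
  "lmod_hom R M N = {f \<in> carrier M \<rightarrow> carrier N.
     (\<forall>x\<in>carrier M. \<forall>y\<in>carrier M. f (x \<oplus>\<^bsub>M\<^esub> y) = f x \<oplus>\<^bsub>N\<^esub> f y) \<and>
     (\<forall>a\<in>carrier R. \<forall>x\<in>carrier M. f (a \<odot>\<^bsub>M\<^esub> x) = a \<odot>\<^bsub>N\<^esub> f x)}"

definition lmod_iso ::
    "('a, 'k) ring_scheme \<Rightarrow> ('a, 'b) module \<Rightarrow> ('a, 'c) module \<Rightarrow> ('b \<Rightarrow> 'c) set" where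
  "lmod_iso R M N = {f \<in> lmod_hom R M N. bij_betw f (carrier M) (carrier N)}"

definition lmod_isomorphic ::
    "('a, 'k) ring_scheme \<Rightarrow> ('a, 'b) module \<Rightarrow> ('a, 'c) module \<Rightarrow> bool" where
  "lmod_isomorphic R M N \<longleftrightarrow> lmod_iso R M N \<noteq> {}"

definition restrict_mod :: "('a, 'b) module \<Rightarrow> 'b set \<Rightarrow> ('a, 'b) module" where
  "restrict_mod M N = M\<lparr>carrier := N\<rparr>"

definition quotient_mod :: "('a, 'b) module \<Rightarrow> 'b set \<Rightarrow> ('a, 'b set) module" where
  "quotient_mod M N =
     \<lparr>carrier = a_rcosets\<^bsub>M\<^esub> N, mult = undefined, one = undefined,
      zero = N, add = set_add M,
      smult = (\<lambda>a A. \<Union>x\<in>A. N +>\<^bsub>M\<^esub> (a \<odot>\<^bsub>M\<^esub> x))\<rparr>"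

definition prod_mod :: "('a, 'b) module \<Rightarrow> ('a, 'c) module \<Rightarrow> ('a, 'b \<times> 'c) module" where
  "prod_mod M N =
     \<lparr>carrier = carrier M \<times> carrier N, mult = undefined, one = undefined,
      zero = (\<zero>\<^bsub>M\<^esub>, \<zero>\<^bsub>N\<^esub>), add = (\<lambda>(x, y) (x', y'). (x \<oplus>\<^bsub>M\<^esub> x', y \<oplus>\<^bsub>N\<^esub> y')),
      smult = (\<lambda>a (x, y). (a \<odot>\<^bsub>M\<^esub> x, a \<odot>\<^bsub>N\<^esub> y))\<rparr>"

definition direct_sum :: "'i set \<Rightarrow> ('i \<Rightarrow> ('a, 'b) module) \<Rightarrow> ('a, 'i \<Rightarrow> 'b) module" where
  "direct_sum I N =
     \<lparr>carrier = {f \<in> (\<Pi>\<^sub>E i\<in>I. carrier (N i)). finite {i \<in> I. f i \<noteq> \<zero>\<^bsub>N i\<^esub>}},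
      mult = undefined, one = undefined,
      zero = (\<lambda>i\<in>I. \<zero>\<^bsub>N i\<^esub>), add = (\<lambda>f g. \<lambda>i\<in>I. f i \<oplus>\<^bsub>N i\<^esub> g i),
      smult = (\<lambda>a f. \<lambda>i\<in>I. a \<odot>\<^bsub>N i\<^esub> f i)\<rparr>"

definition regular_mod :: "('a, 'k) ring_scheme \<Rightarrow> ('a, 'a) module" where
  "regular_mod R =
     \<lparr>carrier = carrier R, mult = undefined, one = undefined,
      zero = \<zero>\<^bsub>R\<^esub>, add = (\<oplus>\<^bsub>R\<^esub>), smult = (\<otimes>\<^bsub>R\<^esub>)\<rparr>"

definition free_mod :: "('a, 'k) ring_scheme \<Rightarrow> 'i set \<Rightarrow> ('a, 'i \<Rightarrow> 'a) module" where
  "free_mod R I = direct_sum I (\<lambda>_. regular_mod R)"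

definition lmod_basis ::
    "('a, 'k) ring_scheme \<Rightarrow> ('a, 'b) module \<Rightarrow> 'i set \<Rightarrow> ('i \<Rightarrow> 'b) \<Rightarrow> bool" where
  "lmod_basis R M I b \<longleftrightarrow>
     b \<in> I \<rightarrow> carrier M \<and>
     (\<forall>x\<in>carrier M. \<exists>F c. finite F \<and> F \<subseteq> I \<and> c \<in> F \<rightarrow> carrier R \<and>
        x = (\<Oplus>\<^bsub>M\<^esub>i\<in>F. c i \<odot>\<^bsub>M\<^esub> b i)) \<and>
     (\<forall>F c. finite F \<longrightarrow> F \<subseteq> I \<longrightarrow> c \<in> F \<rightarrow> carrier R \<longrightarrow>
        (\<Oplus>\<^bsub>M\<^esub>i\<in>F. c i \<odot>\<^bsub>M\<^esub> b i) = \<zero>\<^bsub>M\<^esub> \<longrightarrow> (\<forall>i\<in>F. c i = \<zero>\<^bsub>R\<^esub>))"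


section \<open>Short exact sequences\<close>

text \<open>
  The middle term and the two maps of a sequence \<open>0 \<rightarrow> Y \<rightarrow> M \<rightarrow> X \<rightarrow> 0\<close>; the end terms are
  arguments of the predicates below.
\<close>

record ('a, 'y, 'm, 'x) ses =
  mid :: "('a, 'm) module"
  incl :: "'y \<Rightarrow> 'm"
  proj :: "'m \<Rightarrow> 'x"

definition is_ses ::
    "('a, 'k) ring_scheme \<Rightarrow> ('a, 'y) module \<Rightarrow> ('a, 'y, 'm, 'x) ses \<Rightarrow> ('a, 'x) module \<Rightarrow> bool" where
  "is_ses R Y E X \<longleftrightarrow>
     left_module R Y \<and> left_module R (mid E) \<and> left_module R X \<and>
     incl E \<in> lmod_hom R Y (mid E) \<and> proj E \<in> lmod_hom R (mid E) X \<and>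
     inj_on (incl E) (carrier Y) \<and>
     incl E ` carrier Y = {m \<in> carrier (mid E). proj E m = \<zero>\<^bsub>X\<^esub>} \<and>
     proj E ` carrier (mid E) = carrier X"

definition ses_equiv ::
    "('a, 'k) ring_scheme \<Rightarrow> ('a, 'y) module \<Rightarrow>
      ('a, 'y, 'm, 'x) ses \<Rightarrow> ('a, 'y, 'n, 'x) ses \<Rightarrow> bool" where
  "ses_equiv R Y E E' \<longleftrightarrow>
     (\<exists>h\<in>lmod_iso R (mid E) (mid E').
        (\<forall>y\<in>carrier Y. h (incl E y) = incl E' y) \<and>
        (\<forall>m\<in>carrier (mid E). proj E' (h m) = proj E m))"

definition split_ses :: "('a, 'y) module \<Rightarrow> ('a, 'x) module \<Rightarrow> ('a, 'y, 'y \<times> 'x, 'x) ses" where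
  "split_ses Y X = \<lparr>mid = prod_mod Y X, incl = (\<lambda>y. (y, \<zero>\<^bsub>X\<^esub>)), proj = snd\<rparr>"

definition pullback_ses ::
    "('a, 'z) module \<Rightarrow> ('z \<Rightarrow> 'x) \<Rightarrow> ('a, 'y, 'm, 'x) ses \<Rightarrow> ('a, 'y, 'm \<times> 'z, 'z) ses" where
  "pullback_ses Z \<phi> E =
     \<lparr>mid = restrict_mod (prod_mod (mid E) Z)
        {(m, z). m \<in> carrier (mid E) \<and> z \<in> carrier Z \<and> proj E m = \<phi> z},
      incl = (\<lambda>y. (incl E y, \<zero>\<^bsub>Z\<^esub>)), proj = snd\<rparr>"

text \<open>
  Push-out of \<open>0 \<rightarrow> A \<rightarrow> M \<rightarrow> X \<rightarrow> 0\<close> along \<open>s : A \<rightarrow> Y\<close>, with middle term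
  \<open>(Y \<oplus> M) / {(s a, - a) | a \<in> A}\<close>.
\<close>

definition pushout_ses ::
    "('a, 'w) module \<Rightarrow> ('a, 'y) module \<Rightarrow> ('w \<Rightarrow> 'y) \<Rightarrow>
      ('a, 'w, 'm, 'x) ses \<Rightarrow> ('a, 'y, ('y \<times> 'm) set, 'x) ses" where
  "pushout_ses A Y s E =
     (let D = (\<lambda>a. (s a, \<ominus>\<^bsub>mid E\<^esub> incl E a)) ` carrier A in
      \<lparr>mid = quotient_mod (prod_mod Y (mid E)) D,
       incl = (\<lambda>y. D +>\<^bsub>prod_mod Y (mid E)\<^esub> (y, \<zero>\<^bsub>mid E\<^esub>)),
       proj = (\<lambda>C. proj E (snd (SOME p. p \<in> C)))\<rparr>)"

definition prod_ses ::
    "('a, 'y, 'm, 'x) ses \<Rightarrow> ('a, 'z, 'n, 'w) ses \<Rightarrow> ('a, 'y \<times> 'z, 'm \<times> 'n, 'x \<times> 'w) ses" where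
  "prod_ses E E' =
     \<lparr>mid = prod_mod (mid E) (mid E'), incl = map_prod (incl E) (incl E'),
      proj = map_prod (proj E) (proj E')\<rparr>"

definition direct_sum_ses ::
    "'i set \<Rightarrow> ('i \<Rightarrow> ('a, 'y, 'm, 'x) ses) \<Rightarrow> ('a, 'i \<Rightarrow> 'y, 'i \<Rightarrow> 'm, 'i \<Rightarrow> 'x) ses" where
  "direct_sum_ses I E =
     \<lparr>mid = direct_sum I (\<lambda>i. mid (E i)), incl = (\<lambda>f. \<lambda>i\<in>I. incl (E i) (f i)),
      proj = (\<lambda>f. \<lambda>i\<in>I. proj (E i) (f i))\<rparr>"

definition baer_sum ::
    "('a, 'x) module \<Rightarrow> ('a, 'y) module \<Rightarrow> ('a, 'y, 'm, 'x) ses \<Rightarrow> ('a, 'y, 'n, 'x) ses \<Rightarrow>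
      ('a, 'y, ('y \<times> (('m \<times> 'n) \<times> 'x)) set, 'x) ses" where
  "baer_sum X Y E E' =
     pushout_ses (prod_mod Y Y) Y (\<lambda>(y, y'). y \<oplus>\<^bsub>Y\<^esub> y')
       (pullback_ses X (\<lambda>x. (x, x)) (prod_ses E E'))"


section \<open>Endomorphism rings and the first extension group\<close>

text \<open>
  Endomorphisms are made extensional, so that equality of elements of the ring is equality on the
  module.  Compositions are written from left to right: the product of \<open>f\<close> and \<open>g\<close> is
  \<open>x \<mapsto> g (f x)\<close>.
\<close>

definition End_ring :: "('a, 'k) ring_scheme \<Rightarrow> ('a, 'x) module \<Rightarrow> ('x \<Rightarrow> 'x) ring" where
  "End_ring R X =
     \<lparr>carrier = lmod_hom R X X \<inter> extensional (carrier X),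
      mult = (\<lambda>f g. \<lambda>x\<in>carrier X. g (f x)), one = (\<lambda>x\<in>carrier X. x),
      zero = (\<lambda>x\<in>carrier X. \<zero>\<^bsub>X\<^esub>), add = (\<lambda>f g. \<lambda>x\<in>carrier X. f x \<oplus>\<^bsub>X\<^esub> g x)\<rparr>"

text \<open>
  The underlying set of the middle term of any extension of \<open>X\<close> by \<open>Y\<close> is in bijection with
  \<open>Y \<times> X\<close>, so every extension is equivalent to one whose middle term lives on the product type.
\<close>

type_synonym ('a, 'y, 'x) ext = "('a, 'y, 'y \<times> 'x, 'x) ses"

definition ext_class ::
    "('a, 'k) ring_scheme \<Rightarrow> ('a, 'x) module \<Rightarrow> ('a, 'y) module \<Rightarrow>
      ('a, 'y, 'm, 'x) ses \<Rightarrow> ('a, 'y, 'x) ext set" where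
  "ext_class R X Y E = {G. is_ses R Y G X \<and> ses_equiv R Y E G}"

text \<open>
  \<open>Ext\<^sup>1(X, Y)\<close> as a left module over \<^term>\<open>End_ring R X\<close>: equivalence classes of
  extensions with Baer sum, and endomorphisms acting by pull-back.
\<close>

definition Ext1 ::
    "('a, 'k) ring_scheme \<Rightarrow> ('a, 'x) module \<Rightarrow> ('a, 'y) module \<Rightarrow>
      ('x \<Rightarrow> 'x, ('a, 'y, 'x) ext set) module" where
  "Ext1 R X Y =
     \<lparr>carrier = ext_class R X Y ` {E :: ('a, 'y, 'x) ext. is_ses R Y E X},
      mult = undefined, one = undefined,
      zero = ext_class R X Y (split_ses Y X),
      add = (\<lambda>A B. \<Union>E\<in>A. \<Union>E'\<in>B. ext_class R X Y (baer_sum X Y E E')),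
      smult = (\<lambda>\<phi> A. \<Union>E\<in>A. ext_class R X Y (pullback_ses X \<phi> E))\<rparr>"


section \<open>Bricks, semibricks, projective dimension\<close>

definition division_ring :: "('a, 'k) ring_scheme \<Rightarrow> bool" where
  "division_ring S \<longleftrightarrow>
     ring S \<and> \<one>\<^bsub>S\<^esub> \<noteq> \<zero>\<^bsub>S\<^esub> \<and> Units S = carrier S - {\<zero>\<^bsub>S\<^esub>}"

definition finitely_presented :: "('a, 'k) ring_scheme \<Rightarrow> ('a, 'x) module \<Rightarrow> bool" where
  "finitely_presented R X \<longleftrightarrow>
     left_module R X \<and>
     (\<exists>(m::nat) (n::nat). \<exists>\<alpha>\<in>lmod_hom R (free_mod R {..<m}) (free_mod R {..<n}).
        \<exists>\<beta>\<in>lmod_hom R (free_mod R {..<n}) X.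
          \<beta> ` carrier (free_mod R {..<n}) = carrier X \<and>
          \<alpha> ` carrier (free_mod R {..<m}) = {x \<in> carrier (free_mod R {..<n}). \<beta> x = \<zero>\<^bsub>X\<^esub>})"

definition brick :: "('a, 'k) ring_scheme \<Rightarrow> ('a, 'x) module \<Rightarrow> bool" where
  "brick R X \<longleftrightarrow> finitely_presented R X \<and> division_ring (End_ring R X)"

definition semibrick :: "('a, 'k) ring_scheme \<Rightarrow> ('a, 'x) module set \<Rightarrow> bool" where
  "semibrick R \<X> \<longleftrightarrow>
     (\<forall>X\<in>\<X>. brick R X) \<and>
     (\<forall>X\<in>\<X>. \<forall>X'\<in>\<X>. X \<noteq> X' \<longrightarrow> \<not> lmod_isomorphic R X X') \<and>
     (\<forall>X\<in>\<X>. \<forall>X'\<in>\<X>. X \<noteq> X' \<longrightarrow>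
        (\<forall>f\<in>lmod_hom R X X'. \<forall>x\<in>carrier X. f x = \<zero>\<^bsub>X'\<^esub>))"

text \<open>
  Lifting property.  The type of \<open>M\<close> accommodates the free module on the set underlying \<open>P\<close>;
  lifting the identity of \<open>P\<close> along its canonical map to \<open>P\<close> makes \<open>P\<close> a direct summand of a
  free module.  Hence the property for these types implies it for modules over arbitrary types.
\<close>

definition projective :: "('a, 'k) ring_scheme \<Rightarrow> ('a, 'p) module \<Rightarrow> bool" where
  "projective R P \<longleftrightarrow>
     left_module R P \<and>
     (\<forall>(M :: ('a, 'p \<Rightarrow> 'a) module) (N :: ('a, 'p) module).
        left_module R M \<longrightarrow> left_module R N \<longrightarrow>
        (\<forall>g\<in>lmod_hom R M N. \<forall>h\<in>lmod_hom R P N. g ` carrier M = carrier N \<longrightarrow>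
           (\<exists>k\<in>lmod_hom R P M. \<forall>x\<in>carrier P. g (k x) = h x)))"

text \<open>
  Existence of a projective resolution \<open>0 \<rightarrow> P\<^sub>1 \<rightarrow> P\<^sub>0 \<rightarrow> X \<rightarrow> 0\<close>.  The type of \<open>P\<^sub>0\<close> and \<open>P\<^sub>1\<close> is no
  restriction: if there is such a resolution at all, then by Schanuel's lemma there is one where
  \<open>P\<^sub>0\<close> is the free module on the set underlying \<open>X\<close> and \<open>P\<^sub>1\<close> is a submodule of \<open>P\<^sub>0\<close>.
\<close>

definition proj_dim_le_one :: "('a, 'k) ring_scheme \<Rightarrow> ('a, 'x) module \<Rightarrow> bool" where
  "proj_dim_le_one R X \<longleftrightarrow>
     (\<exists>(P1 :: ('a, 'x \<Rightarrow> 'a) module) (E :: ('a, 'x \<Rightarrow> 'a, 'x \<Rightarrow> 'a, 'x) ses).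
        projective R P1 \<and> projective R (mid E) \<and> is_ses R P1 E X)"


section \<open>Universal sequences\<close>

text \<open>
  A basis of \<open>Ext\<^sup>1(X, Y)\<close> is given by a set of extensions, indexed by itself.  Thus \<open>B X\<close> plays the
  role of the index set \<open>I\<^sub>X\<close>, and \<open>Sigma \<X> B\<close> is the set of all pairs \<open>(X, i)\<close>
  with \<open>X \<in> \<X>\<close> and \<open>i \<in> I\<^sub>X\<close>.  Being a push-out is meant up to equivalence of extensions.
\<close>

definition universal_ses ::
    "('a, 'k) ring_scheme \<Rightarrow> ('a, 'x) module set \<Rightarrow> ('a, 'y) module \<Rightarrow>
      ('a, 'y, 'm, ('a, 'x) module \<times> ('a, 'y, 'x) ext \<Rightarrow> 'x) ses \<Rightarrow> bool" where
  "universal_ses R \<X> Y E \<longleftrightarrow>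
     (\<exists>B. (\<forall>X\<in>\<X>. B X \<subseteq> {e. is_ses R Y e X} \<and>
              lmod_basis (End_ring R X) (Ext1 R X Y) (B X) (ext_class R X Y)) \<and>
        is_ses R Y E (direct_sum (Sigma \<X> B) fst) \<and>
        ses_equiv R Y
          (pushout_ses (direct_sum (Sigma \<X> B) (\<lambda>_. Y)) Y
             (\<lambda>f. \<Oplus>\<^bsub>Y\<^esub>j\<in>{j \<in> Sigma \<X> B. f j \<noteq> \<zero>\<^bsub>Y\<^esub>}. f j)
             (direct_sum_ses (Sigma \<X> B) snd))
          E)"

text \<open>
  \<open>Yinf\<close> is a direct limit of a sequence of monomorphisms of \<open>\<X>\<close>-universal sequences
  starting from \<open>Y\<close>, where the terms \<open>Yn i\<close> (\<open>i \<ge> 1\<close>) of the direct system are viewed as submodules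
  of \<open>Yinf\<close> and \<open>e\<close> is the identification of \<open>Y\<close> with the first of them.  All choices involved (of
  bases, push-outs, direct limit) are covered.
\<close>

definition universal_tower ::
    "('a, 'k) ring_scheme \<Rightarrow> ('a, 'x) module set \<Rightarrow> ('a, 'y) module \<Rightarrow>
      ('y \<Rightarrow> 'm) \<Rightarrow> (nat \<Rightarrow> 'm set) \<Rightarrow> ('a, 'm) module \<Rightarrow> bool" where
  "universal_tower R \<X> Y e Yn Yinf \<longleftrightarrow>
     left_module R Yinf \<and>
     (\<forall>i\<ge>1. submodule (Yn i) R Yinf) \<and>
     e \<in> lmod_iso R Y (restrict_mod Yinf (Yn 1)) \<and>
     (\<forall>i\<ge>1. \<exists>E. universal_ses R \<X> (restrict_mod Yinf (Yn i)) E \<and>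
        mid E = restrict_mod Yinf (Yn (i + 1)) \<and> (\<forall>y\<in>Yn i. incl E y = y)) \<and>
     carrier Yinf = (\<Union>i\<in>{1..}. Yn i)"


section \<open>Filtered and semisimple modules\<close>

text \<open>
  The ordinals \<open>\<lambda> \<le> \<mu>\<close> are represented by a well-order \<open>r\<close> with a greatest element.  The successor
  \<open>\<nu>\<close> of \<open>\<lambda>\<close> is characterized by \<open>{\<kappa>. \<kappa> < \<nu>} = {\<kappa>. \<kappa> \<le> \<lambda>}\<close>, and the limit elements are
  those that are neither the least element nor a successor.  If all members of \<open>\<X>\<close> are nonzero
  (as bricks are), the chain is strictly increasing, so the type of sets of elements of \<open>M\<close> has
  enough elements to serve as type of indices.
\<close>

definition Filt :: "('a, 'k) ring_scheme \<Rightarrow> ('a, 'x) module set \<Rightarrow> ('a, 'b) module \<Rightarrow> bool" where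
  "Filt R \<X> M \<longleftrightarrow>
     left_module R M \<and>
     (\<exists>(r :: 'b set rel) F \<mu>.
        Well_order r \<and> \<mu> \<in> Field r \<and> (\<forall>\<kappa>\<in>Field r. (\<kappa>, \<mu>) \<in> r) \<and>
        (\<forall>\<kappa>\<in>Field r. submodule (F \<kappa>) R M) \<and>
        (\<forall>\<kappa> \<nu>. (\<kappa>, \<nu>) \<in> r \<longrightarrow> F \<kappa> \<subseteq> F \<nu>) \<and>
        F \<mu> = carrier M \<and>
        (\<forall>\<nu>\<in>Field r.
           (underS r \<nu> = {} \<longrightarrow> F \<nu> = {\<zero>\<^bsub>M\<^esub>}) \<and>
           (\<forall>\<kappa>\<in>Field r. underS r \<nu> = under r \<kappa> \<longrightarrow>
              (\<exists>X\<in>\<X>. lmod_isomorphic R (quotient_mod (restrict_mod M (F \<nu>)) (F \<kappa>)) X)) \<and>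
           (underS r \<nu> \<noteq> {} \<longrightarrow> (\<forall>\<kappa>\<in>Field r. underS r \<nu> \<noteq> under r \<kappa>) \<longrightarrow>
              F \<nu> = (\<Union>\<kappa>\<in>underS r \<nu>. F \<kappa>))))"

text \<open>
  Since zero summands can be omitted, a direct sum isomorphic to \<open>M\<close> can be indexed by elements
  of \<open>M\<close>.
\<close>

definition X_semisimple ::
    "('a, 'k) ring_scheme \<Rightarrow> ('a, 'x) module set \<Rightarrow> ('a, 'b) module \<Rightarrow> bool" where
  "X_semisimple R \<X> M \<longleftrightarrow>
     left_module R M \<and>
     (\<exists>(I :: 'b set) S. S \<in> I \<rightarrow> \<X> \<and> lmod_isomorphic R M (direct_sum I S))"

end

theory Submission
  imports Defs
begin

text \<open>
  Let \<open>0 \<rightarrow> Y \<rightarrow> Z \<rightarrow> \<Oplus>X \<rightarrow> 0\<close> be an \<open>\<X>\<close>-universal sequence and \<open>X \<in> \<X>\<close>.  Because a basis of \<open>Ext\<^sup>1(X, Y)\<close>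
  spans, the inclusion \<open>Y \<rightarrow> Z\<close> extends to the middle term of every extension of \<open>X\<close> by \<open>Y\<close>.
  Because it is linearly independent and \<open>\<X>\<close> is a semibrick, every homomorphism \<open>X \<rightarrow> Z\<close> takes values
  in \<open>Y\<close>: its composite with \<open>Z \<rightarrow> \<Oplus>X\<close> is a finite combination of inclusions of summands whose
  connecting class vanishes.

  Applied to consecutive terms \<open>V(k - 2) \<subseteq> V(k - 1) \<subseteq> V(k)\<close> of a tower, the two facts show that every
  homomorphism \<open>X \<rightarrow> V(k) / V(k - 2)\<close> takes values in \<open>V(k - 1) / V(k - 2)\<close>.  As \<open>X\<close> is finitely generated,
  every homomorphism \<open>X \<rightarrow> V(\<infinity>) / V(j)\<close> then takes values in \<open>V(j + 1) / V(j)\<close>, and likewise every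
  homomorphism \<open>X \<rightarrow> V(\<infinity>)\<close> in \<open>V(1)\<close>.  Since \<open>U(i + 1)\<close> is generated by \<open>U(i)\<close> and extensions of members
  of \<open>\<X>\<close> by \<open>U(i)\<close>, induction on \<open>i\<close> gives both claims.
\<close>

section \<open>Modules and homomorphisms\<close>

text \<open>Both facts about a universal sequence come from one construction: a finite combination
  of basis classes with coefficients \<open>c b\<close> is represented by an extension
  \<open>G\<close> whose middle term maps to that of the universal sequence over the map from
  \<open>X\<close> to the direct sum with components \<open>c b\<close>. Spanning makes every
  extension of \<open>X\<close> such a \<open>G\<close>; independence says that \<open>G\<close>
  splits only if all coefficients vanish. In terms of the long exact sequence, the connecting map
  from Hom(X, direct sum) to \<open>Ext1 R X Y\<close> is bijective. The obstacle is that
  \<open>Ext1\<close> consists of classes whose operations involve quotients and choices. Baer sums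
  are therefore handled through maps out of fibre products, and equivalences through relations
  between middle terms. The quotients of V(infinity) are not formed either: a homomorphism from
  \<open>X\<close> to V(infinity) / V(j) is replaced by a homomorphism from the middle term of an
  extension of \<open>X\<close> by \<open>Y\<close> that sends \<open>Y\<close> into V(j).\<close>

lemma left_moduleI:
  fixes R (structure) and M (structure)
  assumes "ring R"
    and "\<And>x y. \<lbrakk>x \<in> carrier M; y \<in> carrier M\<rbrakk> \<Longrightarrow> x \<oplus>\<^bsub>M\<^esub> y \<in> carrier M"
    and "\<zero>\<^bsub>M\<^esub> \<in> carrier M"
    and "\<And>x y z. \<lbrakk>x \<in> carrier M; y \<in> carrier M; z \<in> carrier M\<rbrakk> \<Longrightarrow>
      (x \<oplus>\<^bsub>M\<^esub> y) \<oplus>\<^bsub>M\<^esub> z = x \<oplus>\<^bsub>M\<^esub> (y \<oplus>\<^bsub>M\<^esub> z)"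
    and "\<And>x y. \<lbrakk>x \<in> carrier M; y \<in> carrier M\<rbrakk> \<Longrightarrow> x \<oplus>\<^bsub>M\<^esub> y = y \<oplus>\<^bsub>M\<^esub> x"
    and "\<And>x. x \<in> carrier M \<Longrightarrow> \<zero>\<^bsub>M\<^esub> \<oplus>\<^bsub>M\<^esub> x = x"
    and "\<And>x. x \<in> carrier M \<Longrightarrow> \<exists>y\<in>carrier M. y \<oplus>\<^bsub>M\<^esub> x = \<zero>\<^bsub>M\<^esub>"
    and "\<And>a x. \<lbrakk>a \<in> carrier R; x \<in> carrier M\<rbrakk> \<Longrightarrow> a \<odot>\<^bsub>M\<^esub> x \<in> carrier M"
    and "\<And>a b x. \<lbrakk>a \<in> carrier R; b \<in> carrier R; x \<in> carrier M\<rbrakk> \<Longrightarrow>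
      (a \<oplus> b) \<odot>\<^bsub>M\<^esub> x = a \<odot>\<^bsub>M\<^esub> x \<oplus>\<^bsub>M\<^esub> b \<odot>\<^bsub>M\<^esub> x"
    and "\<And>a x y. \<lbrakk>a \<in> carrier R; x \<in> carrier M; y \<in> carrier M\<rbrakk> \<Longrightarrow>
      a \<odot>\<^bsub>M\<^esub> (x \<oplus>\<^bsub>M\<^esub> y) = a \<odot>\<^bsub>M\<^esub> x \<oplus>\<^bsub>M\<^esub> a \<odot>\<^bsub>M\<^esub> y"
    and "\<And>a b x. \<lbrakk>a \<in> carrier R; b \<in> carrier R; x \<in> carrier M\<rbrakk> \<Longrightarrow>
      (a \<otimes> b) \<odot>\<^bsub>M\<^esub> x = a \<odot>\<^bsub>M\<^esub> (b \<odot>\<^bsub>M\<^esub> x)"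
    and "\<And>x. x \<in> carrier M \<Longrightarrow> \<one> \<odot>\<^bsub>M\<^esub> x = x"
  shows "left_module R M"
  using assms by (intro left_module.intro left_module_axioms.intro abelian_groupI) auto

context left_module
begin

lemma smult_zero_left [simp]:
  assumes "x \<in> carrier M"
  shows "\<zero> \<odot>\<^bsub>M\<^esub> x = \<zero>\<^bsub>M\<^esub>"
proof -
  have "\<zero> \<odot>\<^bsub>M\<^esub> x \<oplus>\<^bsub>M\<^esub> \<zero> \<odot>\<^bsub>M\<^esub> x = \<zero> \<odot>\<^bsub>M\<^esub> x"
    using assms smult_l_distr [of \<zero> \<zero> x] by simp
  then show ?thesis
    using assms M.add.r_cancel_one' by (metis R.zero_closed smult_closed)
qed

lemma smult_zero_right [simp]:
  assumes "a \<in> carrier R"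
  shows "a \<odot>\<^bsub>M\<^esub> \<zero>\<^bsub>M\<^esub> = \<zero>\<^bsub>M\<^esub>"
proof -
  have "a \<odot>\<^bsub>M\<^esub> \<zero>\<^bsub>M\<^esub> \<oplus>\<^bsub>M\<^esub> a \<odot>\<^bsub>M\<^esub> \<zero>\<^bsub>M\<^esub> = a \<odot>\<^bsub>M\<^esub> \<zero>\<^bsub>M\<^esub>"
    using assms smult_r_distr [of a "\<zero>\<^bsub>M\<^esub>" "\<zero>\<^bsub>M\<^esub>"] by simp
  then show ?thesis
    using assms M.add.r_cancel_one' by (metis M.zero_closed smult_closed)
qed

text \<open>Reduces negation to scalars: \<open>submoduleI\<close> need not ask for closure under
  negation, and \<open>map_minus\<close> follows from linearity.\<close>

lemma smult_minus_one:
  assumes "x \<in> carrier M"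
  shows "(\<ominus> \<one>) \<odot>\<^bsub>M\<^esub> x = \<ominus>\<^bsub>M\<^esub> x"
proof -
  have "(\<ominus> \<one>) \<odot>\<^bsub>M\<^esub> x \<oplus>\<^bsub>M\<^esub> x = (\<ominus> \<one> \<oplus> \<one>) \<odot>\<^bsub>M\<^esub> x"
    using assms by (subst smult_l_distr) auto
  also have "\<dots> = \<zero>\<^bsub>M\<^esub>"
    using assms by (simp add: R.l_neg)
  finally show ?thesis
    using assms M.minus_equality [of "(\<ominus> \<one>) \<odot>\<^bsub>M\<^esub> x" x] by simp
qed

lemma minus_zero [simp]: "\<ominus>\<^bsub>M\<^esub> \<zero>\<^bsub>M\<^esub> = \<zero>\<^bsub>M\<^esub>"
  using smult_minus_one [of "\<zero>\<^bsub>M\<^esub>"] by simp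

lemma diff_self [simp]: "x \<in> carrier M \<Longrightarrow> x \<ominus>\<^bsub>M\<^esub> x = \<zero>\<^bsub>M\<^esub>"
  by (simp add: M.minus_eq M.r_neg)

lemma diff_eq_zeroD:
  assumes "x \<ominus>\<^bsub>M\<^esub> y = \<zero>\<^bsub>M\<^esub>" and "x \<in> carrier M" and "y \<in> carrier M"
  shows "x = y"
  using assms M.minus_equality [of x "\<ominus>\<^bsub>M\<^esub> y"] by (simp add: M.minus_eq)

lemma smult_diff:
  assumes "a \<in> carrier R" and "x \<in> carrier M" and "y \<in> carrier M"
  shows "a \<odot>\<^bsub>M\<^esub> (x \<ominus>\<^bsub>M\<^esub> y) = a \<odot>\<^bsub>M\<^esub> x \<ominus>\<^bsub>M\<^esub> a \<odot>\<^bsub>M\<^esub> y"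
proof -
  have "a \<odot>\<^bsub>M\<^esub> (x \<ominus>\<^bsub>M\<^esub> y) \<oplus>\<^bsub>M\<^esub> a \<odot>\<^bsub>M\<^esub> y = a \<odot>\<^bsub>M\<^esub> (x \<ominus>\<^bsub>M\<^esub> y \<oplus>\<^bsub>M\<^esub> y)"
    using assms by (simp add: smult_r_distr)
  also have "x \<ominus>\<^bsub>M\<^esub> y \<oplus>\<^bsub>M\<^esub> y = x"
    using assms by (simp add: M.minus_eq M.a_assoc M.l_neg)
  finally have "a \<odot>\<^bsub>M\<^esub> x = a \<odot>\<^bsub>M\<^esub> (x \<ominus>\<^bsub>M\<^esub> y) \<oplus>\<^bsub>M\<^esub> a \<odot>\<^bsub>M\<^esub> y" ..
  then show ?thesis
    using assms by (simp add: M.minus_eq M.a_assoc M.r_neg)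
qed

lemma submoduleI:
  assumes "H \<subseteq> carrier M" and "\<zero>\<^bsub>M\<^esub> \<in> H"
    and "\<And>x y. \<lbrakk>x \<in> H; y \<in> H\<rbrakk> \<Longrightarrow> x \<oplus>\<^bsub>M\<^esub> y \<in> H"
    and smult: "\<And>a x. \<lbrakk>a \<in> carrier R; x \<in> H\<rbrakk> \<Longrightarrow> a \<odot>\<^bsub>M\<^esub> x \<in> H"
  shows "submodule H R M"
proof -
  have "\<ominus>\<^bsub>M\<^esub> x \<in> H" if "x \<in> H" for x
    using smult [of "\<ominus> \<one>" x] that assms(1) smult_minus_one [of x] by auto
  then show ?thesis
    using assms by (intro submodule.intro submodule_axioms.intro subgroup.intro)
      (auto simp: a_inv_def)
qed

lemma submoduleD:
  assumes "submodule H R M"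
  shows "H \<subseteq> carrier M" and "\<zero>\<^bsub>M\<^esub> \<in> H"
    and "\<And>x y. \<lbrakk>x \<in> H; y \<in> H\<rbrakk> \<Longrightarrow> x \<oplus>\<^bsub>M\<^esub> y \<in> H"
    and "\<And>a x. \<lbrakk>a \<in> carrier R; x \<in> H\<rbrakk> \<Longrightarrow> a \<odot>\<^bsub>M\<^esub> x \<in> H"
    and "\<And>x. x \<in> H \<Longrightarrow> \<ominus>\<^bsub>M\<^esub> x \<in> H"
proof -
  interpret submodule H R M by fact
  show "H \<subseteq> carrier M" "\<zero>\<^bsub>M\<^esub> \<in> H" "\<And>x y. \<lbrakk>x \<in> H; y \<in> H\<rbrakk> \<Longrightarrow> x \<oplus>\<^bsub>M\<^esub> y \<in> H"
    "\<And>a x. \<lbrakk>a \<in> carrier R; x \<in> H\<rbrakk> \<Longrightarrow> a \<odot>\<^bsub>M\<^esub> x \<in> H"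
    using subset one_closed m_closed by auto
  show "\<ominus>\<^bsub>M\<^esub> x \<in> H" if "x \<in> H" for x
    using m_inv_closed [OF that] by (simp add: a_inv_def)
qed

end

section \<open>Submodules, products and direct sums as modules\<close>

lemma restrict_mod_simps [simp]:
  "carrier (restrict_mod M N) = N"
  "add (restrict_mod M N) = add M"
  "zero (restrict_mod M N) = zero M"
  "smult (restrict_mod M N) = smult M"
  by (simp_all add: restrict_mod_def)

lemma prod_mod_simps [simp]:
  "carrier (prod_mod M N) = carrier M \<times> carrier N"
  "add (prod_mod M N) (x, y) (x', y') = (x \<oplus>\<^bsub>M\<^esub> x', y \<oplus>\<^bsub>N\<^esub> y')"
  "zero (prod_mod M N) = (\<zero>\<^bsub>M\<^esub>, \<zero>\<^bsub>N\<^esub>)"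
  "smult (prod_mod M N) a (x, y) = (a \<odot>\<^bsub>M\<^esub> x, a \<odot>\<^bsub>N\<^esub> y)"
  by (simp_all add: prod_mod_def)

lemma direct_sum_simps [simp]:
  "add (direct_sum I N) f g = (\<lambda>i\<in>I. f i \<oplus>\<^bsub>N i\<^esub> g i)"
  "zero (direct_sum I N) = (\<lambda>i\<in>I. \<zero>\<^bsub>N i\<^esub>)"
  "smult (direct_sum I N) a f = (\<lambda>i\<in>I. a \<odot>\<^bsub>N i\<^esub> f i)"
  by (simp_all add: direct_sum_def)

lemma carrier_direct_sum:
  "f \<in> carrier (direct_sum I N) \<longleftrightarrow>
    f \<in> extensional I \<and> (\<forall>i\<in>I. f i \<in> carrier (N i)) \<and> finite {i \<in> I. f i \<noteq> \<zero>\<^bsub>N i\<^esub>}"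
  by (auto simp: direct_sum_def PiE_iff)

lemma left_module_restrict_mod:
  assumes "left_module R M" and "submodule H R M"
  shows "left_module R (restrict_mod M H)"
proof -
  interpret M: left_module R M by fact
  note [simp] = M.submoduleD(2-5) [OF assms(2)]
  note [simp] = subsetD [OF M.submoduleD(1) [OF assms(2)]]
  have inv: "\<exists>y\<in>H. x \<oplus>\<^bsub>M\<^esub> y = \<zero>\<^bsub>M\<^esub>" if "x \<in> H" for x
    using that M.r_neg [of x] by (auto intro: bexI [of _ "\<ominus>\<^bsub>M\<^esub> x"])
  show ?thesis
    by (rule left_moduleI)
      (auto simp: M.a_ac M.R.ring_axioms M.smult_l_distr M.smult_r_distr M.smult_assoc1
        inv)
qed

lemma left_module_prod_mod:
  assumes "left_module R M" and "left_module R N"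
  shows "left_module R (prod_mod M N)"
proof -
  interpret M: left_module R M by fact
  interpret N: left_module R N by fact
  show ?thesis
    by (rule left_moduleI)
      (auto simp: M.a_ac N.a_ac M.R.ring_axioms M.smult_l_distr M.smult_r_distr M.smult_assoc1
        N.smult_l_distr N.smult_r_distr N.smult_assoc1 M.l_neg N.l_neg
        intro: bexI [of _ "\<ominus>\<^bsub>M\<^esub> x" for x] bexI [of _ "\<ominus>\<^bsub>N\<^esub> x" for x] )
qed

lemma left_module_direct_sum:
  assumes "ring R" and "\<And>i. i \<in> I \<Longrightarrow> left_module R (N i)"
  shows "left_module R (direct_sum I N)"
proof (rule left_moduleI)
  have grp: "abelian_group (N i)" if "i \<in> I" for i
    using assms(2) [OF that] by (rule left_module.axioms(2))
  have mon: "abelian_monoid (N i)" if "i \<in> I" for i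
    using grp [OF that] by (rule abelian_group.axioms(1))
  note [simp] = assms(1) carrier_direct_sum abelian_monoid.a_closed [OF mon]
    abelian_monoid.zero_closed [OF mon] abelian_monoid.l_zero [OF mon]
    abelian_group.a_inv_closed [OF grp] abelian_group.l_neg [OF grp]
    left_module.smult_closed [OF assms(2)] left_module.smult_one [OF assms(2)]
    left_module.smult_zero_right [OF assms(2)] left_module.smult_l_distr [OF assms(2)]
    left_module.smult_r_distr [OF assms(2)] left_module.smult_assoc1 [OF assms(2)]
  show "ring R" by fact
  show "\<zero>\<^bsub>direct_sum I N\<^esub> \<in> carrier (direct_sum I N)"
    by simp
  fix f assume f: "f \<in> carrier (direct_sum I N)"
  show "\<zero>\<^bsub>direct_sum I N\<^esub> \<oplus>\<^bsub>direct_sum I N\<^esub> f = f" "\<one>\<^bsub>R\<^esub> \<odot>\<^bsub>direct_sum I N\<^esub> f = f"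
    using f by (auto simp: fun_eq_iff extensional_def)
  show "\<exists>g\<in>carrier (direct_sum I N). g \<oplus>\<^bsub>direct_sum I N\<^esub> f = \<zero>\<^bsub>direct_sum I N\<^esub>"
  proof (rule bexI)
    let ?g = "\<lambda>i\<in>I. \<ominus>\<^bsub>N i\<^esub> f i"
    show "?g \<oplus>\<^bsub>direct_sum I N\<^esub> f = \<zero>\<^bsub>direct_sum I N\<^esub>"
      using f by (auto simp: fun_eq_iff)
    have "{i \<in> I. \<ominus>\<^bsub>N i\<^esub> f i \<noteq> \<zero>\<^bsub>N i\<^esub>} \<subseteq> {i \<in> I. f i \<noteq> \<zero>\<^bsub>N i\<^esub>}"
      using abelian_group.minus_equality [OF grp] by fastforce
    then have "finite {i \<in> I. \<ominus>\<^bsub>N i\<^esub> f i \<noteq> \<zero>\<^bsub>N i\<^esub>}"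
      by (rule finite_subset) (use f in simp)
    then show "?g \<in> carrier (direct_sum I N)"
      using f by (simp cong: conj_cong)
  qed
  {
    fix a assume a: "a \<in> carrier R"
    have "{i \<in> I. a \<odot>\<^bsub>N i\<^esub> f i \<noteq> \<zero>\<^bsub>N i\<^esub>} \<subseteq> {i \<in> I. f i \<noteq> \<zero>\<^bsub>N i\<^esub>}"
      using a by auto
    then have "finite {i \<in> I. a \<odot>\<^bsub>N i\<^esub> f i \<noteq> \<zero>\<^bsub>N i\<^esub>}"
      by (rule finite_subset) (use f in simp)
    then show "a \<odot>\<^bsub>direct_sum I N\<^esub> f \<in> carrier (direct_sum I N)"
      using f a by (simp cong: conj_cong)
    show "(a \<oplus>\<^bsub>R\<^esub> b) \<odot>\<^bsub>direct_sum I N\<^esub> f =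
        a \<odot>\<^bsub>direct_sum I N\<^esub> f \<oplus>\<^bsub>direct_sum I N\<^esub> b \<odot>\<^bsub>direct_sum I N\<^esub> f"
      "(a \<otimes>\<^bsub>R\<^esub> b) \<odot>\<^bsub>direct_sum I N\<^esub> f = a \<odot>\<^bsub>direct_sum I N\<^esub> (b \<odot>\<^bsub>direct_sum I N\<^esub> f)"
      if "b \<in> carrier R" for b
      using f a that by (auto simp: fun_eq_iff)
  }
  fix g assume g: "g \<in> carrier (direct_sum I N)"
  show "f \<oplus>\<^bsub>direct_sum I N\<^esub> g = g \<oplus>\<^bsub>direct_sum I N\<^esub> f"
    using f g by (intro ext) (simp add: abelian_monoid.a_comm [OF mon])
  show "a \<odot>\<^bsub>direct_sum I N\<^esub> (f \<oplus>\<^bsub>direct_sum I N\<^esub> g) =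
      a \<odot>\<^bsub>direct_sum I N\<^esub> f \<oplus>\<^bsub>direct_sum I N\<^esub> a \<odot>\<^bsub>direct_sum I N\<^esub> g"
    if "a \<in> carrier R" for a
    using f g that by (auto simp: fun_eq_iff)
  show "f \<oplus>\<^bsub>direct_sum I N\<^esub> g \<oplus>\<^bsub>direct_sum I N\<^esub> h = f \<oplus>\<^bsub>direct_sum I N\<^esub> (g \<oplus>\<^bsub>direct_sum I N\<^esub> h)"
    if "h \<in> carrier (direct_sum I N)" for h
    using f g that by (intro ext) (simp add: abelian_monoid.a_assoc [OF mon])
  have "{i \<in> I. f i \<oplus>\<^bsub>N i\<^esub> g i \<noteq> \<zero>\<^bsub>N i\<^esub>} \<subseteq>
      {i \<in> I. f i \<noteq> \<zero>\<^bsub>N i\<^esub>} \<union> {i \<in> I. g i \<noteq> \<zero>\<^bsub>N i\<^esub>}"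
    by auto
  then have "finite {i \<in> I. f i \<oplus>\<^bsub>N i\<^esub> g i \<noteq> \<zero>\<^bsub>N i\<^esub>}"
    by (rule finite_subset) (use f g in simp)
  then show "f \<oplus>\<^bsub>direct_sum I N\<^esub> g \<in> carrier (direct_sum I N)"
    using f g by (simp cong: conj_cong)
qed

section \<open>Homomorphisms\<close>

lemma lmod_homI:
  assumes "\<And>x. x \<in> carrier M \<Longrightarrow> f x \<in> carrier N"
    and "\<And>x y. \<lbrakk>x \<in> carrier M; y \<in> carrier M\<rbrakk> \<Longrightarrow> f (x \<oplus>\<^bsub>M\<^esub> y) = f x \<oplus>\<^bsub>N\<^esub> f y"
    and "\<And>a x. \<lbrakk>a \<in> carrier R; x \<in> carrier M\<rbrakk> \<Longrightarrow> f (a \<odot>\<^bsub>M\<^esub> x) = a \<odot>\<^bsub>N\<^esub> f x"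
  shows "f \<in> lmod_hom R M N"
  using assms by (auto simp: lmod_hom_def)

lemma lmod_homD:
  assumes "f \<in> lmod_hom R M N"
  shows "\<And>x. x \<in> carrier M \<Longrightarrow> f x \<in> carrier N"
    and "\<And>x y. \<lbrakk>x \<in> carrier M; y \<in> carrier M\<rbrakk> \<Longrightarrow> f (x \<oplus>\<^bsub>M\<^esub> y) = f x \<oplus>\<^bsub>N\<^esub> f y"
    and "\<And>a x. \<lbrakk>a \<in> carrier R; x \<in> carrier M\<rbrakk> \<Longrightarrow> f (a \<odot>\<^bsub>M\<^esub> x) = a \<odot>\<^bsub>N\<^esub> f x"
  using assms by (auto simp: lmod_hom_def)

locale lmod_map = source: left_module R M + target: left_module R N
  for R (structure) and M (structure) and N (structure) and f +
  assumes hom: "f \<in> lmod_hom R M N"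
begin

lemma map_closed [simp]: "x \<in> carrier M \<Longrightarrow> f x \<in> carrier N"
  and map_add [simp]: "\<lbrakk>x \<in> carrier M; y \<in> carrier M\<rbrakk> \<Longrightarrow> f (x \<oplus>\<^bsub>M\<^esub> y) = f x \<oplus>\<^bsub>N\<^esub> f y"
  and map_smult [simp]: "\<lbrakk>a \<in> carrier R; x \<in> carrier M\<rbrakk> \<Longrightarrow> f (a \<odot>\<^bsub>M\<^esub> x) = a \<odot>\<^bsub>N\<^esub> f x"
  using lmod_homD [OF hom] by blast+

lemma map_zero [simp]: "f \<zero>\<^bsub>M\<^esub> = \<zero>\<^bsub>N\<^esub>"
  using map_smult [of \<zero> "\<zero>\<^bsub>M\<^esub>"] by simp

lemma map_minus [simp]: "x \<in> carrier M \<Longrightarrow> f (\<ominus>\<^bsub>M\<^esub> x) = \<ominus>\<^bsub>N\<^esub> f x"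
  using map_smult [of "\<ominus> \<one>" x]
  by (simp add: source.smult_minus_one target.smult_minus_one)

lemma map_diff [simp]:
  "\<lbrakk>x \<in> carrier M; y \<in> carrier M\<rbrakk> \<Longrightarrow> f (x \<ominus>\<^bsub>M\<^esub> y) = f x \<ominus>\<^bsub>N\<^esub> f y"
  by (simp add: source.M.minus_eq target.M.minus_eq)

end

subsection \<open>Quotient modules\<close>

locale left_module_submodule = left_module R M
  for R :: "('a, 'k) ring_scheme" (structure) and M :: "('a, 'm) module" (structure) +
  fixes D
  assumes D: "submodule D R M"
begin

lemma abelian_subgroup_submodule: "abelian_subgroup D M"
  using D M.a_comm_group by (intro abelian_subgroupI2) (auto simp: submodule_def)

lemma coset_eqI:
  assumes "p \<in> carrier M" and "d \<in> D"
  shows "D +>\<^bsub>M\<^esub> (d \<oplus>\<^bsub>M\<^esub> p) = D +>\<^bsub>M\<^esub> p"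
proof -
  interpret abelian_subgroup D M by (rule abelian_subgroup_submodule)
  have "d \<oplus>\<^bsub>M\<^esub> p \<in> D +>\<^bsub>M\<^esub> p"
    using assms by (auto simp: a_r_coset_def')
  then show ?thesis
    using assms a_repr_independence' by metis
qed

lemma coset_memD:
  assumes "q \<in> D +>\<^bsub>M\<^esub> p"
  shows "\<exists>d\<in>D. q = d \<oplus>\<^bsub>M\<^esub> p"
  using assms by (auto simp: a_r_coset_def')

lemma coset_self: "p \<in> carrier M \<Longrightarrow> p \<in> D +>\<^bsub>M\<^esub> p"
  using abelian_subgroup.a_rcos_self [OF abelian_subgroup_submodule] .

lemma coset_eqD:
  assumes "D +>\<^bsub>M\<^esub> p = D +>\<^bsub>M\<^esub> q" and "p \<in> carrier M"
  shows "\<exists>d\<in>D. p = d \<oplus>\<^bsub>M\<^esub> q"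
  using assms coset_self coset_memD by metis

lemma carrier_quotient_mod: "carrier (quotient_mod M D) = (\<lambda>p. D +>\<^bsub>M\<^esub> p) ` carrier M"
  by (auto simp: quotient_mod_def A_RCOSETS_def')

lemma zero_quotient_mod: "\<zero>\<^bsub>quotient_mod M D\<^esub> = D +>\<^bsub>M\<^esub> \<zero>\<^bsub>M\<^esub>"
  using submoduleD(1) [OF D] by (auto simp: quotient_mod_def)

lemma add_quotient_mod:
  "\<lbrakk>p \<in> carrier M; q \<in> carrier M\<rbrakk> \<Longrightarrow>
    (D +>\<^bsub>M\<^esub> p) \<oplus>\<^bsub>quotient_mod M D\<^esub> (D +>\<^bsub>M\<^esub> q) = D +>\<^bsub>M\<^esub> (p \<oplus>\<^bsub>M\<^esub> q)"
  using abelian_subgroup.a_rcos_sum [OF abelian_subgroup_submodule]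
  by (simp add: quotient_mod_def)

text \<open>The union in \<open>quotient_mod\<close> ranges over all representatives of the coset.
  Each differs from \<open>p\<close> by an element of \<open>D\<close>, and \<open>D\<close> is
  stable under scalars, so all members of the union coincide.\<close>

lemma smult_quotient_mod:
  assumes "a \<in> carrier R" and "p \<in> carrier M"
  shows "a \<odot>\<^bsub>quotient_mod M D\<^esub> (D +>\<^bsub>M\<^esub> p) = D +>\<^bsub>M\<^esub> (a \<odot>\<^bsub>M\<^esub> p)"
proof -
  have "D +>\<^bsub>M\<^esub> (a \<odot>\<^bsub>M\<^esub> q) = D +>\<^bsub>M\<^esub> (a \<odot>\<^bsub>M\<^esub> p)" if q: "q \<in> D +>\<^bsub>M\<^esub> p" for q
  proof -
    obtain d where d: "d \<in> D" "q = d \<oplus>\<^bsub>M\<^esub> p"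
      using coset_memD [OF q] by blast
    then have "a \<odot>\<^bsub>M\<^esub> q = a \<odot>\<^bsub>M\<^esub> d \<oplus>\<^bsub>M\<^esub> a \<odot>\<^bsub>M\<^esub> p"
      using assms submoduleD(1) [OF D] by (auto simp: smult_r_distr)
    then show ?thesis
      using assms d submoduleD(4) [OF D] by (simp add: coset_eqI)
  qed
  then have "(\<Union>q\<in>D +>\<^bsub>M\<^esub> p. D +>\<^bsub>M\<^esub> (a \<odot>\<^bsub>M\<^esub> q)) = D +>\<^bsub>M\<^esub> (a \<odot>\<^bsub>M\<^esub> p)"
    using coset_self [OF assms(2)] by blast
  then show ?thesis
    by (simp add: quotient_mod_def)
qed

lemma left_module_quotient_mod: "left_module R (quotient_mod M D)"
proof (rule left_moduleI)
  show "\<exists>y\<in>carrier (quotient_mod M D). y \<oplus>\<^bsub>quotient_mod M D\<^esub> x = \<zero>\<^bsub>quotient_mod M D\<^esub>"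
    if x: "x \<in> carrier (quotient_mod M D)" for x
  proof -
    obtain p where "p \<in> carrier M" "x = D +>\<^bsub>M\<^esub> p"
      using x by (auto simp: carrier_quotient_mod)
    then have "D +>\<^bsub>M\<^esub> (\<ominus>\<^bsub>M\<^esub> p) \<in> carrier (quotient_mod M D)"
      "(D +>\<^bsub>M\<^esub> (\<ominus>\<^bsub>M\<^esub> p)) \<oplus>\<^bsub>quotient_mod M D\<^esub> x = \<zero>\<^bsub>quotient_mod M D\<^esub>"
      by (auto simp: carrier_quotient_mod add_quotient_mod zero_quotient_mod M.l_neg)
    then show ?thesis ..
  qed
qed (auto simp: carrier_quotient_mod add_quotient_mod zero_quotient_mod smult_quotient_mod
      R.ring_axioms M.a_ac smult_l_distr smult_r_distr smult_assoc1)

end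


section \<open>Extensions\<close>

text \<open>Locale counterpart of \<open>is_ses\<close>: both maps become instances of
  \<open>lmod_map\<close>, whose rules then simplify terms in all three modules.\<close>

locale extension = incl: lmod_map R Y "mid E" "incl E" + proj: lmod_map R "mid E" X "proj E"
  for R (structure) and Y (structure) and E (structure) and X (structure) +
  assumes incl_inj: "inj_on (incl E) (carrier Y)"
    and exact: "incl E ` carrier Y = {m \<in> carrier (mid E). proj E m = \<zero>\<^bsub>X\<^esub>}"
    and proj_surj: "proj E ` carrier (mid E) = carrier X"
begin

lemma proj_incl [simp]: "y \<in> carrier Y \<Longrightarrow> proj E (incl E y) = \<zero>\<^bsub>X\<^esub>"
  using exact by blast

lemma incl_eq_iff [simp]:
  "\<lbrakk>y \<in> carrier Y; y' \<in> carrier Y\<rbrakk> \<Longrightarrow> incl E y = incl E y' \<longleftrightarrow> y = y'"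
  using incl_inj by (auto simp: inj_on_def)

lemma incl_eq_zero_iff [simp]: "y \<in> carrier Y \<Longrightarrow> incl E y = \<zero>\<^bsub>mid E\<^esub> \<longleftrightarrow> y = \<zero>\<^bsub>Y\<^esub>"
  using incl_eq_iff [of y "\<zero>\<^bsub>Y\<^esub>"] by simp

lemma proj_eq_zeroE:
  assumes "m \<in> carrier (mid E)" and "proj E m = \<zero>\<^bsub>X\<^esub>"
  obtains y where "y \<in> carrier Y" and "m = incl E y"
  using assms exact by blast

lemma proj_lift:
  assumes "x \<in> carrier X"
  obtains m where "m \<in> carrier (mid E)" and "proj E m = x"
proof -
  have "x \<in> proj E ` carrier (mid E)"
    using assms by (simp add: proj_surj)
  then show thesis
    by (elim imageE) (simp add: that)
qed

lemma proj_eqE: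
  assumes "m \<in> carrier (mid E)" and "n \<in> carrier (mid E)" and "proj E m = proj E n"
  obtains y where "y \<in> carrier Y" and "m = n \<oplus>\<^bsub>mid E\<^esub> incl E y"
proof -
  have "proj E (m \<ominus>\<^bsub>mid E\<^esub> n) = \<zero>\<^bsub>X\<^esub>"
    using assms by simp
  then obtain y where y: "y \<in> carrier Y" "m \<ominus>\<^bsub>mid E\<^esub> n = incl E y"
    using assms by (elim proj_eq_zeroE [rotated]) simp_all
  then have "m = n \<oplus>\<^bsub>mid E\<^esub> incl E y"
    using assms by (simp flip: y(2) add: incl.target.M.minus_eq incl.target.M.a_lcomm incl.target.M.r_neg)
  with y(1) show thesis
    by (rule that)
qed

end

lemma is_ses_iff_extension: "is_ses R Y E X \<longleftrightarrow> extension R Y E X"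
  by (auto simp: is_ses_def extension_def extension_axioms_def lmod_map_def lmod_map_axioms_def)

lemma extensionI:
  assumes "left_module R Y" and "left_module R (mid E)" and "left_module R X"
    and "incl E \<in> lmod_hom R Y (mid E)" and "proj E \<in> lmod_hom R (mid E) X"
    and "\<And>y. \<lbrakk>y \<in> carrier Y; incl E y = \<zero>\<^bsub>mid E\<^esub>\<rbrakk> \<Longrightarrow> y = \<zero>\<^bsub>Y\<^esub>"
    and "\<And>y. y \<in> carrier Y \<Longrightarrow> proj E (incl E y) = \<zero>\<^bsub>X\<^esub>"
    and "\<And>m. \<lbrakk>m \<in> carrier (mid E); proj E m = \<zero>\<^bsub>X\<^esub>\<rbrakk> \<Longrightarrow> \<exists>y\<in>carrier Y. m = incl E y"
    and "\<And>x. x \<in> carrier X \<Longrightarrow> \<exists>m\<in>carrier (mid E). proj E m = x"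
  shows "extension R Y E X"
proof -
  interpret incl: lmod_map R Y "mid E" "incl E"
    using assms by (simp add: lmod_map_def lmod_map_axioms_def)
  interpret proj: lmod_map R "mid E" X "proj E"
    using assms by (simp add: lmod_map_def lmod_map_axioms_def)
  have "y = y'" if "y \<in> carrier Y" "y' \<in> carrier Y" "incl E y = incl E y'" for y y'
  proof -
    have "incl E (y \<ominus>\<^bsub>Y\<^esub> y') = \<zero>\<^bsub>mid E\<^esub>"
      using that by simp
    then have "y \<ominus>\<^bsub>Y\<^esub> y' = \<zero>\<^bsub>Y\<^esub>"
      using that assms(6) by simp
    then show ?thesis
      using that incl.source.diff_eq_zeroD by blast
  qed
  moreover have "incl E ` carrier Y = {m \<in> carrier (mid E). proj E m = \<zero>\<^bsub>X\<^esub>}"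
    using assms(7,8) by auto
  moreover have "proj E ` carrier (mid E) = carrier X"
  proof
    show "carrier X \<subseteq> proj E ` carrier (mid E)"
      using assms(9) by force
  qed auto
  ultimately show ?thesis
    by unfold_locales (auto simp: inj_on_def)
qed


subsection \<open>Equivalence of extensions\<close>

lemma ses_equivE:
  assumes "ses_equiv R Y G H"
  obtains h where "h \<in> lmod_hom R (mid G) (mid H)"
    and "bij_betw h (carrier (mid G)) (carrier (mid H))"
    and "\<And>y. y \<in> carrier Y \<Longrightarrow> h (incl G y) = incl H y"
    and "\<And>m. m \<in> carrier (mid G) \<Longrightarrow> proj H (h m) = proj G m"
  using assms by (auto simp: ses_equiv_def lmod_iso_def)

text \<open>
  Extensions are often compared through a third module mapping to both of them.  The images of such
  maps form a relation as below, which is then the graph of an isomorphism.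
\<close>

lemma ses_equiv_of_relation:
  assumes "extension R Y G X" and "extension R Y H X"
    and dom: "\<And>m n. (m, n) \<in> S \<Longrightarrow>
      m \<in> carrier (mid G) \<and> n \<in> carrier (mid H) \<and> proj G m = proj H n"
    and add: "\<And>m n m' n'. \<lbrakk>(m, n) \<in> S; (m', n') \<in> S\<rbrakk> \<Longrightarrow>
      (m \<oplus>\<^bsub>mid G\<^esub> m', n \<oplus>\<^bsub>mid H\<^esub> n') \<in> S"
    and smult: "\<And>a m n. \<lbrakk>a \<in> carrier R; (m, n) \<in> S\<rbrakk> \<Longrightarrow> (a \<odot>\<^bsub>mid G\<^esub> m, a \<odot>\<^bsub>mid H\<^esub> n) \<in> S"
    and incl: "\<And>y. y \<in> carrier Y \<Longrightarrow> (incl G y, incl H y) \<in> S"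
    and onto: "\<And>x. x \<in> carrier X \<Longrightarrow> \<exists>m n. (m, n) \<in> S \<and> proj G m = x"
    and zero: "\<And>n. (\<zero>\<^bsub>mid G\<^esub>, n) \<in> S \<Longrightarrow> n = \<zero>\<^bsub>mid H\<^esub>"
  shows "ses_equiv R Y G H"
proof -
  interpret G: extension R Y G X by fact
  interpret H: extension R Y H X by fact
  have diff: "(m \<ominus>\<^bsub>mid G\<^esub> m', n \<ominus>\<^bsub>mid H\<^esub> n') \<in> S" if "(m, n) \<in> S" "(m', n') \<in> S" for m n m' n'
    using add [OF that(1) smult [OF _ that(2), of "\<ominus>\<^bsub>R\<^esub> \<one>\<^bsub>R\<^esub>"]] dom [OF that(2)]
    by (simp add: G.incl.target.smult_minus_one H.incl.target.smult_minus_one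
        G.incl.target.M.minus_eq H.incl.target.M.minus_eq)
  \<comment> \<open>Some pair in \<open>S\<close> has the projection of \<open>m\<close>; the
    remaining difference comes from \<open>Y\<close>, where the hypothesis \<open>incl\<close>
    supplies a pair.\<close>
  have total: "\<exists>n. (m, n) \<in> S" if m: "m \<in> carrier (mid G)" for m
  proof -
    obtain m0 n0 where S0: "(m0, n0) \<in> S" "proj G m0 = proj G m"
      using onto [of "proj G m"] m by auto
    then obtain y where "y \<in> carrier Y" "m = m0 \<oplus>\<^bsub>mid G\<^esub> incl G y"
      using G.proj_eqE [OF m, of m0] dom by metis
    then show ?thesis
      using add [OF S0(1) incl] by blast
  qed
  have total': "\<exists>m. (m, n) \<in> S" if n: "n \<in> carrier (mid H)" for n
  proof -
    obtain m0 n0 where S0: "(m0, n0) \<in> S" "proj G m0 = proj H n"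
      using onto [of "proj H n"] n by auto
    then obtain y where "y \<in> carrier Y" "n = n0 \<oplus>\<^bsub>mid H\<^esub> incl H y"
      using H.proj_eqE [OF n, of n0] dom by metis
    then show ?thesis
      using add [OF S0(1) incl] by blast
  qed
  have unique: "n = n'" if "(m, n) \<in> S" "(m, n') \<in> S" for m n n'
  proof -
    have "(\<zero>\<^bsub>mid G\<^esub>, n \<ominus>\<^bsub>mid H\<^esub> n') \<in> S"
      using diff [OF that] dom [OF that(1)] by simp
    then have "n \<ominus>\<^bsub>mid H\<^esub> n' = \<zero>\<^bsub>mid H\<^esub>"
      by (rule zero)
    then show ?thesis
      using dom [OF that(1)] dom [OF that(2)] H.incl.target.diff_eq_zeroD by blast
  qed
  \<comment> \<open>As in the short five lemma: for a pair whose second entry is zero, the first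
    entry is the image of some \<open>y\<close>. Comparing with the pair of images of
    \<open>y\<close> shows that \<open>y\<close> vanishes in \<open>mid H\<close>, hence in
    \<open>Y\<close>.\<close>
  have unique': "m = m'" if "(m, n) \<in> S" "(m', n) \<in> S" for m m' n
  proof -
    have *: "(m \<ominus>\<^bsub>mid G\<^esub> m', \<zero>\<^bsub>mid H\<^esub>) \<in> S"
      using diff [OF that] dom [OF that(1)] by simp
    then obtain y where y: "y \<in> carrier Y" "m \<ominus>\<^bsub>mid G\<^esub> m' = incl G y"
      using G.proj_eq_zeroE [of "m \<ominus>\<^bsub>mid G\<^esub> m'"] dom [OF *] by auto
    then have "\<zero>\<^bsub>mid H\<^esub> = incl H y"
      using unique [OF * ] incl [OF y(1)] by simp
    then have "y = \<zero>\<^bsub>Y\<^esub>"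
      using y H.incl_eq_zero_iff by metis
    then have "m \<ominus>\<^bsub>mid G\<^esub> m' = \<zero>\<^bsub>mid G\<^esub>"
      using y by simp
    then show ?thesis
      using dom [OF that(1)] dom [OF that(2)] G.incl.target.diff_eq_zeroD by blast
  qed
  define h where "h = (\<lambda>m. SOME n. (m, n) \<in> S)"
  have h: "(m, h m) \<in> S" if "m \<in> carrier (mid G)" for m
    unfolding h_def using total [OF that] by (rule someI_ex)
  have eq: "h m = n" if "(m, n) \<in> S" for m n
    using h unique that dom by blast
  have "h \<in> lmod_hom R (mid G) (mid H)"
  proof (rule lmod_homI)
    show "h (m \<oplus>\<^bsub>mid G\<^esub> m') = h m \<oplus>\<^bsub>mid H\<^esub> h m'"
      if "m \<in> carrier (mid G)" "m' \<in> carrier (mid G)" for m m'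
      by (rule eq [OF add [OF h h]]) fact+
    show "h (a \<odot>\<^bsub>mid G\<^esub> m) = a \<odot>\<^bsub>mid H\<^esub> h m" if "a \<in> carrier R" "m \<in> carrier (mid G)" for a m
      by (rule eq [OF smult [OF _ h]]) fact+
    show "h m \<in> carrier (mid H)" if "m \<in> carrier (mid G)" for m
      using dom [OF h [OF that]] by blast
  qed
  moreover have "bij_betw h (carrier (mid G)) (carrier (mid H))"
  proof (rule bij_betwI')
    show "(h m = h m') = (m = m')" if "m \<in> carrier (mid G)" "m' \<in> carrier (mid G)" for m m'
      using h that unique' by metis
    show "h m \<in> carrier (mid H)" if "m \<in> carrier (mid G)" for m
      using dom [OF h [OF that]] by blast
    show "\<exists>m\<in>carrier (mid G). n = h m" if "n \<in> carrier (mid H)" for n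
      using total' [OF that] eq dom by metis
  qed
  ultimately show ?thesis
    unfolding ses_equiv_def lmod_iso_def using eq incl h dom by (metis (mono_tags, lifting) mem_Collect_eq)
qed

text \<open>The short five lemma: the graph of \<open>g\<close> is a relation of the kind just
  treated, so bijectivity of \<open>g\<close> need not be checked.\<close>

lemma ses_equiv_of_hom:
  assumes "extension R Y G X" and "extension R Y H X"
    and "g \<in> lmod_hom R (mid G) (mid H)"
    and "\<And>y. y \<in> carrier Y \<Longrightarrow> g (incl G y) = incl H y"
    and "\<And>m. m \<in> carrier (mid G) \<Longrightarrow> proj H (g m) = proj G m"
  shows "ses_equiv R Y G H"
proof -
  interpret G: extension R Y G X by fact
  interpret H: extension R Y H X by fact
  interpret g: lmod_map R "mid G" "mid H" g
    by unfold_locales fact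
  show ?thesis
  proof (rule ses_equiv_of_relation [where S = "(\<lambda>m. (m, g m)) ` carrier (mid G)"])
    show "\<exists>m n. (m, n) \<in> (\<lambda>m. (m, g m)) ` carrier (mid G) \<and> proj G m = x" if "x \<in> carrier X" for x
      using that by (blast elim: G.proj_lift)
  qed (use assms in \<open>auto simp: image_iff\<close>)
qed

lemma ses_equiv_refl:
  assumes "extension R Y G X"
  shows "ses_equiv R Y G G"
  using assms by (rule ses_equiv_of_hom [where g = id]) (auto intro: assms lmod_homI)

text \<open>The converse of the graph of the isomorphism serves as the relation, so that no inverse
  map has to be shown linear.\<close>

lemma ses_equiv_sym:
  assumes "extension R Y G X" and "extension R Y H X" and "ses_equiv R Y G H"
  shows "ses_equiv R Y H G"
proof -
  interpret G: extension R Y G X by fact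
  interpret H: extension R Y H X by fact
  from assms(3) obtain h where h: "h \<in> lmod_hom R (mid G) (mid H)"
    "bij_betw h (carrier (mid G)) (carrier (mid H))"
    "\<And>y. y \<in> carrier Y \<Longrightarrow> h (incl G y) = incl H y"
    "\<And>m. m \<in> carrier (mid G) \<Longrightarrow> proj H (h m) = proj G m"
    by (rule ses_equivE) blast
  interpret h: lmod_map R "mid G" "mid H" h
    by unfold_locales (rule h)
  show ?thesis
  proof (rule ses_equiv_of_relation [where S = "(\<lambda>m. (h m, m)) ` carrier (mid G)"])
    show "\<exists>m n. (m, n) \<in> (\<lambda>m. (h m, m)) ` carrier (mid G) \<and> proj H m = x" if x: "x \<in> carrier X" for x
    proof -
      obtain m where "m \<in> carrier (mid G)" "proj G m = x"
        using x by (rule G.proj_lift)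
      then show ?thesis
        using h(4) [of m] by (intro exI [of _ "h m"] exI [of _ m]) simp
    qed
    show "n = \<zero>\<^bsub>mid G\<^esub>" if "(\<zero>\<^bsub>mid H\<^esub>, n) \<in> (\<lambda>m. (h m, m)) ` carrier (mid G)" for n
      using that h(2) h.map_zero unfolding bij_betw_def
      by (smt (verit) G.incl.target.M.zero_closed image_iff inj_onD prod.inject)
    show "(incl H y, incl G y) \<in> (\<lambda>m. (h m, m)) ` carrier (mid G)" if "y \<in> carrier Y" for y
      using h(3) [OF that] that by (auto simp: image_iff intro: bexI [of _ "incl G y"])
  qed (use assms h in \<open>auto simp: image_iff\<close>)
qed

lemma ses_equiv_trans:
  assumes "extension R Y G X" and "extension R Y K X"
    and "ses_equiv R Y G H" and "ses_equiv R Y H K"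
  shows "ses_equiv R Y G K"
proof -
  interpret G: extension R Y G X by fact
  interpret K: extension R Y K X by fact
  from assms(3) obtain g where g: "g \<in> lmod_hom R (mid G) (mid H)"
    "\<And>y. y \<in> carrier Y \<Longrightarrow> g (incl G y) = incl H y"
    "\<And>m. m \<in> carrier (mid G) \<Longrightarrow> proj H (g m) = proj G m"
    by (rule ses_equivE) blast
  from assms(4) obtain h where h: "h \<in> lmod_hom R (mid H) (mid K)"
    "\<And>y. y \<in> carrier Y \<Longrightarrow> h (incl H y) = incl K y"
    "\<And>m. m \<in> carrier (mid H) \<Longrightarrow> proj K (h m) = proj H m"
    by (rule ses_equivE) blast
  show ?thesis
    using assms(1,2)
    by (rule ses_equiv_of_hom [where g = "\<lambda>m. h (g m)"])
      (use g h in \<open>auto intro!: lmod_homI simp: lmod_homD [OF g(1)] lmod_homD [OF h(1)]\<close>)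
qed

text \<open>
  A set-theoretic section of the projection puts the middle term in bijection with a subset of the
  product type.
\<close>

lemma extension_on_product_type:
  fixes E :: "('a, 'y, 'm, 'x) ses"
  assumes "extension R Y E X"
  obtains G :: "('a, 'y, 'x) ext" where "extension R Y G X" and "ses_equiv R Y E G"
proof -
  interpret E: extension R Y E X by fact
  have "\<forall>x\<in>carrier X. \<exists>m. m \<in> carrier (mid E) \<and> proj E m = x"
    by (blast elim: E.proj_lift)
  then obtain s where s: "\<And>x. x \<in> carrier X \<Longrightarrow> s x \<in> carrier (mid E) \<and> proj E (s x) = x"
    by metis
  have "\<exists>y\<in>carrier Y. m = s (proj E m) \<oplus>\<^bsub>mid E\<^esub> incl E y" if "m \<in> carrier (mid E)" for m
    using E.proj_eqE [OF that, of "s (proj E m)"] s [of "proj E m"] that by (metis E.proj.map_closed)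
  then obtain c where c: "\<And>m. m \<in> carrier (mid E) \<Longrightarrow>
      c m \<in> carrier Y \<and> m = s (proj E m) \<oplus>\<^bsub>mid E\<^esub> incl E (c m)"
    by metis
  \<comment> \<open>\<open>c m\<close> is the coordinate of \<open>m\<close> in \<open>Y\<close>
    relative to the section \<open>s\<close>. Both coordinates together determine \<open>m\<close>,
    so \<open>\<theta>\<close> is injective; it need not be additive.\<close>
  define \<theta> where "\<theta> m = (c m, proj E m)" for m
  have inj: "inj_on \<theta> (carrier (mid E))"
    by (rule inj_onI) (metis \<theta>_def c prod.inject)
  define \<theta>' where "\<theta>' = inv_into (carrier (mid E)) \<theta>"
  have [simp]: "\<theta>' (\<theta> m) = m" if "m \<in> carrier (mid E)" for m
    using that inj by (simp add: \<theta>'_def)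
  \<comment> \<open>The module structure is transported along \<open>\<theta>\<close>. The
    componentwise structure of \<open>prod_mod\<close> would only give the split extension.\<close>
  define G :: "('a, 'y, 'x) ext" where
    "G = \<lparr>mid = \<lparr>carrier = \<theta> ` carrier (mid E), mult = undefined, one = undefined,
        zero = \<theta> \<zero>\<^bsub>mid E\<^esub>, add = (\<lambda>p q. \<theta> (\<theta>' p \<oplus>\<^bsub>mid E\<^esub> \<theta>' q)),
        smult = (\<lambda>a p. \<theta> (a \<odot>\<^bsub>mid E\<^esub> \<theta>' p))\<rparr>,
      incl = (\<lambda>y. \<theta> (incl E y)), proj = (\<lambda>p. proj E (\<theta>' p))\<rparr>"
  have [simp]: "carrier (mid G) = \<theta> ` carrier (mid E)" "\<zero>\<^bsub>mid G\<^esub> = \<theta> \<zero>\<^bsub>mid E\<^esub>"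
    "p \<oplus>\<^bsub>mid G\<^esub> q = \<theta> (\<theta>' p \<oplus>\<^bsub>mid E\<^esub> \<theta>' q)" "a \<odot>\<^bsub>mid G\<^esub> p = \<theta> (a \<odot>\<^bsub>mid E\<^esub> \<theta>' p)"
    "incl G y = \<theta> (incl E y)" "proj G p = proj E (\<theta>' p)" for p q a y
    by (simp_all add: G_def)
  have mod: "left_module R (mid G)"
  proof (rule left_moduleI)
    show "\<exists>q\<in>carrier (mid G). q \<oplus>\<^bsub>mid G\<^esub> p = \<zero>\<^bsub>mid G\<^esub>" if p: "p \<in> carrier (mid G)" for p
    proof -
      obtain m where "m \<in> carrier (mid E)" "p = \<theta> m"
        using p by auto
      then show ?thesis
        by (intro bexI [of _ "\<theta> (\<ominus>\<^bsub>mid E\<^esub> m)"]) (auto simp: E.incl.target.M.l_neg)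
    qed
  qed (auto simp: E.incl.target.M.a_ac E.incl.target.smult_l_distr E.incl.target.smult_r_distr
        E.incl.target.smult_assoc1 E.incl.source.R.ring_axioms)
  have G: "extension R Y G X"
  proof (rule extensionI)
    show "incl G \<in> lmod_hom R Y (mid G)"
      by (rule lmod_homI) auto
    show "proj G \<in> lmod_hom R (mid G) X"
      by (rule lmod_homI) auto
    show "y = \<zero>\<^bsub>Y\<^esub>" if "y \<in> carrier Y" "incl G y = \<zero>\<^bsub>mid G\<^esub>" for y
      using that inj_onD [OF inj, of "incl E y" "\<zero>\<^bsub>mid E\<^esub>"] by simp
    show "\<exists>y\<in>carrier Y. p = incl G y" if "p \<in> carrier (mid G)" "proj G p = \<zero>\<^bsub>X\<^esub>" for p
      using that by clarsimp (metis (mono_tags, lifting) E.exact imageE mem_Collect_eq)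
    show "\<exists>p\<in>carrier (mid G). proj G p = x" if "x \<in> carrier X" for x
      using that by (auto elim: E.proj_lift)
  qed (auto simp: mod E.incl.source.left_module_axioms E.proj.target.left_module_axioms)
  moreover have "ses_equiv R Y E G"
    using assms G by (rule ses_equiv_of_hom [where g = \<theta>]) (auto intro: lmod_homI)
  ultimately show thesis
    by (rule that)
qed

subsection \<open>Pull-backs and push-outs\<close>

lemma extension_split_ses:
  assumes "left_module R Y" and "left_module R X"
  shows "extension R Y (split_ses Y X) X"
proof -
  interpret Y: left_module R Y by fact
  interpret X: left_module R X by fact
  show ?thesis
    by (rule extensionI)
      (auto simp: split_ses_def intro!: left_module_prod_mod lmod_homI assms)
qed

lemma extension_prod_ses:
  assumes "extension R Y E X" and "extension R Z F W"
  shows "extension R (prod_mod Y Z) (prod_ses E F) (prod_mod X W)"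
proof -
  interpret E: extension R Y E X by fact
  interpret F: extension R Z F W by fact
  note mods = E.incl.source.left_module_axioms F.incl.source.left_module_axioms
    E.incl.target.left_module_axioms F.incl.target.left_module_axioms
    E.proj.target.left_module_axioms F.proj.target.left_module_axioms
  show ?thesis
  proof (rule extensionI)
    show "\<exists>y\<in>carrier (prod_mod Y Z). p = incl (prod_ses E F) y"
      if "p \<in> carrier (mid (prod_ses E F))" "proj (prod_ses E F) p = \<zero>\<^bsub>prod_mod X W\<^esub>" for p
      using that by (fastforce simp: prod_ses_def elim: E.proj_eq_zeroE F.proj_eq_zeroE)
    show "\<exists>m\<in>carrier (mid (prod_ses E F)). proj (prod_ses E F) m = x"
      if "x \<in> carrier (prod_mod X W)" for x
      using that by (fastforce simp: prod_ses_def elim: E.proj_lift F.proj_lift)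
  qed (auto simp: prod_ses_def intro!: left_module_prod_mod lmod_homI mods)
qed

lemma extension_pullback_ses:
  assumes "extension R Y E X" and "left_module R Z" and "\<phi> \<in> lmod_hom R Z X"
  shows "extension R Y (pullback_ses Z \<phi> E) Z"
proof -
  interpret E: extension R Y E X by fact
  interpret Z: left_module R Z by fact
  interpret \<phi>: lmod_map R Z X \<phi>
    by unfold_locales fact
  interpret P: left_module R "prod_mod (mid E) Z"
    by (intro left_module_prod_mod E.incl.target.left_module_axioms assms)
  have "submodule {(m, z). m \<in> carrier (mid E) \<and> z \<in> carrier Z \<and> proj E m = \<phi> z} R
      (prod_mod (mid E) Z)"
    by (rule P.submoduleI) auto
  then have mod: "left_module R (mid (pullback_ses Z \<phi> E))"
    by (auto simp: pullback_ses_def intro: left_module_restrict_mod P.left_module_axioms)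
  show ?thesis
  proof (rule extensionI)
    show "\<exists>y\<in>carrier Y. p = incl (pullback_ses Z \<phi> E) y"
      if "p \<in> carrier (mid (pullback_ses Z \<phi> E))" "proj (pullback_ses Z \<phi> E) p = \<zero>\<^bsub>Z\<^esub>" for p
      using that by (auto simp: pullback_ses_def elim: E.proj_eq_zeroE)
    show "\<exists>m\<in>carrier (mid (pullback_ses Z \<phi> E)). proj (pullback_ses Z \<phi> E) m = z"
      if "z \<in> carrier Z" for z
    proof -
      have "\<phi> z \<in> carrier X"
        using that by simp
      then obtain m where "m \<in> carrier (mid E)" "proj E m = \<phi> z"
        by (rule E.proj_lift)
      with that show ?thesis
        by (intro bexI [of _ "(m, z)"]) (auto simp: pullback_ses_def)
    qed
  qed (use mod in \<open>auto simp: pullback_ses_def E.incl.source.left_module_axioms assms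
      intro!: lmod_homI\<close>)
qed

text \<open>The condition \<open>proj_incl\<close> is what makes the projection well defined on
  classes; exactness enters only in \<open>extension_pushout\<close>.\<close>

locale pushout = s: lmod_map R A Y s + incl: lmod_map R A "mid E" "incl E" +
    proj: lmod_map R "mid E" X "proj E"
  for R :: "('a, 'k) ring_scheme" and A :: "('a, 'w) module" and Y :: "('a, 'y) module"
    and s and E :: "('a, 'w, 'm, 'x) ses" and X :: "('a, 'x) module" +
  assumes proj_incl: "a \<in> carrier A \<Longrightarrow> proj E (incl E a) = \<zero>\<^bsub>X\<^esub>"
begin

definition antidiag :: "('y \<times> 'm) set" where
  "antidiag = (\<lambda>a. (s a, \<ominus>\<^bsub>mid E\<^esub> incl E a)) ` carrier A"

definition cls :: "'y \<Rightarrow> 'm \<Rightarrow> ('y \<times> 'm) set" where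
  "cls y m = antidiag +>\<^bsub>prod_mod Y (mid E)\<^esub> (y, m)"

sublocale Q: left_module_submodule R "prod_mod Y (mid E)" antidiag
proof -
  interpret P: left_module R "prod_mod Y (mid E)"
    by (intro left_module_prod_mod s.target.left_module_axioms incl.target.left_module_axioms)
  have "submodule antidiag R (prod_mod Y (mid E))"
  proof (rule P.submoduleI)
    show "antidiag \<subseteq> carrier (prod_mod Y (mid E))"
      by (auto simp: antidiag_def)
    show "\<zero>\<^bsub>prod_mod Y (mid E)\<^esub> \<in> antidiag"
      unfolding antidiag_def by (rule image_eqI [of _ _ "\<zero>\<^bsub>A\<^esub>"]) auto
    show "p \<oplus>\<^bsub>prod_mod Y (mid E)\<^esub> q \<in> antidiag" if "p \<in> antidiag" "q \<in> antidiag" for p q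
    proof -
      obtain a b where "a \<in> carrier A" "p = (s a, incl E (\<ominus>\<^bsub>A\<^esub> a))"
          "b \<in> carrier A" "q = (s b, incl E (\<ominus>\<^bsub>A\<^esub> b))"
        using \<open>p \<in> antidiag\<close> \<open>q \<in> antidiag\<close> by (auto simp: antidiag_def)
      then show ?thesis
        unfolding antidiag_def
        by (intro image_eqI [of _ _ "a \<oplus>\<^bsub>A\<^esub> b"])
          (auto simp: incl.target.M.minus_add)
    qed
    show "c \<odot>\<^bsub>prod_mod Y (mid E)\<^esub> p \<in> antidiag" if "c \<in> carrier R" "p \<in> antidiag" for c p
    proof -
      obtain a where a: "a \<in> carrier A" "p = (s a, incl E (\<ominus>\<^bsub>A\<^esub> a))"
        using \<open>p \<in> antidiag\<close> by (auto simp: antidiag_def)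
      have "c \<odot>\<^bsub>A\<^esub> (\<ominus>\<^bsub>A\<^esub> a) = \<ominus>\<^bsub>A\<^esub> (c \<odot>\<^bsub>A\<^esub> a)"
        using a \<open>c \<in> carrier R\<close>
        by (intro s.source.M.minus_equality [symmetric])
          (simp_all flip: s.source.smult_r_distr add: s.source.M.l_neg)
      with a \<open>c \<in> carrier R\<close> show ?thesis
        unfolding antidiag_def
        by (intro image_eqI [of _ _ "c \<odot>\<^bsub>A\<^esub> a"]) (simp_all flip: incl.map_smult incl.map_minus)
    qed
  qed
  then show "left_module_submodule R (prod_mod Y (mid E)) antidiag"
    by (intro left_module_submodule.intro left_module_submodule_axioms.intro P.left_module_axioms)
qed

lemma mid_pushout: "mid (pushout_ses A Y s E) = quotient_mod (prod_mod Y (mid E)) antidiag"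
  and incl_pushout: "incl (pushout_ses A Y s E) = (\<lambda>y. cls y \<zero>\<^bsub>mid E\<^esub>)"
  by (simp_all add: pushout_ses_def antidiag_def cls_def Let_def)

lemma carrier_pushout:
  "carrier (mid (pushout_ses A Y s E)) = {cls y m |y m. y \<in> carrier Y \<and> m \<in> carrier (mid E)}"
  by (auto simp: mid_pushout Q.carrier_quotient_mod cls_def)

lemma cls_closed [simp]:
  "\<lbrakk>y \<in> carrier Y; m \<in> carrier (mid E)\<rbrakk> \<Longrightarrow> cls y m \<in> carrier (mid (pushout_ses A Y s E))"
  by (auto simp: carrier_pushout)

lemma zero_pushout: "\<zero>\<^bsub>mid (pushout_ses A Y s E)\<^esub> = cls \<zero>\<^bsub>Y\<^esub> \<zero>\<^bsub>mid E\<^esub>"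
  by (simp add: mid_pushout cls_def Q.zero_quotient_mod)

lemma cls_add:
  "\<lbrakk>y \<in> carrier Y; m \<in> carrier (mid E); y' \<in> carrier Y; m' \<in> carrier (mid E)\<rbrakk> \<Longrightarrow>
    cls y m \<oplus>\<^bsub>mid (pushout_ses A Y s E)\<^esub> cls y' m' = cls (y \<oplus>\<^bsub>Y\<^esub> y') (m \<oplus>\<^bsub>mid E\<^esub> m')"
  by (simp add: mid_pushout cls_def Q.add_quotient_mod)

lemma cls_smult:
  "\<lbrakk>a \<in> carrier R; y \<in> carrier Y; m \<in> carrier (mid E)\<rbrakk> \<Longrightarrow>
    a \<odot>\<^bsub>mid (pushout_ses A Y s E)\<^esub> cls y m = cls (a \<odot>\<^bsub>Y\<^esub> y) (a \<odot>\<^bsub>mid E\<^esub> m)"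
  by (simp add: mid_pushout cls_def Q.smult_quotient_mod)

text \<open>The defining relation of the push-out: an element of \<open>A\<close> can be moved from
  one coordinate to the other.\<close>

lemma cls_eqI:
  assumes "a \<in> carrier A" and "y \<in> carrier Y" and "m \<in> carrier (mid E)"
  shows "cls (s a \<oplus>\<^bsub>Y\<^esub> y) m = cls y (incl E a \<oplus>\<^bsub>mid E\<^esub> m)"
proof -
  have "(s a, \<ominus>\<^bsub>mid E\<^esub> incl E a) \<in> antidiag"
    using assms by (auto simp: antidiag_def)
  moreover have "(s a, \<ominus>\<^bsub>mid E\<^esub> incl E a) \<oplus>\<^bsub>prod_mod Y (mid E)\<^esub> (y, incl E a \<oplus>\<^bsub>mid E\<^esub> m) =
      (s a \<oplus>\<^bsub>Y\<^esub> y, m)"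
    using assms by (simp add: incl.target.M.r_neg1)
  ultimately show ?thesis
    using Q.coset_eqI [of "(y, incl E a \<oplus>\<^bsub>mid E\<^esub> m)"] assms by (metis (no_types) cls_def mem_Sigma_iff
      prod_mod_simps(1) incl.map_closed incl.target.M.add.m_closed)
qed

lemma cls_eqD:
  assumes "cls y m = cls y' m'" and "y \<in> carrier Y" and "m \<in> carrier (mid E)"
  obtains a where "a \<in> carrier A"
    and "y = s a \<oplus>\<^bsub>Y\<^esub> y'" and "m = \<ominus>\<^bsub>mid E\<^esub> incl E a \<oplus>\<^bsub>mid E\<^esub> m'"
  using Q.coset_eqD [of "(y, m)" "(y', m')"] assms by (auto simp: cls_def antidiag_def)

text \<open>The definition applies the projection to a representative picked by \<open>SOME\<close>.
  Second coordinates of representatives differ by elements of the image of \<open>A\<close>, which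
  the projection kills.\<close>

lemma proj_cls:
  assumes "y \<in> carrier Y" and "m \<in> carrier (mid E)"
  shows "proj (pushout_ses A Y s E) (cls y m) = proj E m"
proof -
  have "(SOME p. p \<in> cls y m) \<in> cls y m"
    using Q.coset_self [of "(y, m)"] assms by (auto simp: cls_def intro: someI)
  then obtain a where "a \<in> carrier A" "snd (SOME p. p \<in> cls y m) = \<ominus>\<^bsub>mid E\<^esub> incl E a \<oplus>\<^bsub>mid E\<^esub> m"
    using Q.coset_memD [of "SOME p. p \<in> cls y m" "(y, m)"] by (auto simp: cls_def antidiag_def)
  moreover have "proj (pushout_ses A Y s E) (cls y m) = proj E (snd (SOME p. p \<in> cls y m))"
    by (simp add: pushout_ses_def Let_def)
  ultimately show ?thesis
    using assms by (simp add: proj_incl)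
qed

lemma extension_pushout:
  assumes "extension R A E X"
  shows "extension R Y (pushout_ses A Y s E) X"
proof -
  interpret E: extension R A E X by fact
  have mod: "left_module R (mid (pushout_ses A Y s E))"
    by (simp add: mid_pushout Q.left_module_quotient_mod)
  show ?thesis
  proof (rule extensionI)
    show "incl (pushout_ses A Y s E) \<in> lmod_hom R Y (mid (pushout_ses A Y s E))"
      by (rule lmod_homI) (auto simp: incl_pushout cls_add cls_smult)
    show "proj (pushout_ses A Y s E) \<in> lmod_hom R (mid (pushout_ses A Y s E)) X"
      by (rule lmod_homI) (auto simp: carrier_pushout cls_add cls_smult proj_cls)
    show "y = \<zero>\<^bsub>Y\<^esub>"
      if "y \<in> carrier Y" "incl (pushout_ses A Y s E) y = \<zero>\<^bsub>mid (pushout_ses A Y s E)\<^esub>" for y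
    proof -
      \<comment> \<open>Equality with the zero class yields \<open>a\<close> whose image in
        \<open>mid E\<close> is zero and with \<open>y\<close> equal to \<open>s a\<close>.
        Injectivity of \<open>incl E\<close> then gives that \<open>a\<close> is zero, and so is
        \<open>y\<close>.\<close>
      have "cls y \<zero>\<^bsub>mid E\<^esub> = cls \<zero>\<^bsub>Y\<^esub> \<zero>\<^bsub>mid E\<^esub>"
        using that by (simp add: incl_pushout zero_pushout)
      then obtain a where a: "a \<in> carrier A" "y = s a \<oplus>\<^bsub>Y\<^esub> \<zero>\<^bsub>Y\<^esub>"
        "\<zero>\<^bsub>mid E\<^esub> = \<ominus>\<^bsub>mid E\<^esub> incl E a \<oplus>\<^bsub>mid E\<^esub> \<zero>\<^bsub>mid E\<^esub>"
        using \<open>y \<in> carrier Y\<close> by (elim cls_eqD) simp_all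
      then have "incl E (\<ominus>\<^bsub>A\<^esub> a) = \<zero>\<^bsub>mid E\<^esub>"
        by simp
      then have "\<ominus>\<^bsub>A\<^esub> a = \<zero>\<^bsub>A\<^esub>"
        using a by (simp only: E.incl_eq_zero_iff s.source.M.a_inv_closed)
      then have "a = \<zero>\<^bsub>A\<^esub>"
        using a s.source.M.minus_minus [of a] by simp
      then show ?thesis
        using a by simp
    qed
    show "\<exists>y\<in>carrier Y. p = incl (pushout_ses A Y s E) y"
      if p: "p \<in> carrier (mid (pushout_ses A Y s E))" "proj (pushout_ses A Y s E) p = \<zero>\<^bsub>X\<^esub>" for p
    proof -
      obtain y m where ym: "y \<in> carrier Y" "m \<in> carrier (mid E)" "p = cls y m"
        using p(1) by (auto simp: carrier_pushout)
      then obtain a where a: "a \<in> carrier A" "m = incl E a"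
        using p(2) by (auto simp: proj_cls elim: E.proj_eq_zeroE)
      \<comment> \<open>By exactness \<open>m\<close> comes from \<open>A\<close>, so it can be
        moved to the coordinate in \<open>Y\<close>.\<close>
      then have "p = cls (s a \<oplus>\<^bsub>Y\<^esub> y) \<zero>\<^bsub>mid E\<^esub>"
        using ym by (simp add: cls_eqI)
      then show ?thesis
        using a ym by (auto simp: incl_pushout)
    qed
    show "\<exists>p\<in>carrier (mid (pushout_ses A Y s E)). proj (pushout_ses A Y s E) p = x"
      if x: "x \<in> carrier X" for x
    proof -
      obtain m where "m \<in> carrier (mid E)" "proj E m = x"
        using x by (rule E.proj_lift)
      then show ?thesis
        by (intro bexI [of _ "cls \<zero>\<^bsub>Y\<^esub> m"]) (auto simp: proj_cls)
    qed
  qed (auto simp: mod incl_pushout proj_cls s.target.left_module_axioms proj.target.left_module_axioms)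
qed

end

subsection \<open>Baer sums\<close>

text \<open>
  A Baer sum of \<open>E\<close> and \<open>F\<close> is characterized up to equivalence by a homomorphism, here curried, from
  the fibre product of the two middle terms that restricts to the addition of \<open>Y\<close>.
\<close>

locale baer_sum_map = E: extension R Y E X + F: extension R Y F X + G: extension R Y G X
  for R :: "('a, 'k) ring_scheme" and Y :: "('a, 'y) module" and X :: "('a, 'x) module"
    and E :: "('a, 'y, 'm, 'x) ses" and F :: "('a, 'y, 'n, 'x) ses" and G :: "('a, 'y, 'p, 'x) ses"
    and g +
  assumes g_closed [simp]:
      "\<lbrakk>m \<in> carrier (mid E); n \<in> carrier (mid F); proj E m = proj F n\<rbrakk> \<Longrightarrow> g m n \<in> carrier (mid G)"
    and proj_g [simp]:
      "\<lbrakk>m \<in> carrier (mid E); n \<in> carrier (mid F); proj E m = proj F n\<rbrakk> \<Longrightarrow>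
        proj G (g m n) = proj E m"
    and g_add:
      "\<lbrakk>m \<in> carrier (mid E); n \<in> carrier (mid F); proj E m = proj F n;
        m' \<in> carrier (mid E); n' \<in> carrier (mid F); proj E m' = proj F n'\<rbrakk> \<Longrightarrow>
        g (m \<oplus>\<^bsub>mid E\<^esub> m') (n \<oplus>\<^bsub>mid F\<^esub> n') = g m n \<oplus>\<^bsub>mid G\<^esub> g m' n'"
    and g_smult:
      "\<lbrakk>a \<in> carrier R; m \<in> carrier (mid E); n \<in> carrier (mid F); proj E m = proj F n\<rbrakk> \<Longrightarrow>
        g (a \<odot>\<^bsub>mid E\<^esub> m) (a \<odot>\<^bsub>mid F\<^esub> n) = a \<odot>\<^bsub>mid G\<^esub> g m n"
    and g_incl [simp]:
      "\<lbrakk>y \<in> carrier Y; z \<in> carrier Y\<rbrakk> \<Longrightarrow> g (incl E y) (incl F z) = incl G (y \<oplus>\<^bsub>Y\<^esub> z)"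
begin

lemma g_incl_zero [simp]: "y \<in> carrier Y \<Longrightarrow> g (incl E y) \<zero>\<^bsub>mid F\<^esub> = incl G y"
  using g_incl [of y "\<zero>\<^bsub>Y\<^esub>"] by simp

lemma swap: "baer_sum_map R Y X F E G (\<lambda>n m. g m n)"
  by unfold_locales (auto simp: g_add g_smult E.incl.source.M.a_comm)

lemma compose:
  assumes "extension R Y H X" and "ses_equiv R Y G H"
  obtains h where "baer_sum_map R Y X E F H h"
proof -
  interpret H: extension R Y H X by fact
  from assms(2) obtain k where k: "k \<in> lmod_hom R (mid G) (mid H)"
    "\<And>y. y \<in> carrier Y \<Longrightarrow> k (incl G y) = incl H y"
    "\<And>m. m \<in> carrier (mid G) \<Longrightarrow> proj H (k m) = proj G m"
    by (rule ses_equivE) blast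
  show thesis
    by (rule that [of "\<lambda>m n. k (g m n)"], unfold_locales)
      (simp_all add: g_add g_smult k lmod_homD [OF k(1)])
qed

text \<open>Both sums are images of the fibre product of \<open>mid E\<close> and
  \<open>mid F\<close>, the second one by way of the given equivalences. The pairs of images form a
  relation to which \<open>ses_equiv_of_relation\<close> applies.\<close>

lemma unique:
  assumes "baer_sum_map R Y X E' F' H h"
    and "ses_equiv R Y E E'" and "ses_equiv R Y F F'"
  shows "ses_equiv R Y G H"
proof -
  interpret H: baer_sum_map R Y X E' F' H h by fact
  from assms(2) obtain \<alpha> where \<alpha>: "\<alpha> \<in> lmod_hom R (mid E) (mid E')"
    "\<And>y. y \<in> carrier Y \<Longrightarrow> \<alpha> (incl E y) = incl E' y"
    "\<And>m. m \<in> carrier (mid E) \<Longrightarrow> proj E' (\<alpha> m) = proj E m"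
    by (rule ses_equivE) blast
  from assms(3) obtain \<beta> where \<beta>: "\<beta> \<in> lmod_hom R (mid F) (mid F')"
    "\<And>y. y \<in> carrier Y \<Longrightarrow> \<beta> (incl F y) = incl F' y"
    "\<And>m. m \<in> carrier (mid F) \<Longrightarrow> proj F' (\<beta> m) = proj F m"
    by (rule ses_equivE) blast
  note [simp] = \<alpha>(2,3) \<beta>(2,3) lmod_homD [OF \<alpha>(1)] lmod_homD [OF \<beta>(1)]
  define S where "S = {(g m n, h (\<alpha> m) (\<beta> n)) |m n.
    m \<in> carrier (mid E) \<and> n \<in> carrier (mid F) \<and> proj E m = proj F n}"
  have S_I: "(g m n, h (\<alpha> m) (\<beta> n)) \<in> S"
    if "m \<in> carrier (mid E)" "n \<in> carrier (mid F)" "proj E m = proj F n" for m n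
    using that by (auto simp: S_def)
  show ?thesis
  proof (rule ses_equiv_of_relation [where S = S, OF G.extension_axioms H.G.extension_axioms])
    show "m \<in> carrier (mid G) \<and> n \<in> carrier (mid H) \<and> proj G m = proj H n" if "(m, n) \<in> S" for m n
      using that by (auto simp: S_def)
    show "(m \<oplus>\<^bsub>mid G\<^esub> m', n \<oplus>\<^bsub>mid H\<^esub> n') \<in> S" if mn: "(m, n) \<in> S" "(m', n') \<in> S" for m n m' n'
    proof -
      obtain a b where ab: "a \<in> carrier (mid E)" "b \<in> carrier (mid F)" "proj E a = proj F b"
        "m = g a b" "n = h (\<alpha> a) (\<beta> b)"
        using mn(1) by (auto simp: S_def)
      obtain a' b' where ab': "a' \<in> carrier (mid E)" "b' \<in> carrier (mid F)" "proj E a' = proj F b'"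
        "m' = g a' b'" "n' = h (\<alpha> a') (\<beta> b')"
        using mn(2) by (auto simp: S_def)
      from ab ab' show ?thesis
        using S_I [of "a \<oplus>\<^bsub>mid E\<^esub> a'" "b \<oplus>\<^bsub>mid F\<^esub> b'"] by (simp add: g_add H.g_add)
    qed
    show "(c \<odot>\<^bsub>mid G\<^esub> m, c \<odot>\<^bsub>mid H\<^esub> n) \<in> S" if c: "c \<in> carrier R" and mn: "(m, n) \<in> S" for c m n
    proof -
      obtain a b where ab: "a \<in> carrier (mid E)" "b \<in> carrier (mid F)" "proj E a = proj F b"
        "m = g a b" "n = h (\<alpha> a) (\<beta> b)"
        using mn by (auto simp: S_def)
      with c show ?thesis
        using S_I [of "c \<odot>\<^bsub>mid E\<^esub> a" "c \<odot>\<^bsub>mid F\<^esub> b"] by (simp add: g_smult H.g_smult)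
    qed
    show "(incl G y, incl H y) \<in> S" if "y \<in> carrier Y" for y
      using S_I [of "incl E y" "\<zero>\<^bsub>mid F\<^esub>"] that \<beta>(2) [of "\<zero>\<^bsub>Y\<^esub>"] by simp
    show "\<exists>m n. (m, n) \<in> S \<and> proj G m = x" if x: "x \<in> carrier X" for x
    proof -
      obtain m where "m \<in> carrier (mid E)" "proj E m = x"
        using x by (rule E.proj_lift)
      moreover obtain n where "n \<in> carrier (mid F)" "proj F n = x"
        using x by (rule F.proj_lift)
      ultimately show ?thesis
        using S_I [of m n] by (intro exI conjI) auto
    qed
    show "n = \<zero>\<^bsub>mid H\<^esub>" if n: "(\<zero>\<^bsub>mid G\<^esub>, n) \<in> S" for n
    proof -
      obtain a b where ab: "a \<in> carrier (mid E)" "b \<in> carrier (mid F)" "proj E a = proj F b"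
        "\<zero>\<^bsub>mid G\<^esub> = g a b" "n = h (\<alpha> a) (\<beta> b)"
        using n by (auto simp: S_def)
      \<comment> \<open>Once the common projection vanishes, both entries come from
        \<open>Y\<close>, where \<open>g\<close> and \<open>h\<close> are addition.\<close>
      then have "proj E a = \<zero>\<^bsub>X\<^esub>"
        using proj_g [of a b] by (simp flip: ab(4))
      then obtain y z where yz: "y \<in> carrier Y" "a = incl E y" "z \<in> carrier Y" "b = incl F z"
        using ab E.proj_eq_zeroE F.proj_eq_zeroE by metis
      then have "y \<oplus>\<^bsub>Y\<^esub> z = \<zero>\<^bsub>Y\<^esub>"
        using ab(4) G.incl_eq_zero_iff [of "y \<oplus>\<^bsub>Y\<^esub> z"] by simp
      then show ?thesis
        using ab yz by simp
    qed
  qed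
qed

end

lemma baer_sum_map_baer_sum:
  assumes "extension R Y E X" and "extension R Y F X"
  obtains g where "baer_sum_map R Y X E F (baer_sum X Y E F) g"
proof -
  interpret E: extension R Y E X by fact
  interpret F: extension R Y F X by fact
  note mods = E.incl.source.left_module_axioms E.proj.target.left_module_axioms
  let ?P = "pullback_ses X (\<lambda>x. (x, x)) (prod_ses E F)"
  have P: "extension R (prod_mod Y Y) ?P X"
    using extension_prod_ses [OF assms] mods(2)
    by (rule extension_pullback_ses) (auto intro: lmod_homI)
  interpret P: extension R "prod_mod Y Y" ?P X by fact
  interpret s: lmod_map R "prod_mod Y Y" Y "\<lambda>(y, z). y \<oplus>\<^bsub>Y\<^esub> z"
    by (intro lmod_map.intro lmod_map_axioms.intro lmod_homI left_module_prod_mod mods)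
      (auto simp: E.incl.source.M.a_ac E.incl.source.smult_r_distr)
  interpret P: pushout R "prod_mod Y Y" Y "\<lambda>(y, z). y \<oplus>\<^bsub>Y\<^esub> z" ?P X
    by unfold_locales auto
  interpret G: extension R Y "baer_sum X Y E F" X
    unfolding baer_sum_def by (rule P.extension_pushout) fact
  have mem: "((m, n), proj E m) \<in> carrier (mid ?P)"
    if "m \<in> carrier (mid E)" "n \<in> carrier (mid F)" "proj E m = proj F n" for m n
    using that by (auto simp: pullback_ses_def prod_ses_def)
  have add: "((m, n), x) \<oplus>\<^bsub>mid ?P\<^esub> ((m', n'), x') =
      ((m \<oplus>\<^bsub>mid E\<^esub> m', n \<oplus>\<^bsub>mid F\<^esub> n'), x \<oplus>\<^bsub>X\<^esub> x')" for m n x m' n' x'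
    by (simp add: pullback_ses_def prod_ses_def)
  have smult: "a \<odot>\<^bsub>mid ?P\<^esub> ((m, n), x) = ((a \<odot>\<^bsub>mid E\<^esub> m, a \<odot>\<^bsub>mid F\<^esub> n), a \<odot>\<^bsub>X\<^esub> x)" for a m n x
    by (simp add: pullback_ses_def prod_ses_def)
  have proj: "proj ?P (p, x) = x" for p x
    by (simp add: pullback_ses_def)
  have incl: "incl ?P (y, z) = ((incl E y, incl F z), \<zero>\<^bsub>X\<^esub>)" for y z
    by (simp add: pullback_ses_def prod_ses_def)
  \<comment> \<open>A compatible pair is placed in the pull-back along the diagonal of
    \<open>X\<close>, then in the push-out along the addition of \<open>Y\<close>.\<close>
  define g where "g m n = P.cls \<zero>\<^bsub>Y\<^esub> ((m, n), proj E m)" for m n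
  have "baer_sum_map R Y X E F (baer_sum X Y E F) g"
  proof unfold_locales
    fix m n assume mn: "m \<in> carrier (mid E)" "n \<in> carrier (mid F)" "proj E m = proj F n"
    show "g m n \<in> carrier (mid (baer_sum X Y E F))"
      using mem [OF mn] by (simp add: g_def baer_sum_def)
    show "proj (baer_sum X Y E F) (g m n) = proj E m"
      using mem [OF mn] by (simp add: g_def baer_sum_def P.proj_cls proj)
    show "g (a \<odot>\<^bsub>mid E\<^esub> m) (a \<odot>\<^bsub>mid F\<^esub> n) = a \<odot>\<^bsub>mid (baer_sum X Y E F)\<^esub> g m n"
      if "a \<in> carrier R" for a
      using that mn mem [OF mn] by (simp add: g_def baer_sum_def P.cls_smult smult)
    fix m' n' assume mn': "m' \<in> carrier (mid E)" "n' \<in> carrier (mid F)" "proj E m' = proj F n'"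
    show "g (m \<oplus>\<^bsub>mid E\<^esub> m') (n \<oplus>\<^bsub>mid F\<^esub> n') = g m n \<oplus>\<^bsub>mid (baer_sum X Y E F)\<^esub> g m' n'"
      using mn mn' mem [OF mn] mem [OF mn'] by (simp add: g_def baer_sum_def P.cls_add add)
  next
    fix y z assume yz: "y \<in> carrier Y" "z \<in> carrier Y"
    then have "(y, z) \<in> carrier (prod_mod Y Y)"
      by simp
    \<comment> \<open>The relation of the push-out for the element \<open>(y, z)\<close> moves its
      sum to the coordinate in \<open>Y\<close>.\<close>
    from P.cls_eqI [OF this, of "\<zero>\<^bsub>Y\<^esub>" "\<zero>\<^bsub>mid ?P\<^esub>"] yz
    show "g (incl E y) (incl F z) = incl (baer_sum X Y E F) (y \<oplus>\<^bsub>Y\<^esub> z)"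
      using P.incl.map_closed [OF \<open>(y, z) \<in> carrier (prod_mod Y Y)\<close>]
      by (simp add: g_def baer_sum_def P.incl_pushout incl)
  qed
  then show thesis
    by (rule that)
qed

text \<open>\<open>baer_sum\<close> enlarges the type of the middle term. Returning to the product
  type allows sums to be iterated and to be members of classes in \<open>Ext1\<close>.\<close>

lemma baer_sum_on_product_type:
  fixes E :: "('a, 'y, 'm, 'x) ses" and F :: "('a, 'y, 'n, 'x) ses"
  assumes "extension R Y E X" and "extension R Y F X"
  obtains G :: "('a, 'y, 'x) ext" and g where "baer_sum_map R Y X E F G g"
proof -
  obtain g where g: "baer_sum_map R Y X E F (baer_sum X Y E F) g"
    using assms by (rule baer_sum_map_baer_sum)
  interpret baer_sum_map R Y X E F "baer_sum X Y E F" g by fact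
  obtain G :: "('a, 'y, 'x) ext" where "extension R Y G X" "ses_equiv R Y (baer_sum X Y E F) G"
    using G.extension_axioms by (rule extension_on_product_type)
  then obtain h where "baer_sum_map R Y X E F G h"
    by (rule compose)
  then show thesis
    by (rule that)
qed

text \<open>The triple fibre product \<open>T\<close> maps onto both iterated sums. The relation of
  common images reduces associativity to that of addition in \<open>Y\<close>.\<close>

lemma baer_sum_map_assoc:
  assumes "baer_sum_map R Y X E1 E2 G g1" and "baer_sum_map R Y X G E3 H g2"
    and "baer_sum_map R Y X E2 E3 G' h1" and "baer_sum_map R Y X E1 G' H' h2"
  shows "ses_equiv R Y H H'"
proof -
  interpret g1: baer_sum_map R Y X E1 E2 G g1 by fact
  interpret g2: baer_sum_map R Y X G E3 H g2 by fact
  interpret h1: baer_sum_map R Y X E2 E3 G' h1 by fact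
  interpret h2: baer_sum_map R Y X E1 G' H' h2 by fact
  define T where "T = {(a, b, c). a \<in> carrier (mid E1) \<and> b \<in> carrier (mid E2) \<and>
    c \<in> carrier (mid E3) \<and> proj E1 a = proj E2 b \<and> proj E2 b = proj E3 c}"
  define S where "S = (\<lambda>(a, b, c). (g2 (g1 a b) c, h2 a (h1 b c))) ` T"
  have S_I: "(g2 (g1 a b) c, h2 a (h1 b c)) \<in> S" if "(a, b, c) \<in> T" for a b c
    unfolding S_def by (rule image_eqI [OF _ that]) simp
  have S_E: thesis if "(m, n) \<in> S"
    "\<And>a b c. \<lbrakk>(a, b, c) \<in> T; m = g2 (g1 a b) c; n = h2 a (h1 b c)\<rbrakk> \<Longrightarrow> thesis" for m n thesis
    using that by (auto simp: S_def)
  show ?thesis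
  proof (rule ses_equiv_of_relation [where S = S, OF g2.G.extension_axioms h2.G.extension_axioms])
    show "m \<in> carrier (mid H) \<and> n \<in> carrier (mid H') \<and> proj H m = proj H' n" if "(m, n) \<in> S" for m n
      using that by (rule S_E) (simp add: T_def)
    show "(m \<oplus>\<^bsub>mid H\<^esub> m', n \<oplus>\<^bsub>mid H'\<^esub> n') \<in> S" if mn: "(m, n) \<in> S" "(m', n') \<in> S" for m n m' n'
    proof -
      obtain a b c where abc: "(a, b, c) \<in> T" "m = g2 (g1 a b) c" "n = h2 a (h1 b c)"
        using mn(1) by (rule S_E)
      obtain a' b' c' where abc': "(a', b', c') \<in> T" "m' = g2 (g1 a' b') c'" "n' = h2 a' (h1 b' c')"
        using mn(2) by (rule S_E)
      have "(a \<oplus>\<^bsub>mid E1\<^esub> a', b \<oplus>\<^bsub>mid E2\<^esub> b', c \<oplus>\<^bsub>mid E3\<^esub> c') \<in> T"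
        using abc(1) abc'(1) by (simp add: T_def)
      from S_I [OF this] show ?thesis
        using abc abc' by (simp add: T_def g1.g_add g2.g_add h1.g_add h2.g_add)
    qed
    show "(r \<odot>\<^bsub>mid H\<^esub> m, r \<odot>\<^bsub>mid H'\<^esub> n) \<in> S" if r: "r \<in> carrier R" and mn: "(m, n) \<in> S" for r m n
    proof -
      obtain a b c where abc: "(a, b, c) \<in> T" "m = g2 (g1 a b) c" "n = h2 a (h1 b c)"
        using mn by (rule S_E)
      have "(r \<odot>\<^bsub>mid E1\<^esub> a, r \<odot>\<^bsub>mid E2\<^esub> b, r \<odot>\<^bsub>mid E3\<^esub> c) \<in> T"
        using abc(1) r by (simp add: T_def)
      from S_I [OF this] show ?thesis
        using abc r by (simp add: T_def g1.g_smult g2.g_smult h1.g_smult h2.g_smult)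
    qed
    show "(incl H y, incl H' y) \<in> S" if y: "y \<in> carrier Y" for y
    proof -
      have "(incl E1 y, \<zero>\<^bsub>mid E2\<^esub>, \<zero>\<^bsub>mid E3\<^esub>) \<in> T"
        using y by (simp add: T_def)
      from S_I [OF this] show ?thesis
        using y h1.g_incl_zero [of "\<zero>\<^bsub>Y\<^esub>"] by simp
    qed
    show "\<exists>m n. (m, n) \<in> S \<and> proj H m = x" if x: "x \<in> carrier X" for x
    proof -
      obtain a where "a \<in> carrier (mid E1)" "proj E1 a = x"
        using x by (rule g1.E.proj_lift)
      moreover obtain b where "b \<in> carrier (mid E2)" "proj E2 b = x"
        using x by (rule g1.F.proj_lift)
      moreover obtain c where "c \<in> carrier (mid E3)" "proj E3 c = x"
        using x by (rule g2.F.proj_lift)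
      ultimately show ?thesis
        using S_I [of a b c] by (intro exI conjI) (auto simp: T_def)
    qed
    show "n = \<zero>\<^bsub>mid H'\<^esub>" if n: "(\<zero>\<^bsub>mid H\<^esub>, n) \<in> S" for n
    proof -
      obtain a b c where abc: "(a, b, c) \<in> T" "\<zero>\<^bsub>mid H\<^esub> = g2 (g1 a b) c" "n = h2 a (h1 b c)"
        using n by (rule S_E)
      then have "proj H \<zero>\<^bsub>mid H\<^esub> = proj E1 a"
        by (simp only: abc(2)) (simp add: T_def)
      then have "proj E1 a = \<zero>\<^bsub>X\<^esub>"
        by simp
      then have "proj E2 b = \<zero>\<^bsub>X\<^esub>" "proj E3 c = \<zero>\<^bsub>X\<^esub>"
        and carr: "a \<in> carrier (mid E1)" "b \<in> carrier (mid E2)" "c \<in> carrier (mid E3)"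
        using abc(1) by (auto simp: T_def)
      obtain y where y: "y \<in> carrier Y" "a = incl E1 y"
        using carr(1) \<open>proj E1 a = \<zero>\<^bsub>X\<^esub>\<close> by (rule g1.E.proj_eq_zeroE)
      obtain z where z: "z \<in> carrier Y" "b = incl E2 z"
        using carr(2) \<open>proj E2 b = \<zero>\<^bsub>X\<^esub>\<close> by (rule g1.F.proj_eq_zeroE)
      obtain w where w: "w \<in> carrier Y" "c = incl E3 w"
        using carr(3) \<open>proj E3 c = \<zero>\<^bsub>X\<^esub>\<close> by (rule g2.F.proj_eq_zeroE)
      note yzw = y z w
      note Y_closed = g1.E.incl.source.M.add.m_closed
      have "g2 (g1 a b) c = incl H (y \<oplus>\<^bsub>Y\<^esub> z \<oplus>\<^bsub>Y\<^esub> w)"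
        using yzw by (simp only: g1.g_incl g2.g_incl Y_closed)
      moreover have "h2 a (h1 b c) = incl H' (y \<oplus>\<^bsub>Y\<^esub> (z \<oplus>\<^bsub>Y\<^esub> w))"
        using yzw by (simp only: h1.g_incl h2.g_incl Y_closed)
      moreover have "y \<oplus>\<^bsub>Y\<^esub> z \<oplus>\<^bsub>Y\<^esub> w = y \<oplus>\<^bsub>Y\<^esub> (z \<oplus>\<^bsub>Y\<^esub> w)"
        using yzw by (simp add: g1.E.incl.source.M.a_assoc)
      ultimately show ?thesis
        using abc yzw g2.G.incl_eq_zero_iff h2.G.incl_eq_zero_iff Y_closed by metis
    qed
  qed
qed


subsection \<open>The first extension group\<close>

lemma ext_class_iff:
  "G \<in> ext_class R X Y E \<longleftrightarrow> extension R Y G X \<and> ses_equiv R Y E G"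
  by (simp add: ext_class_def is_ses_iff_extension)

lemma ext_class_eqI:
  assumes "extension R Y E X" and "extension R Y F X" and "ses_equiv R Y E F"
  shows "ext_class R X Y E = ext_class R X Y F"
  using assms(1,2) ses_equiv_trans [OF _ _ assms(3)] ses_equiv_trans [OF _ _ ses_equiv_sym [OF assms]]
  unfolding ext_class_def is_ses_iff_extension by blast

lemma ext_class_self:
  "extension R Y E X \<Longrightarrow> E \<in> ext_class R X Y E"
  by (simp add: ext_class_iff ses_equiv_refl)

text \<open>A class contains only extensions on the product type, so \<open>E\<close> itself may be
  of the wrong type to be a member; an equivalent copy is needed.\<close>

lemma ext_class_nonempty:
  assumes "extension R Y E X"
  shows "ext_class R X Y E \<noteq> {}"
  using assms by (rule extension_on_product_type) (auto simp: ext_class_iff)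

lemma ext_class_in_Ext1:
  fixes X :: "('a, 'x) module" and Y :: "('a, 'y) module"
  assumes "extension R Y E X"
  shows "ext_class R X Y E \<in> carrier (Ext1 R X Y)"
proof -
  obtain G :: "('a, 'y, 'x) ext" where "extension R Y G X" "ses_equiv R Y E G"
    using assms by (rule extension_on_product_type)
  with assms have "extension R Y G X" "ext_class R X Y E = ext_class R X Y G"
    by (simp_all add: ext_class_eqI)
  then show ?thesis
    by (auto simp: Ext1_def is_ses_iff_extension)
qed

lemma Ext1_E:
  fixes X :: "('a, 'x) module" and Y :: "('a, 'y) module"
  assumes "A \<in> carrier (Ext1 R X Y)"
  obtains E :: "('a, 'y, 'x) ext" where "extension R Y E X" and "A = ext_class R X Y E"
  using assms by (auto simp: Ext1_def is_ses_iff_extension)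

text \<open>The union over representatives is constant by uniqueness of Baer sums, and it is not
  empty because the two classes are not.\<close>

lemma Ext1_add:
  assumes "baer_sum_map R Y X E F G g"
  shows "ext_class R X Y E \<oplus>\<^bsub>Ext1 R X Y\<^esub> ext_class R X Y F = ext_class R X Y G"
proof -
  interpret g: baer_sum_map R Y X E F G g by fact
  have "ext_class R X Y (baer_sum X Y E' F') = ext_class R X Y G"
    if "E' \<in> ext_class R X Y E" "F' \<in> ext_class R X Y F" for E' F'
  proof -
    have ext: "extension R Y E' X" "extension R Y F' X"
      and equiv: "ses_equiv R Y E E'" "ses_equiv R Y F F'"
      using that by (auto simp: ext_class_iff)
    obtain h where "baer_sum_map R Y X E' F' (baer_sum X Y E' F') h"
      using ext by (rule baer_sum_map_baer_sum)
    then have "ses_equiv R Y G (baer_sum X Y E' F')" "extension R Y (baer_sum X Y E' F') X"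
      using equiv g.unique by (auto simp: baer_sum_map_def)
    then show ?thesis
      using g.G.extension_axioms ext_class_eqI by metis
  qed
  then have "(\<Union>E'\<in>ext_class R X Y E. \<Union>F'\<in>ext_class R X Y F.
      ext_class R X Y (baer_sum X Y E' F')) = ext_class R X Y G"
    using ext_class_nonempty [OF g.E.extension_axioms] ext_class_nonempty [OF g.F.extension_axioms]
    by blast
  then show ?thesis
    by (simp add: Ext1_def)
qed

text \<open>As for sums, the union over representatives is constant: an equivalence of extensions
  induces one of their pull-backs.\<close>

lemma Ext1_smult:
  assumes "extension R Y E X" and "\<phi> \<in> lmod_hom R X X"
  shows "\<phi> \<odot>\<^bsub>Ext1 R X Y\<^esub> ext_class R X Y E = ext_class R X Y (pullback_ses X \<phi> E)"
proof -
  interpret E: extension R Y E X by fact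
  note X = E.proj.target.left_module_axioms
  have "ext_class R X Y (pullback_ses X \<phi> E') = ext_class R X Y (pullback_ses X \<phi> E)"
    if "E' \<in> ext_class R X Y E" for E'
  proof -
    have E': "extension R Y E' X" "ses_equiv R Y E E'"
      using that by (auto simp: ext_class_iff)
    obtain h where h: "h \<in> lmod_hom R (mid E) (mid E')"
      "\<And>y. y \<in> carrier Y \<Longrightarrow> h (incl E y) = incl E' y"
      "\<And>m. m \<in> carrier (mid E) \<Longrightarrow> proj E' (h m) = proj E m"
      using E'(2) by (rule ses_equivE) blast
    note pb = extension_pullback_ses [OF assms(1) X assms(2)]
      extension_pullback_ses [OF E'(1) X assms(2)]
    have "ses_equiv R Y (pullback_ses X \<phi> E) (pullback_ses X \<phi> E')"
      using pb by (rule ses_equiv_of_hom [where g = "map_prod h id"])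
        (auto simp: pullback_ses_def h lmod_homD [OF h(1)] intro!: lmod_homI)
    then show ?thesis
      using pb ext_class_eqI by metis
  qed
  then have "(\<Union>E'\<in>ext_class R X Y E. ext_class R X Y (pullback_ses X \<phi> E')) =
      ext_class R X Y (pullback_ses X \<phi> E)"
    using ext_class_nonempty [OF assms(1)] by blast
  then show ?thesis
    by (simp add: Ext1_def)
qed

lemma zero_Ext1: "\<zero>\<^bsub>Ext1 R X Y\<^esub> = ext_class R X Y (split_ses Y X)"
  by (simp add: Ext1_def)

text \<open>This is the structure on which the finite sums in \<open>lmod_basis\<close> rest: it
  allows a linear combination to be built one term at a time.\<close>

lemma abelian_monoid_Ext1:
  fixes X :: "('a, 'x) module" and Y :: "('a, 'y) module"
  assumes "left_module R X" and "left_module R Y"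
  shows "abelian_monoid (Ext1 R X Y)"
proof (rule abelian_monoidI)
  fix A assume "A \<in> carrier (Ext1 R X Y)"
  then obtain E :: "('a, 'y, 'x) ext" where E: "extension R Y E X" "A = ext_class R X Y E"
    by (rule Ext1_E)
  interpret E: extension R Y E X by fact
  interpret O: extension R Y "split_ses Y X" X
    by (rule extension_split_ses) fact+
  \<comment> \<open>Adding the split extension amounts to translating \<open>m\<close> by the
    coordinate in \<open>Y\<close> of the other entry.\<close>
  have "baer_sum_map R Y X (split_ses Y X) E E (\<lambda>p m. incl E (fst p) \<oplus>\<^bsub>mid E\<^esub> m)"
    by unfold_locales (auto simp: split_ses_def E.incl.target.M.a_ac E.incl.target.smult_r_distr)
  then show "\<zero>\<^bsub>Ext1 R X Y\<^esub> \<oplus>\<^bsub>Ext1 R X Y\<^esub> A = A"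
    using Ext1_add E by (simp add: zero_Ext1)
  fix B assume "B \<in> carrier (Ext1 R X Y)"
  then obtain F :: "('a, 'y, 'x) ext" where F: "extension R Y F X" "B = ext_class R X Y F"
    by (rule Ext1_E)
  obtain G :: "('a, 'y, 'x) ext" and g where g: "baer_sum_map R Y X E F G g"
    using E(1) F(1) by (rule baer_sum_on_product_type)
  then have AB: "A \<oplus>\<^bsub>Ext1 R X Y\<^esub> B = ext_class R X Y G"
    using E F Ext1_add by blast
  have G: "extension R Y G X"
    using g by (simp add: baer_sum_map_def)
  show "A \<oplus>\<^bsub>Ext1 R X Y\<^esub> B \<in> carrier (Ext1 R X Y)"
    unfolding AB using G by (rule ext_class_in_Ext1)
  show "A \<oplus>\<^bsub>Ext1 R X Y\<^esub> B = B \<oplus>\<^bsub>Ext1 R X Y\<^esub> A"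
    using AB Ext1_add [OF baer_sum_map.swap [OF g]] E F by simp
  fix C assume "C \<in> carrier (Ext1 R X Y)"
  then obtain K :: "('a, 'y, 'x) ext" where K: "extension R Y K X" "C = ext_class R X Y K"
    by (rule Ext1_E)
  obtain G' :: "('a, 'y, 'x) ext" and g' where g': "baer_sum_map R Y X F K G' g'"
    using F(1) K(1) by (rule baer_sum_on_product_type)
  then have G': "extension R Y G' X"
    by (simp add: baer_sum_map_def)
  obtain H :: "('a, 'y, 'x) ext" and h where h: "baer_sum_map R Y X G K H h"
    using G K(1) by (rule baer_sum_on_product_type)
  obtain H' :: "('a, 'y, 'x) ext" and h' where h': "baer_sum_map R Y X E G' H' h'"
    using E(1) G' by (rule baer_sum_on_product_type)
  have "ext_class R X Y H = ext_class R X Y H'"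
    using baer_sum_map_assoc [OF g h g' h'] h h' by (intro ext_class_eqI) (simp_all add: baer_sum_map_def)
  then show "A \<oplus>\<^bsub>Ext1 R X Y\<^esub> B \<oplus>\<^bsub>Ext1 R X Y\<^esub> C = A \<oplus>\<^bsub>Ext1 R X Y\<^esub> (B \<oplus>\<^bsub>Ext1 R X Y\<^esub> C)"
    using AB Ext1_add [OF g'] Ext1_add [OF h] Ext1_add [OF h'] E F K by simp
next
  show "\<zero>\<^bsub>Ext1 R X Y\<^esub> \<in> carrier (Ext1 R X Y)"
    unfolding zero_Ext1 using assms by (intro ext_class_in_Ext1 extension_split_ses)
qed

section \<open>Factorizations, direct sums and finite generation\<close>

text \<open>Universal property of the quotient, stated for an arbitrary surjection \<open>q\<close>.
  The factor is \<open>u\<close> composed with a set-theoretic section; the kernel condition makes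
  it independent of the section, hence linear.\<close>

lemma lmod_hom_factor:
  assumes "lmod_map R M Q q" and "lmod_map R M N u"
    and surj: "\<And>z. z \<in> carrier Q \<Longrightarrow> \<exists>m\<in>carrier M. q m = z"
    and ker: "\<And>m. \<lbrakk>m \<in> carrier M; q m = \<zero>\<^bsub>Q\<^esub>\<rbrakk> \<Longrightarrow> u m = \<zero>\<^bsub>N\<^esub>"
  obtains k where "k \<in> lmod_hom R Q N" and "\<And>m. m \<in> carrier M \<Longrightarrow> k (q m) = u m"
proof -
  interpret q: lmod_map R M Q q by fact
  interpret u: lmod_map R M N u by fact
  obtain s where s: "\<And>z. z \<in> carrier Q \<Longrightarrow> s z \<in> carrier M \<and> q (s z) = z"
    using surj by metis
  have eq: "u m = u m'" if "m \<in> carrier M" "m' \<in> carrier M" "q m = q m'" for m m'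
  proof -
    have "u (m \<ominus>\<^bsub>M\<^esub> m') = \<zero>\<^bsub>N\<^esub>"
      using that by (intro ker) simp_all
    with that show ?thesis
      by (metis u.target.diff_eq_zeroD u.map_diff u.map_closed)
  qed
  show thesis
  proof (rule that [of "\<lambda>z. u (s z)"])
    show k: "u (s (q m)) = u m" if "m \<in> carrier M" for m
      using that s [of "q m"] by (intro eq) simp_all
    show "(\<lambda>z. u (s z)) \<in> lmod_hom R Q N"
    proof (rule lmod_homI)
      show "u (s z) \<in> carrier N" if "z \<in> carrier Q" for z
        using s [OF that] by simp
      show "u (s (z \<oplus>\<^bsub>Q\<^esub> z')) = u (s z) \<oplus>\<^bsub>N\<^esub> u (s z')" if "z \<in> carrier Q" "z' \<in> carrier Q" for z z'
        using k [of "s z \<oplus>\<^bsub>M\<^esub> s z'"] s [OF that(1)] s [OF that(2)] by simp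
      show "u (s (a \<odot>\<^bsub>Q\<^esub> z)) = a \<odot>\<^bsub>N\<^esub> u (s z)" if "a \<in> carrier R" "z \<in> carrier Q" for a z
        using k [of "a \<odot>\<^bsub>M\<^esub> s z"] s [OF that(2)] that by simp
    qed
  qed
qed

text \<open>Any lifts \<open>m\<close> and \<open>n\<close> of the projection of \<open>h\<close>
  give an element of \<open>mid G\<close> that differs from \<open>h\<close> by an element of
  \<open>Y\<close>, and this can be absorbed into \<open>m\<close>.\<close>

lemma (in baer_sum_map) surj:
  assumes h: "h \<in> carrier (mid G)"
  obtains m n where "m \<in> carrier (mid E)" and "n \<in> carrier (mid F)"
    and "proj E m = proj F n" and "h = g m n"
proof -
  have x: "proj G h \<in> carrier X"
    using h by simp
  obtain m where m: "m \<in> carrier (mid E)" "proj E m = proj G h"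
    using x by (rule E.proj_lift)
  obtain n where n: "n \<in> carrier (mid F)" "proj F n = proj G h"
    using x by (rule F.proj_lift)
  have "g m n \<in> carrier (mid G)" "proj G h = proj G (g m n)"
    using m n by simp_all
  with h obtain y where y: "y \<in> carrier Y" "h = g m n \<oplus>\<^bsub>mid G\<^esub> incl G y"
    by (rule G.proj_eqE)
  have mn: "proj E m = proj F n"
    using m n by simp
  have "g (m \<oplus>\<^bsub>mid E\<^esub> incl E y) n = h"
    using m(1) n(1) mn y g_add [of m n "incl E y" "\<zero>\<^bsub>mid F\<^esub>"] by simp
  then show thesis
    using that [of "m \<oplus>\<^bsub>mid E\<^esub> incl E y" n] m(1) n(1) mn y(1) by simp
qed

text \<open>The kernel of \<open>g\<close> on the fibre product is the antidiagonal copy of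
  \<open>Y\<close>. There the sum of \<open>u\<close> and \<open>v\<close> vanishes because the two
  maps agree on \<open>Y\<close>.\<close>

lemma (in baer_sum_map) factor:
  assumes "lmod_map R (mid E) M u" and "lmod_map R (mid F) M v"
    and eq: "\<And>y. y \<in> carrier Y \<Longrightarrow> u (incl E y) = v (incl F y)"
  obtains k where "k \<in> lmod_hom R (mid G) M"
    and "\<And>m n. \<lbrakk>m \<in> carrier (mid E); n \<in> carrier (mid F); proj E m = proj F n\<rbrakk> \<Longrightarrow>
      k (g m n) = u m \<oplus>\<^bsub>M\<^esub> v n"
proof -
  interpret u: lmod_map R "mid E" M u by fact
  interpret v: lmod_map R "mid F" M v by fact
  let ?T = "{(m, n). m \<in> carrier (mid E) \<and> n \<in> carrier (mid F) \<and> proj E m = proj F n}"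
  let ?P = "restrict_mod (prod_mod (mid E) (mid F)) ?T"
  interpret prod: left_module R "prod_mod (mid E) (mid F)"
    by (intro left_module_prod_mod E.incl.target.left_module_axioms F.incl.target.left_module_axioms)
  have "submodule ?T R (prod_mod (mid E) (mid F))"
    by (rule prod.submoduleI) auto
  then interpret P: left_module R ?P
    by (intro left_module_restrict_mod prod.left_module_axioms)
  have q: "lmod_map R ?P (mid G) (\<lambda>(m, n). g m n)"
    by (intro lmod_map.intro lmod_map_axioms.intro lmod_homI P.left_module_axioms
        G.incl.target.left_module_axioms) (auto simp: g_add g_smult)
  have w: "lmod_map R ?P M (\<lambda>(m, n). u m \<oplus>\<^bsub>M\<^esub> v n)"
    by (intro lmod_map.intro lmod_map_axioms.intro lmod_homI P.left_module_axioms
        u.target.left_module_axioms) (auto simp: u.target.M.a_ac u.target.smult_r_distr)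
  have surj: "\<exists>p\<in>carrier ?P. (case p of (m, n) \<Rightarrow> g m n) = h" if h: "h \<in> carrier (mid G)" for h
  proof -
    obtain m n where "m \<in> carrier (mid E)" "n \<in> carrier (mid F)" "proj E m = proj F n" "h = g m n"
      using h by (rule surj)
    then show ?thesis
      by (intro bexI [of _ "(m, n)"]) simp_all
  qed
  have ker: "(case p of (m, n) \<Rightarrow> u m \<oplus>\<^bsub>M\<^esub> v n) = \<zero>\<^bsub>M\<^esub>"
    if p: "p \<in> carrier ?P" "(case p of (m, n) \<Rightarrow> g m n) = \<zero>\<^bsub>mid G\<^esub>" for p
  proof -
    obtain m n where mn: "p = (m, n)" "m \<in> carrier (mid E)" "n \<in> carrier (mid F)" "proj E m = proj F n"
        "g m n = \<zero>\<^bsub>mid G\<^esub>"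
      using p by auto
    have "proj E m = \<zero>\<^bsub>X\<^esub>"
      using mn proj_g [of m n] by simp
    then obtain y where y: "y \<in> carrier Y" "m = incl E y"
      by (rule E.proj_eq_zeroE [OF mn(2)])
    have "proj F n = \<zero>\<^bsub>X\<^esub>"
      using \<open>proj E m = \<zero>\<^bsub>X\<^esub>\<close> mn by simp
    then obtain z where z: "z \<in> carrier Y" "n = incl F z"
      by (rule F.proj_eq_zeroE [OF mn(3)])
    have "y \<oplus>\<^bsub>Y\<^esub> z = \<zero>\<^bsub>Y\<^esub>"
      using mn y z G.incl_eq_zero_iff [of "y \<oplus>\<^bsub>Y\<^esub> z"] by (simp del: G.incl.map_add)
    then have "u (incl E (y \<oplus>\<^bsub>Y\<^esub> z)) = \<zero>\<^bsub>M\<^esub>"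
      by simp
    then have "u (incl E y) \<oplus>\<^bsub>M\<^esub> u (incl E z) = \<zero>\<^bsub>M\<^esub>"
      using y z by simp
    then show ?thesis
      using mn y z eq by simp
  qed
  obtain k where k: "k \<in> lmod_hom R (mid G) M"
    "\<And>p. p \<in> carrier ?P \<Longrightarrow> k (case p of (m, n) \<Rightarrow> g m n) = (case p of (m, n) \<Rightarrow> u m \<oplus>\<^bsub>M\<^esub> v n)"
    using lmod_hom_factor [OF q w surj ker] by blast
  show thesis
  proof (rule that [OF k(1)])
    show "k (g m n) = u m \<oplus>\<^bsub>M\<^esub> v n"
      if "m \<in> carrier (mid E)" "n \<in> carrier (mid F)" "proj E m = proj F n" for m n
      using k(2) [of "(m, n)"] that by simp
  qed
qed

section \<open>Direct sums and finite generation\<close>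

definition single :: "'i set \<Rightarrow> ('i \<Rightarrow> ('a, 'b) module) \<Rightarrow> 'i \<Rightarrow> 'b \<Rightarrow> 'i \<Rightarrow> 'b" where
  "single I N j x = (\<lambda>i\<in>I. if i = j then x else \<zero>\<^bsub>N i\<^esub>)"

locale lmod_family =
  fixes R :: "('a, 'k) ring_scheme" and I :: "'i set" and N :: "'i \<Rightarrow> ('a, 'b) module"
  assumes R: "ring R" and N: "i \<in> I \<Longrightarrow> left_module R (N i)"
begin

sublocale sum: left_module R "direct_sum I N"
  by (rule left_module_direct_sum [OF R N])

lemma abelian_monoid_N: "i \<in> I \<Longrightarrow> abelian_monoid (N i)"
  using left_module.axioms(2) [OF N] abelian_group.axioms(1) by blast

lemmas zero_in_N [simp] = abelian_monoid.zero_closed [OF abelian_monoid_N]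

lemma zero_add_zero [simp]: "i \<in> I \<Longrightarrow> \<zero>\<^bsub>N i\<^esub> \<oplus>\<^bsub>N i\<^esub> \<zero>\<^bsub>N i\<^esub> = \<zero>\<^bsub>N i\<^esub>"
  using abelian_monoid.l_zero [OF abelian_monoid_N zero_in_N] .

lemma single_closed [simp]:
  assumes "j \<in> I" and "x \<in> carrier (N j)"
  shows "single I N j x \<in> carrier (direct_sum I N)"
proof -
  have "finite {i \<in> I. single I N j x i \<noteq> \<zero>\<^bsub>N i\<^esub>}"
    by (rule finite_subset [of _ "{j}"]) (auto simp: single_def)
  then show ?thesis
    using assms by (auto simp: carrier_direct_sum single_def)
qed

lemma single_hom:
  assumes "j \<in> I"
  shows "single I N j \<in> lmod_hom R (N j) (direct_sum I N)"
proof (rule lmod_homI)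
  show "single I N j x \<in> carrier (direct_sum I N)" if "x \<in> carrier (N j)" for x
    using assms that by simp
  show "single I N j (a \<odot>\<^bsub>N j\<^esub> x) = a \<odot>\<^bsub>direct_sum I N\<^esub> single I N j x" if "a \<in> carrier R" for a x
    using that left_module.smult_zero_right [OF N] by (auto simp: single_def fun_eq_iff)
qed (auto simp: assms single_def fun_eq_iff)

lemma eval_hom:
  assumes "j \<in> I"
  shows "(\<lambda>f. f j) \<in> lmod_hom R (direct_sum I N) (N j)"
  using assms by (intro lmod_homI) (auto simp: carrier_direct_sum)

lemma eval_diff:
  assumes "j \<in> I" and "f \<in> carrier (direct_sum I N)" and "g \<in> carrier (direct_sum I N)"
  shows "(f \<ominus>\<^bsub>direct_sum I N\<^esub> g) j = f j \<ominus>\<^bsub>N j\<^esub> g j"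
proof -
  interpret lmod_map R "direct_sum I N" "N j" "\<lambda>f. f j"
    by (intro lmod_map.intro lmod_map_axioms.intro sum.left_module_axioms N eval_hom assms)
  show ?thesis
    using assms by simp
qed

text \<open>Induction over a finite set \<open>F\<close> containing the support; the closure
  conditions on \<open>S\<close> reduce membership to elements concentrated at one index.\<close>

lemma direct_sum_induct:
  assumes f: "f \<in> carrier (direct_sum I N)"
    and zero: "\<zero>\<^bsub>direct_sum I N\<^esub> \<in> S"
    and add: "\<And>f g. \<lbrakk>f \<in> S; g \<in> S\<rbrakk> \<Longrightarrow> f \<oplus>\<^bsub>direct_sum I N\<^esub> g \<in> S"
    and single: "\<And>j x. \<lbrakk>j \<in> I; x \<in> carrier (N j)\<rbrakk> \<Longrightarrow> single I N j x \<in> S"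
  shows "f \<in> S"
proof -
  have *: "f \<in> S"
    if "finite F" "f \<in> carrier (direct_sum I N)" "\<And>i. i \<in> I - F \<Longrightarrow> f i = \<zero>\<^bsub>N i\<^esub>" for F f
    using that
  proof (induction F arbitrary: f rule: finite_induct)
    case empty
    then have "f = \<zero>\<^bsub>direct_sum I N\<^esub>"
      by (auto simp: carrier_direct_sum fun_eq_iff extensional_def)
    then show ?case
      using zero by (simp only:)
  next
    case (insert j F)
    show ?case
    proof (cases "j \<in> I")
      case False
      then show ?thesis
        using insert by auto
    next
      case j: True
      interpret Nj: left_module R "N j"
        by (rule N [OF j])
      have fj: "f j \<in> carrier (N j)"
        using insert.prems j by (auto simp: carrier_direct_sum)
      let ?s = "single I N j (f j)"
      \<comment> \<open>Removing the component at \<open>j\<close> leaves an element supported in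
        \<open>F\<close>.\<close>
      let ?f = "f \<ominus>\<^bsub>direct_sum I N\<^esub> ?s"
      have "?f i = \<zero>\<^bsub>N i\<^esub>" if "i \<in> I - F" for i
      proof (cases "i = j")
        case True
        moreover have "?s j = f j"
          using j by (simp add: single_def)
        ultimately show ?thesis
          using j fj insert.prems eval_diff [OF j, of f ?s] by simp
      next
        case False
        then have "f i = \<zero>\<^bsub>N i\<^esub>" "?s i = \<zero>\<^bsub>N i\<^esub>" "i \<in> I"
          using that insert.prems(2) [of i] by (auto simp: single_def)
        then show ?thesis
          using j fj insert.prems eval_diff [of i f ?s] left_module.diff_self [OF N] by simp
      qed
      then have "?f \<in> S"
        using insert.prems j fj by (intro insert.IH) simp_all
      then have "?f \<oplus>\<^bsub>direct_sum I N\<^esub> ?s \<in> S"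
        by (intro add single j fj)
      moreover have "?f \<oplus>\<^bsub>direct_sum I N\<^esub> ?s = f"
        using insert.prems j fj
        by (simp add: sum.M.minus_eq sum.M.a_assoc sum.M.l_neg del: direct_sum_simps)
      ultimately show ?thesis
        by (simp only:)
    qed
  qed
  have "finite {i \<in> I. f i \<noteq> \<zero>\<^bsub>N i\<^esub>}"
    using f by (simp add: carrier_direct_sum)
  then show ?thesis
    using f by (rule *) blast
qed

end

text \<open>The images of the unit vectors of the free module generate \<open>X\<close>. Generation
  is expressed through submodules, since it is always applied to a submodule that is to be shown to
  be everything.\<close>

lemma finitely_presented_generators:
  assumes "ring R" and "finitely_presented R X"
  obtains G where "finite G" and "G \<subseteq> carrier X"
    and "\<And>S. \<lbrakk>submodule S R X; G \<subseteq> S\<rbrakk> \<Longrightarrow> carrier X \<subseteq> S"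
proof -
  interpret R: ring R by fact
  interpret X: left_module R X
    using assms by (simp add: finitely_presented_def)
  from assms obtain n :: nat and \<beta> where \<beta>: "\<beta> \<in> lmod_hom R (free_mod R {..<n}) X"
      "\<beta> ` carrier (free_mod R {..<n}) = carrier X"
    unfolding finitely_presented_def by blast
  let ?N = "\<lambda>_. regular_mod R"
  have "left_module R (regular_mod R)"
    by (rule left_moduleI)
      (auto simp: regular_mod_def R.ring_axioms R.a_ac R.m_assoc R.l_distr R.r_distr R.r_neg
        intro: bexI [of _ "\<ominus>\<^bsub>R\<^esub> x" for x])
  then interpret F: lmod_family R "{..<n}" ?N
    using assms by (simp add: lmod_family_def)
  interpret \<beta>: lmod_map R "direct_sum {..<n} ?N" X \<beta>
    using \<beta> by unfold_locales (simp add: free_mod_def)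
  let ?e = "\<lambda>i. single {..<n} ?N i \<one>\<^bsub>R\<^esub>"
  have [simp]: "carrier (regular_mod R) = carrier R"
    by (simp add: regular_mod_def)
  have e: "?e i \<in> carrier (direct_sum {..<n} ?N)" if "i < n" for i
    using that by simp
  show thesis
  proof (rule that [of "(\<lambda>i. \<beta> (?e i)) ` {..<n}"])
    show "(\<lambda>i. \<beta> (?e i)) ` {..<n} \<subseteq> carrier X"
      using e by auto
    fix S assume S: "submodule S R X" "(\<lambda>i. \<beta> (?e i)) ` {..<n} \<subseteq> S"
    note D = X.submoduleD [OF S(1)]
    let ?S = "{f \<in> carrier (direct_sum {..<n} ?N). \<beta> f \<in> S}"
    have "f \<in> ?S" if "f \<in> carrier (direct_sum {..<n} ?N)" for f
    proof (rule F.direct_sum_induct [OF that])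
      show "\<zero>\<^bsub>direct_sum {..<n} ?N\<^esub> \<in> ?S"
        using D(2) by (simp del: direct_sum_simps)
      show "f \<oplus>\<^bsub>direct_sum {..<n} ?N\<^esub> g \<in> ?S" if "f \<in> ?S" "g \<in> ?S" for f g
        using D(3) that by (simp del: direct_sum_simps)
      show "single {..<n} ?N i r \<in> ?S" if "i \<in> {..<n}" "r \<in> carrier (regular_mod R)" for i r
      proof -
        have "single {..<n} ?N i r = r \<odot>\<^bsub>direct_sum {..<n} ?N\<^esub> ?e i"
          using that by (auto simp: single_def regular_mod_def fun_eq_iff)
        then have "\<beta> (single {..<n} ?N i r) = r \<odot>\<^bsub>X\<^esub> \<beta> (?e i)"
          using that e by (simp del: direct_sum_simps)
        moreover have "\<beta> (?e i) \<in> S"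
          using S(2) that by blast
        ultimately show ?thesis
          using D(4) that by simp
      qed
    qed
    then show "carrier X \<subseteq> S"
      unfolding \<beta>(2) [symmetric] free_mod_def by blast
  qed simp
qed

section \<open>Universal sequences\<close>

lemma direct_sum_val: "\<lbrakk>f \<in> carrier (direct_sum I N); i \<in> I\<rbrakk> \<Longrightarrow> f i \<in> carrier (N i)"
  by (simp add: carrier_direct_sum)

text \<open>The support of a sum or of a scalar multiple can shrink. Any finite set containing it
  gives the same value, so several sums can be taken over one index set.\<close>

lemma summation_eq:
  assumes "left_module R Y" and "f \<in> carrier (direct_sum J (\<lambda>_. Y))"
    and "finite F" and "F \<subseteq> J" and "{j \<in> J. f j \<noteq> \<zero>\<^bsub>Y\<^esub>} \<subseteq> F"
  shows "(\<Oplus>\<^bsub>Y\<^esub>j\<in>{j \<in> J. f j \<noteq> \<zero>\<^bsub>Y\<^esub>}. f j) = (\<Oplus>\<^bsub>Y\<^esub>j\<in>F. f j)"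
proof -
  interpret Y: left_module R Y by fact
  show ?thesis
    using assms by (intro Y.add.finprod_mono_neutral_cong_left) (auto simp: carrier_direct_sum)
qed

lemma summation_single:
  assumes "left_module R Y" and "j \<in> J" and "y \<in> carrier Y"
  shows "(\<Oplus>\<^bsub>Y\<^esub>i\<in>{i \<in> J. single J (\<lambda>_. Y) j y i \<noteq> \<zero>\<^bsub>Y\<^esub>}. single J (\<lambda>_. Y) j y i) = y"
proof -
  interpret Y: left_module R Y by fact
  interpret J: lmod_family R J "\<lambda>_. Y"
    using assms Y.R.ring_axioms by unfold_locales
  have "(\<Oplus>\<^bsub>Y\<^esub>i\<in>{i \<in> J. single J (\<lambda>_. Y) j y i \<noteq> \<zero>\<^bsub>Y\<^esub>}. single J (\<lambda>_. Y) j y i) =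
      (\<Oplus>\<^bsub>Y\<^esub>i\<in>{j}. single J (\<lambda>_. Y) j y i)"
    by (rule summation_eq [OF assms(1) J.single_closed [OF assms(2,3)]])
      (use assms in \<open>auto simp: single_def\<close>)
  also have "\<dots> = y"
    using assms by (simp add: single_def)
  finally show ?thesis .
qed

lemma summation_hom:
  assumes "left_module R Y"
  shows "(\<lambda>f. \<Oplus>\<^bsub>Y\<^esub>j\<in>{j \<in> J. f j \<noteq> \<zero>\<^bsub>Y\<^esub>}. f j) \<in> lmod_hom R (direct_sum J (\<lambda>_. Y)) Y"
proof (rule lmod_homI)
  interpret Y: left_module R Y by fact
  interpret J: lmod_family R J "\<lambda>_. Y"
    using assms Y.R.ring_axioms by unfold_locales
  let ?supp = "\<lambda>f. {j \<in> J. f j \<noteq> \<zero>\<^bsub>Y\<^esub>}"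
  fix f assume f: "f \<in> carrier (direct_sum J (\<lambda>_. Y))"
  then have ff: "f \<in> J \<rightarrow> carrier Y" "finite (?supp f)"
    by (auto simp: carrier_direct_sum)
  then show "(\<Oplus>\<^bsub>Y\<^esub>j\<in>?supp f. f j) \<in> carrier Y"
    by (intro Y.finsum_closed) auto
  show "(\<Oplus>\<^bsub>Y\<^esub>j\<in>?supp (f \<oplus>\<^bsub>direct_sum J (\<lambda>_. Y)\<^esub> g). (f \<oplus>\<^bsub>direct_sum J (\<lambda>_. Y)\<^esub> g) j) =
      (\<Oplus>\<^bsub>Y\<^esub>j\<in>?supp f. f j) \<oplus>\<^bsub>Y\<^esub> (\<Oplus>\<^bsub>Y\<^esub>j\<in>?supp g. g j)"
    if g: "g \<in> carrier (direct_sum J (\<lambda>_. Y))" for g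
  proof -
    have gg: "g \<in> J \<rightarrow> carrier Y" "finite (?supp g)"
      using g by (auto simp: carrier_direct_sum)
    let ?F = "?supp f \<union> ?supp g"
    have fin: "finite ?F" "?F \<subseteq> J"
      using ff gg by auto
    have F: "f \<in> ?F \<rightarrow> carrier Y" "g \<in> ?F \<rightarrow> carrier Y"
      using ff gg by auto
    have "(\<Oplus>\<^bsub>Y\<^esub>j\<in>?supp (f \<oplus>\<^bsub>direct_sum J (\<lambda>_. Y)\<^esub> g). (f \<oplus>\<^bsub>direct_sum J (\<lambda>_. Y)\<^esub> g) j) =
        (\<Oplus>\<^bsub>Y\<^esub>j\<in>?F. (f \<oplus>\<^bsub>direct_sum J (\<lambda>_. Y)\<^esub> g) j)"
      by (rule summation_eq [OF assms J.sum.M.a_closed [OF f g] fin]) auto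
    also have "\<dots> = (\<Oplus>\<^bsub>Y\<^esub>j\<in>?F. f j \<oplus>\<^bsub>Y\<^esub> g j)"
      using F by (intro Y.finsum_cong') auto
    also have "\<dots> = (\<Oplus>\<^bsub>Y\<^esub>j\<in>?F. f j) \<oplus>\<^bsub>Y\<^esub> (\<Oplus>\<^bsub>Y\<^esub>j\<in>?F. g j)"
      by (rule Y.finsum_addf [OF F])
    also have "(\<Oplus>\<^bsub>Y\<^esub>j\<in>?F. f j) = (\<Oplus>\<^bsub>Y\<^esub>j\<in>?supp f. f j)"
      by (rule summation_eq [OF assms f fin, symmetric]) blast
    also have "(\<Oplus>\<^bsub>Y\<^esub>j\<in>?F. g j) = (\<Oplus>\<^bsub>Y\<^esub>j\<in>?supp g. g j)"
      by (rule summation_eq [OF assms g fin, symmetric]) blast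
    finally show ?thesis .
  qed
  show "(\<Oplus>\<^bsub>Y\<^esub>j\<in>?supp (a \<odot>\<^bsub>direct_sum J (\<lambda>_. Y)\<^esub> f). (a \<odot>\<^bsub>direct_sum J (\<lambda>_. Y)\<^esub> f) j) =
      a \<odot>\<^bsub>Y\<^esub> (\<Oplus>\<^bsub>Y\<^esub>j\<in>?supp f. f j)"
    if a: "a \<in> carrier R" for a
  proof -
    have "(\<Oplus>\<^bsub>Y\<^esub>j\<in>?supp (a \<odot>\<^bsub>direct_sum J (\<lambda>_. Y)\<^esub> f). (a \<odot>\<^bsub>direct_sum J (\<lambda>_. Y)\<^esub> f) j) =
        (\<Oplus>\<^bsub>Y\<^esub>j\<in>?supp f. (a \<odot>\<^bsub>direct_sum J (\<lambda>_. Y)\<^esub> f) j)"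
      by (rule summation_eq [OF assms J.sum.smult_closed [OF a f] ff(2)]) (use a in auto)
    also have "\<dots> = (\<Oplus>\<^bsub>Y\<^esub>j\<in>?supp f. a \<odot>\<^bsub>Y\<^esub> f j)"
      using ff a by (intro Y.finsum_cong') auto
    also have "\<dots> = a \<odot>\<^bsub>Y\<^esub> (\<Oplus>\<^bsub>Y\<^esub>j\<in>?supp f. f j)"
    proof -
      have "(\<Oplus>\<^bsub>Y\<^esub>j\<in>F. a \<odot>\<^bsub>Y\<^esub> f j) = a \<odot>\<^bsub>Y\<^esub> (\<Oplus>\<^bsub>Y\<^esub>j\<in>F. f j)" if "finite F" "F \<subseteq> J" for F
        using that
      proof (induction F rule: finite_induct)
        case empty
        then show ?case
          using a by simp
      next
        case (insert j F)
        then have "f j \<in> carrier Y" "f \<in> F \<rightarrow> carrier Y"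
          using ff by auto
        with insert a show ?case
          by (simp add: Y.smult_r_distr Pi_def)
      qed
      then show ?thesis
        using ff by auto
    qed
    finally show ?thesis .
  qed
qed

text \<open>
  All that is needed of the push-out is that every basis element \<open>b\<close> of \<open>Ext\<^sup>1(X, Y)\<close> is the
  pull-back of \<open>E\<close> along the inclusion of the summand with index \<open>(X, b)\<close>, as witnessed by \<open>g X b\<close>.
\<close>

locale universal = extension R Y E "direct_sum (Sigma \<X> B) fst"
  for R :: "('a, 'k) ring_scheme" and \<X> :: "('a, 'x) module set" and Y :: "('a, 'y) module"
    and B :: "('a, 'x) module \<Rightarrow> ('a, 'y, 'x) ext set"
    and E :: "('a, 'y, 'm, ('a, 'x) module \<times> ('a, 'y, 'x) ext \<Rightarrow> 'x) ses"
    and g :: "('a, 'x) module \<Rightarrow> ('a, 'y, 'x) ext \<Rightarrow> 'y \<times> 'x \<Rightarrow> 'm" +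
  assumes semibrick: "semibrick R \<X>"
    and ext_B: "\<lbrakk>X \<in> \<X>; b \<in> B X\<rbrakk> \<Longrightarrow> extension R Y b X"
    and basis: "X \<in> \<X> \<Longrightarrow> lmod_basis (End_ring R X) (Ext1 R X Y) (B X) (ext_class R X Y)"
    and g_hom: "\<lbrakk>X \<in> \<X>; b \<in> B X\<rbrakk> \<Longrightarrow> g X b \<in> lmod_hom R (mid b) (mid E)"
    and g_incl: "\<lbrakk>X \<in> \<X>; b \<in> B X; y \<in> carrier Y\<rbrakk> \<Longrightarrow> g X b (incl b y) = incl E y"
    and proj_g: "\<lbrakk>X \<in> \<X>; b \<in> B X; m \<in> carrier (mid b)\<rbrakk> \<Longrightarrow>
      proj E (g X b m) = single (Sigma \<X> B) fst (X, b) (proj b m)"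

text \<open>The inclusion of a summand of the direct sum of the basis sequences, followed by the map
  to the push-out and the equivalence with \<open>E\<close>, provides \<open>g\<close>. Exactness of
  \<open>E\<close> is part of \<open>universal_ses\<close>, so that direct sum is only shown to be a
  complex, as \<open>pushout\<close> requires.\<close>

lemma universal_sesE:
  assumes semibrick: "semibrick R \<X>" and univ: "universal_ses R \<X> Y E"
  obtains B g where "universal R \<X> Y B E g"
proof -
  obtain B where B: "\<And>X. X \<in> \<X> \<Longrightarrow> B X \<subseteq> {e. is_ses R Y e X}"
      "\<And>X. X \<in> \<X> \<Longrightarrow> lmod_basis (End_ring R X) (Ext1 R X Y) (B X) (ext_class R X Y)"
    and ses: "is_ses R Y E (direct_sum (Sigma \<X> B) fst)"
    and equiv: "ses_equiv R Y
          (pushout_ses (direct_sum (Sigma \<X> B) (\<lambda>_. Y)) Y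
             (\<lambda>f. \<Oplus>\<^bsub>Y\<^esub>j\<in>{j \<in> Sigma \<X> B. f j \<noteq> \<zero>\<^bsub>Y\<^esub>}. f j)
             (direct_sum_ses (Sigma \<X> B) snd)) E"
    using univ unfolding universal_ses_def by blast
  let ?J = "Sigma \<X> B"
  let ?A = "direct_sum ?J (\<lambda>_. Y)"
  let ?s = "\<lambda>f. \<Oplus>\<^bsub>Y\<^esub>j\<in>{j \<in> ?J. f j \<noteq> \<zero>\<^bsub>Y\<^esub>}. f j"
  let ?D = "direct_sum_ses ?J snd"
  interpret E: extension R Y E "direct_sum ?J fst"
    using ses by (simp add: is_ses_iff_extension)
  have extJ: "extension R Y (snd j) (fst j)" if "j \<in> ?J" for j
    using that B(1) [of "fst j"] by (auto simp: is_ses_iff_extension)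
  note ext_ax = extension.axioms(1,2) [OF extJ]
  note R = E.incl.source.R.ring_axioms
  note Y = E.incl.source.left_module_axioms
  have modm: "left_module R (mid (snd j))" if "j \<in> ?J" for j
    using ext_ax [OF that] by (auto simp: lmod_map_def)
  have hom_i: "incl (snd j) \<in> lmod_hom R Y (mid (snd j))"
    and hom_p: "proj (snd j) \<in> lmod_hom R (mid (snd j)) (fst j)" if "j \<in> ?J" for j
    using ext_ax [OF that] by (auto simp: lmod_map_def lmod_map_axioms_def)
  have incl0: "incl (snd j) \<zero>\<^bsub>Y\<^esub> = \<zero>\<^bsub>mid (snd j)\<^esub>"
    and proj0: "proj (snd j) \<zero>\<^bsub>mid (snd j)\<^esub> = \<zero>\<^bsub>fst j\<^esub>" if "j \<in> ?J" for j
    using ext_ax [OF that] lmod_map.map_zero by blast+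
  interpret A: lmod_family R ?J "\<lambda>_. Y"
    using R Y by unfold_locales
  interpret M: lmod_family R ?J "\<lambda>j. mid (snd j)"
    using R modm by (rule lmod_family.intro)
  have mid_D: "mid ?D = direct_sum ?J (\<lambda>j. mid (snd j))"
    and incl_D: "incl ?D = (\<lambda>f. \<lambda>j\<in>?J. incl (snd j) (f j))"
    and proj_D: "proj ?D = (\<lambda>f. \<lambda>j\<in>?J. proj (snd j) (f j))"
    by (simp_all add: direct_sum_ses_def)
  have "incl ?D \<in> lmod_hom R ?A (mid ?D)"
  proof (rule lmod_homI)
    fix f assume f: "f \<in> carrier ?A"
    then have "finite {j \<in> ?J. f j \<noteq> \<zero>\<^bsub>Y\<^esub>}"
      by (simp only: carrier_direct_sum)
    then have "finite {j \<in> ?J. incl (snd j) (f j) \<noteq> \<zero>\<^bsub>mid (snd j)\<^esub>}"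
      by (rule finite_subset [rotated]) (use incl0 in fastforce)
    then have "finite {j \<in> ?J. incl ?D f j \<noteq> \<zero>\<^bsub>mid (snd j)\<^esub>}"
      by (simp only: incl_D restrict_apply' cong: conj_cong)
    moreover have "incl (snd j) (f j) \<in> carrier (mid (snd j))" if "j \<in> ?J" for j
      using f that lmod_homD(1) [OF hom_i [OF that]] by (simp only: carrier_direct_sum)
    ultimately show "incl ?D f \<in> carrier (mid ?D)"
      unfolding mid_D carrier_direct_sum
      by (intro conjI ballI) (simp_all only: incl_D restrict_apply' restrict_extensional)
    show "incl ?D (a \<odot>\<^bsub>?A\<^esub> f) = a \<odot>\<^bsub>mid ?D\<^esub> incl ?D f" if "a \<in> carrier R" for a
      using that by (intro ext) (simp add: mid_D incl_D direct_sum_val [OF f] lmod_homD(3) [OF hom_i])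
    show "incl ?D (f \<oplus>\<^bsub>?A\<^esub> f') = incl ?D f \<oplus>\<^bsub>mid ?D\<^esub> incl ?D f'" if "f' \<in> carrier ?A" for f'
      by (intro ext) (simp add: mid_D incl_D direct_sum_val [OF f] direct_sum_val [OF that] lmod_homD(2) [OF hom_i])
  qed
  then interpret i: lmod_map R ?A "mid ?D" "incl ?D"
    using A.sum.left_module_axioms M.sum.left_module_axioms
    by (simp add: lmod_map_def lmod_map_axioms_def mid_D)
  have "proj ?D \<in> lmod_hom R (mid ?D) (direct_sum ?J fst)"
  proof (rule lmod_homI)
    fix f assume f: "f \<in> carrier (mid ?D)"
    then have "finite {j \<in> ?J. f j \<noteq> \<zero>\<^bsub>mid (snd j)\<^esub>}"
      by (simp only: mid_D carrier_direct_sum)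
    then have "finite {j \<in> ?J. proj (snd j) (f j) \<noteq> \<zero>\<^bsub>fst j\<^esub>}"
      by (rule finite_subset [rotated]) (use proj0 in fastforce)
    then have "finite {j \<in> ?J. proj ?D f j \<noteq> \<zero>\<^bsub>fst j\<^esub>}"
      by (simp only: proj_D restrict_apply' cong: conj_cong)
    moreover have "proj (snd j) (f j) \<in> carrier (fst j)" if "j \<in> ?J" for j
      using f that lmod_homD(1) [OF hom_p [OF that]] by (simp only: carrier_direct_sum mid_D)
    ultimately show "proj ?D f \<in> carrier (direct_sum ?J fst)"
      unfolding carrier_direct_sum
      by (intro conjI ballI) (simp_all only: proj_D restrict_apply' restrict_extensional)
    show "proj ?D (a \<odot>\<^bsub>mid ?D\<^esub> f) = a \<odot>\<^bsub>direct_sum ?J fst\<^esub> proj ?D f" if "a \<in> carrier R" for a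
      using that by (intro ext) (simp add: mid_D proj_D direct_sum_val [OF f [unfolded mid_D]] lmod_homD(3) [OF hom_p])
    show "proj ?D (f \<oplus>\<^bsub>mid ?D\<^esub> f') = proj ?D f \<oplus>\<^bsub>direct_sum ?J fst\<^esub> proj ?D f'"
      if "f' \<in> carrier (mid ?D)" for f'
      by (intro ext) (simp add: mid_D proj_D direct_sum_val [OF f [unfolded mid_D]]
          direct_sum_val [OF that [unfolded mid_D]] lmod_homD(2) [OF hom_p])
  qed
  then interpret p: lmod_map R "mid ?D" "direct_sum ?J fst" "proj ?D"
    by (intro lmod_map.intro lmod_map_axioms.intro E.proj.target.left_module_axioms
        i.target.left_module_axioms)
  interpret s: lmod_map R ?A Y ?s
    by (intro lmod_map.intro lmod_map_axioms.intro summation_hom Y A.sum.left_module_axioms)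
  have "proj ?D (incl ?D f) = \<zero>\<^bsub>direct_sum ?J fst\<^esub>" if "f \<in> carrier ?A" for f
    by (intro ext) (simp add: proj_D incl_D direct_sum_val [OF that] extension.proj_incl [OF extJ])
  then interpret P: pushout R ?A Y ?s ?D "direct_sum ?J fst"
    by (intro pushout.intro pushout_axioms.intro s.lmod_map_axioms i.lmod_map_axioms p.lmod_map_axioms)
  obtain h where h: "h \<in> lmod_hom R (mid (pushout_ses ?A Y ?s ?D)) (mid E)"
    "\<And>y. y \<in> carrier Y \<Longrightarrow> h (incl (pushout_ses ?A Y ?s ?D) y) = incl E y"
    "\<And>m. m \<in> carrier (mid (pushout_ses ?A Y ?s ?D)) \<Longrightarrow>
      proj E (h m) = proj (pushout_ses ?A Y ?s ?D) m"
    using equiv by (rule ses_equivE) blast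
  let ?m = "\<lambda>X b. single ?J (\<lambda>j. mid (snd j)) (X, b)"
  \<comment> \<open>The class has zero in the coordinate of \<open>Y\<close> and \<open>m\<close> in
    the summand with index \<open>(X, b)\<close>.\<close>
  define g where "g X b m = h (P.cls \<zero>\<^bsub>Y\<^esub> (?m X b m))" for X b m
  have single_m: "?m X b m \<in> carrier (mid ?D)"
    if "X \<in> \<X>" "b \<in> B X" "m \<in> carrier (mid b)" for X b m
    using that M.single_closed [of "(X, b)" m] by (simp add: mid_D)
  have "universal R \<X> Y B E g"
  proof (intro universal.intro universal_axioms.intro E.extension_axioms semibrick)
    show "extension R Y b X" if "X \<in> \<X>" "b \<in> B X" for X b
      using extJ [of "(X, b)"] that by simp
    show "lmod_basis (End_ring R X) (Ext1 R X Y) (B X) (ext_class R X Y)" if "X \<in> \<X>" for X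
      by (rule B(2)) fact
    fix X b assume Xb: "X \<in> \<X>" "b \<in> B X"
    then have J: "(X, b) \<in> ?J"
      by simp
    note hom = lmod_homD [OF M.single_hom [OF J]]
    show "g X b \<in> lmod_hom R (mid b) (mid E)"
    proof (rule lmod_homI)
      fix m assume m: "m \<in> carrier (mid b)"
      show "g X b m \<in> carrier (mid E)"
        using single_m [OF Xb m] by (simp add: g_def lmod_homD(1) [OF h(1)])
      show "g X b (a \<odot>\<^bsub>mid b\<^esub> m) = a \<odot>\<^bsub>mid E\<^esub> g X b m" if "a \<in> carrier R" for a
      proof -
        have "?m X b (a \<odot>\<^bsub>mid b\<^esub> m) = a \<odot>\<^bsub>mid ?D\<^esub> ?m X b m"
          using hom(3) [of a m] that m by (simp add: mid_D)
        then show ?thesis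
          using single_m [OF Xb m] that P.cls_smult [of a "\<zero>\<^bsub>Y\<^esub>" "?m X b m"]
            lmod_homD(3) [OF h(1), of a "P.cls \<zero>\<^bsub>Y\<^esub> (?m X b m)"] by (simp add: g_def)
      qed
      fix m' assume m': "m' \<in> carrier (mid b)"
      have "?m X b (m \<oplus>\<^bsub>mid b\<^esub> m') = ?m X b m \<oplus>\<^bsub>mid ?D\<^esub> ?m X b m'"
        using hom(2) [of m m'] m m' by (simp add: mid_D)
      then show "g X b (m \<oplus>\<^bsub>mid b\<^esub> m') = g X b m \<oplus>\<^bsub>mid E\<^esub> g X b m'"
        using single_m [OF Xb m] single_m [OF Xb m']
          P.cls_add [of "\<zero>\<^bsub>Y\<^esub>" "?m X b m" "\<zero>\<^bsub>Y\<^esub>" "?m X b m'"]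
          lmod_homD(2) [OF h(1), of "P.cls \<zero>\<^bsub>Y\<^esub> (?m X b m)" "P.cls \<zero>\<^bsub>Y\<^esub> (?m X b m')"]
        by (simp add: g_def)
    qed
    show "g X b (incl b y) = incl E y" if y: "y \<in> carrier Y" for y
    proof -
      have sy: "single ?J (\<lambda>_. Y) (X, b) y \<in> carrier ?A"
        using J y by (rule A.single_closed)
      \<comment> \<open>An element of \<open>Y\<close> in a single summand has itself as sum, so the
        push-out identifies it with the corresponding element of \<open>Y\<close>. This is why every
        \<open>g X b\<close> restricts to \<open>incl E\<close>.\<close>
      have "incl ?D (single ?J (\<lambda>_. Y) (X, b) y) = ?m X b (incl b y)"
        by (intro ext) (simp add: incl_D single_def incl0)
      then have "P.cls \<zero>\<^bsub>Y\<^esub> (?m X b (incl b y)) = P.cls y \<zero>\<^bsub>mid ?D\<^esub>"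
        using P.cls_eqI [OF sy, of "\<zero>\<^bsub>Y\<^esub>" "\<zero>\<^bsub>mid ?D\<^esub>"] summation_single [OF Y J y] y i.map_closed [OF sy]
        by simp
      then show ?thesis
        using h(2) [OF y] by (simp add: g_def P.incl_pushout)
    qed
    show "proj E (g X b m) = single ?J fst (X, b) (proj b m)" if m: "m \<in> carrier (mid b)" for m
    proof -
      have "proj E (g X b m) = proj ?D (?m X b m)"
        using single_m [OF Xb m] by (simp add: g_def h(3) P.proj_cls)
      also have "\<dots> = single ?J fst (X, b) (proj b m)"
        by (intro ext) (simp add: proj_D single_def proj0)
      finally show ?thesis .
    qed
  qed
  then show thesis
    by (rule that)
qed

section \<open>The two properties of a universal sequence\<close>

context universal
begin

lemma finitely_presented: "X \<in> \<X> \<Longrightarrow> finitely_presented R X"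
  using semibrick by (simp add: semibrick_def brick_def)

lemma left_module_X: "X \<in> \<X> \<Longrightarrow> left_module R X"
  using finitely_presented by (simp add: finitely_presented_def)

sublocale J: lmod_family R "Sigma \<X> B" fst
proof (rule lmod_family.intro)
  show "left_module R (fst j)" if "j \<in> Sigma \<X> B" for j
    using that by (auto intro: left_module_X)
qed (rule incl.source.R.ring_axioms)

text \<open>The projection of \<open>u\<close> is a finite sum of elements concentrated at one
  index, each of which lifts to the image of some \<open>g X b\<close>. Two lifts of the same
  element differ by an element of \<open>Y\<close>.\<close>

lemma generated:
  assumes "u \<in> carrier (mid E)"
    and add: "\<And>u v. \<lbrakk>u \<in> S; v \<in> S\<rbrakk> \<Longrightarrow> u \<oplus>\<^bsub>mid E\<^esub> v \<in> S"
    and base: "\<And>y. y \<in> carrier Y \<Longrightarrow> incl E y \<in> S"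
    and gen: "\<And>X b m. \<lbrakk>X \<in> \<X>; b \<in> B X; m \<in> carrier (mid b)\<rbrakk> \<Longrightarrow> g X b m \<in> S"
  shows "u \<in> S"
proof -
  \<comment> \<open>All lifts are required to lie in \<open>S\<close>; by \<open>step\<close> this
    follows as soon as one of them does, and it gives the induction freedom in choosing lifts of a
    sum.\<close>
  let ?T = "{f. \<forall>u\<in>carrier (mid E). proj E u = f \<longrightarrow> u \<in> S}"
  let ?J = "Sigma \<X> B"
  have step: "u \<in> S"
    if u: "u \<in> carrier (mid E)" and v: "v \<in> carrier (mid E)" "v \<in> S" and uv: "proj E u = proj E v" for u v
  proof -
    obtain y where "y \<in> carrier Y" "u = v \<oplus>\<^bsub>mid E\<^esub> incl E y"
      using u v(1) uv by (rule proj_eqE)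
    then show ?thesis
      using add v base by simp
  qed
  have "proj E u \<in> carrier (direct_sum ?J fst)"
    using assms(1) by simp
  then have "proj E u \<in> {f \<in> carrier (direct_sum ?J fst). f \<in> ?T}"
  proof (rule J.direct_sum_induct)
    have "incl E \<zero>\<^bsub>Y\<^esub> \<in> S"
      using base by blast
    then show "\<zero>\<^bsub>direct_sum ?J fst\<^esub> \<in> {f \<in> carrier (direct_sum ?J fst). f \<in> ?T}"
      using step [of _ "\<zero>\<^bsub>mid E\<^esub>"] by (simp del: direct_sum_simps)
    show "single ?J fst j x \<in> {f \<in> carrier (direct_sum ?J fst). f \<in> ?T}"
      if "j \<in> ?J" "x \<in> carrier (fst j)" for j x
    proof -
      obtain X b where j: "j = (X, b)" "X \<in> \<X>" "b \<in> B X"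
        using \<open>j \<in> ?J\<close> by auto
      interpret b: extension R Y b X
        by (rule ext_B) fact+
      have "x \<in> carrier X"
        using \<open>x \<in> carrier (fst j)\<close> j by simp
      then obtain m where m: "m \<in> carrier (mid b)" "proj b m = x"
        by (rule b.proj_lift)
      then have "proj E (g X b m) = single ?J fst j x" "g X b m \<in> S" "g X b m \<in> carrier (mid E)"
        using j proj_g gen lmod_homD(1) [OF g_hom] by auto
      then show ?thesis
        using step that by auto
    qed
    show "f \<oplus>\<^bsub>direct_sum ?J fst\<^esub> f' \<in> {f \<in> carrier (direct_sum ?J fst). f \<in> ?T}"
      if ff: "f \<in> {f \<in> carrier (direct_sum ?J fst). f \<in> ?T}"
        "f' \<in> {f \<in> carrier (direct_sum ?J fst). f \<in> ?T}" for f f'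
    proof -
      have f: "f \<in> carrier (direct_sum ?J fst)" "f' \<in> carrier (direct_sum ?J fst)"
        using ff by simp_all
      obtain v where v: "v \<in> carrier (mid E)" "proj E v = f"
        using f(1) by (rule proj_lift)
      obtain v' where v': "v' \<in> carrier (mid E)" "proj E v' = f'"
        using f(2) by (rule proj_lift)
      have "v \<in> S" "v' \<in> S"
        using ff v v' by auto
      then have vv: "v \<oplus>\<^bsub>mid E\<^esub> v' \<in> S" "v \<oplus>\<^bsub>mid E\<^esub> v' \<in> carrier (mid E)"
        "proj E (v \<oplus>\<^bsub>mid E\<^esub> v') = f \<oplus>\<^bsub>direct_sum ?J fst\<^esub> f'"
        using add v v' by (auto simp del: direct_sum_simps)
      show ?thesis
        unfolding vv(3) [symmetric] using step [OF _ vv(2,1)] vv(2) by simp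
    qed
  qed
  then show ?thesis
    using assms(1) by simp
qed

text \<open>The last clause says that \<open>k\<close> lies over the map from \<open>X\<close> to
  the direct sum with components \<open>c b\<close> for \<open>b\<close> in \<open>F\<close>; thus
  \<open>G\<close> is the pull-back of \<open>E\<close> along that map. The induction adds one
  pulled-back basis sequence at a time by a Baer sum, and the maps to \<open>mid E\<close> combine
  since they agree on \<open>Y\<close>.\<close>

lemma linear_combination:
  assumes X: "X \<in> \<X>" and "finite F" and "F \<subseteq> B X" and "c \<in> F \<rightarrow> carrier (End_ring R X)"
  obtains G :: "('a, 'y, 'x) ext" and k where "extension R Y G X"
    and "(\<Oplus>\<^bsub>Ext1 R X Y\<^esub>b\<in>F. c b \<odot>\<^bsub>Ext1 R X Y\<^esub> ext_class R X Y b) = ext_class R X Y G"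
    and "k \<in> lmod_hom R (mid G) (mid E)"
    and "\<And>y. y \<in> carrier Y \<Longrightarrow> k (incl G y) = incl E y"
    and "\<And>m j. \<lbrakk>m \<in> carrier (mid G); j \<in> Sigma \<X> B\<rbrakk> \<Longrightarrow>
      proj E (k m) j = (if fst j = X \<and> snd j \<in> F then c (snd j) (proj G m) else \<zero>\<^bsub>fst j\<^esub>)"
proof -
  interpret X: left_module R X
    by (rule left_module_X) fact
  interpret Ext: abelian_monoid "Ext1 R X Y"
    by (rule abelian_monoid_Ext1 [OF X.left_module_axioms incl.source.left_module_axioms])
  let ?term = "\<lambda>b. c b \<odot>\<^bsub>Ext1 R X Y\<^esub> ext_class R X Y b"
  let ?J = "Sigma \<X> B"
  from assms(2-4) have "\<exists>(G :: ('a, 'y, 'x) ext) k. extension R Y G X \<and>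
    (\<Oplus>\<^bsub>Ext1 R X Y\<^esub>b\<in>F. ?term b) = ext_class R X Y G \<and>
    k \<in> lmod_hom R (mid G) (mid E) \<and> (\<forall>y\<in>carrier Y. k (incl G y) = incl E y) \<and>
    (\<forall>m\<in>carrier (mid G). \<forall>j\<in>?J. proj E (k m) j =
      (if fst j = X \<and> snd j \<in> F then c (snd j) (proj G m) else \<zero>\<^bsub>fst j\<^esub>))"
  proof (induction F rule: finite_induct)
    case empty
    \<comment> \<open>The empty combination is the split extension. Its map to \<open>mid E\<close>
      factors through \<open>Y\<close>, so all components vanish.\<close>
    have "(\<lambda>p. incl E (fst p)) \<in> lmod_hom R (mid (split_ses Y X)) (mid E)"
      by (rule lmod_homI) (auto simp: split_ses_def)
    moreover have "proj E (incl E (fst p)) j = \<zero>\<^bsub>fst j\<^esub>"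
      if "p \<in> carrier (mid (split_ses Y X))" "j \<in> ?J" for p j
      using that by (auto simp: split_ses_def)
    ultimately show ?case
      using extension_split_ses [OF incl.source.left_module_axioms X.left_module_axioms]
      by (intro exI [of _ "split_ses Y X"] exI [of _ "\<lambda>p. incl E (fst p)"])
        (simp add: zero_Ext1, simp add: split_ses_def)
  next
    case (insert b F)
    then obtain G :: "('a, 'y, 'x) ext" and k where G: "extension R Y G X"
      "(\<Oplus>\<^bsub>Ext1 R X Y\<^esub>b\<in>F. ?term b) = ext_class R X Y G"
      and k: "k \<in> lmod_hom R (mid G) (mid E)" "\<And>y. y \<in> carrier Y \<Longrightarrow> k (incl G y) = incl E y"
      and proj_k: "\<And>m j. \<lbrakk>m \<in> carrier (mid G); j \<in> ?J\<rbrakk> \<Longrightarrow> proj E (k m) j =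
        (if fst j = X \<and> snd j \<in> F then c (snd j) (proj G m) else \<zero>\<^bsub>fst j\<^esub>)"
      by auto
    have b: "b \<in> B X" and F: "F \<subseteq> B X"
      using insert.prems by auto
    have c: "c b' \<in> lmod_hom R X X" if "b' \<in> insert b F" for b'
      using insert.prems that by (auto simp: End_ring_def)
    interpret b: extension R Y b X
      using X b by (rule ext_B)
    interpret c: lmod_map R X X "c b"
      using c by unfold_locales simp
    let ?P = "pullback_ses X (c b) b"
    interpret P: extension R Y ?P X
      by (rule extension_pullback_ses) (fact b.extension_axioms X.left_module_axioms c.hom)+
    interpret G: extension R Y G X
      by (rule G(1))
    have terms: "?term b' = ext_class R X Y (pullback_ses X (c b') b')"
      "?term b' \<in> carrier (Ext1 R X Y)" if "b' \<in> insert b F" for b'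
    proof -
      have b': "extension R Y b' X"
        using X that insert.prems by (intro ext_B) auto
      show "?term b' = ext_class R X Y (pullback_ses X (c b') b')"
        using b' c [OF that] by (rule Ext1_smult)
      then show "?term b' \<in> carrier (Ext1 R X Y)"
        using ext_class_in_Ext1 [OF extension_pullback_ses [OF b' X.left_module_axioms c [OF that]]]
        by simp
    qed
    obtain H :: "('a, 'y, 'x) ext" and h where "baer_sum_map R Y X ?P G H h"
      using P.extension_axioms G(1) by (rule baer_sum_on_product_type)
    then interpret h: baer_sum_map R Y X ?P G H h .
    have H: "(\<Oplus>\<^bsub>Ext1 R X Y\<^esub>b'\<in>insert b F. ?term b') = ext_class R X Y H"
    proof -
      have "(\<Oplus>\<^bsub>Ext1 R X Y\<^esub>b'\<in>insert b F. ?term b') =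
          ?term b \<oplus>\<^bsub>Ext1 R X Y\<^esub> (\<Oplus>\<^bsub>Ext1 R X Y\<^esub>b\<in>F. ?term b)"
        using insert.hyps terms(2) by (intro Ext.finsum_insert) auto
      also have "\<dots> = ext_class R X Y ?P \<oplus>\<^bsub>Ext1 R X Y\<^esub> ext_class R X Y G"
        using G(2) terms(1) by simp
      also have "\<dots> = ext_class R X Y H"
        by (rule Ext1_add) (rule h.baer_sum_map_axioms)
      finally show ?thesis .
    qed
    \<comment> \<open>The pull-back of \<open>b\<close> along \<open>c b\<close> maps to
      \<open>mid b\<close> and from there by \<open>g X b\<close>; its only component is
      \<open>c b\<close>, at the index \<open>(X, b)\<close>.\<close>
    let ?u = "\<lambda>p. g X b (fst p)"
    have mem_P: "fst p \<in> carrier (mid b)" "proj b (fst p) = c b (proj ?P p)"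
      if "p \<in> carrier (mid ?P)" for p
      using that by (auto simp: pullback_ses_def)
    have u: "lmod_map R (mid ?P) (mid E) ?u"
      by (intro lmod_map.intro lmod_map_axioms.intro lmod_homI P.incl.target.left_module_axioms
          incl.target.left_module_axioms)
        (use lmod_homD [OF g_hom [OF X b]] in \<open>auto simp: pullback_ses_def\<close>)
    then interpret u: lmod_map R "mid ?P" "mid E" ?u .
    interpret k: lmod_map R "mid G" "mid E" k
      using k(1) by unfold_locales
    have uk: "?u (incl ?P y) = k (incl G y)" if "y \<in> carrier Y" for y
      using that k(2) g_incl [OF X b] by (simp add: pullback_ses_def)
    obtain l where l: "l \<in> lmod_hom R (mid H) (mid E)"
      "\<And>p n. \<lbrakk>p \<in> carrier (mid ?P); n \<in> carrier (mid G); proj ?P p = proj G n\<rbrakk> \<Longrightarrow>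
        l (h p n) = ?u p \<oplus>\<^bsub>mid E\<^esub> k n"
      using h.factor [OF u k.lmod_map_axioms uk] by metis
    have "l (incl H y) = incl E y" if "y \<in> carrier Y" for y
    proof -
      have "l (incl H y) = l (h (incl ?P y) \<zero>\<^bsub>mid G\<^esub>)"
        using that by simp
      also have "\<dots> = ?u (incl ?P y)"
        using that by (subst l(2)) simp_all
      also have "\<dots> = incl E y"
        using that g_incl [OF X b] by (simp add: pullback_ses_def)
      finally show ?thesis .
    qed
    moreover have "proj E (l m) j =
        (if fst j = X \<and> snd j \<in> insert b F then c (snd j) (proj H m) else \<zero>\<^bsub>fst j\<^esub>)"
      if m: "m \<in> carrier (mid H)" and j: "j \<in> ?J" for m j
    proof -
      obtain p n where pn: "p \<in> carrier (mid ?P)" "n \<in> carrier (mid G)" "proj ?P p = proj G n" "m = h p n"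
        using m by (rule h.surj)
      have x: "proj H m = proj ?P p" "proj H m = proj G n" "proj H m \<in> carrier X"
        using pn by simp_all
      have "proj E (l m) = proj E (?u p) \<oplus>\<^bsub>direct_sum ?J fst\<^esub> proj E (k n)"
        using pn l(2) by (simp del: direct_sum_simps)
      also have "proj E (?u p) = single ?J fst (X, b) (c b (proj H m))"
        using pn(1) X b mem_P [OF pn(1)] proj_g [OF X b, of "fst p"] x by simp
      finally have lm: "proj E (l m) j =
          single ?J fst (X, b) (c b (proj H m)) j \<oplus>\<^bsub>fst j\<^esub> proj E (k n) j"
        using j by simp
      have cX: "c (snd j) (proj H m) \<in> carrier X" if "snd j \<in> insert b F"
        using lmod_homD(1) [OF c [OF that]] x(3) by blast
      \<comment> \<open>At the index \<open>(X, b)\<close> the contribution of \<open>k\<close> is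
        zero because \<open>b\<close> is not in \<open>F\<close>; at every other index the
        contribution of \<open>?u\<close> is zero.\<close>
      show ?thesis
        using lm cX J.zero_add_zero [OF j] proj_k [OF pn(2) j] j insert.hyps(2) x(2) by (cases j) (auto simp: single_def)
    qed
    ultimately show ?case
      using l(1) H h.G.extension_axioms by blast
  qed
  then show thesis
    using that by blast
qed

text \<open>Spanning makes \<open>P\<close> equivalent to an extension produced by
  \<open>linear_combination\<close>, which already carries such a map. In other words, pushing out
  along \<open>incl E\<close> kills every class in \<open>Ext1 R X Y\<close>.\<close>

lemma extend_incl:
  fixes P :: "('a, 'y, 'x) ext"
  assumes X: "X \<in> \<X>" and P: "extension R Y P X"
  obtains t where "t \<in> lmod_hom R (mid P) (mid E)"
    and "\<And>y. y \<in> carrier Y \<Longrightarrow> t (incl P y) = incl E y"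
proof -
  obtain F c where F: "finite F" "F \<subseteq> B X" "c \<in> F \<rightarrow> carrier (End_ring R X)"
    and sum: "ext_class R X Y P = (\<Oplus>\<^bsub>Ext1 R X Y\<^esub>b\<in>F. c b \<odot>\<^bsub>Ext1 R X Y\<^esub> ext_class R X Y b)"
  proof -
    have "\<forall>A\<in>carrier (Ext1 R X Y). \<exists>F c. finite F \<and> F \<subseteq> B X \<and> c \<in> F \<rightarrow> carrier (End_ring R X) \<and>
        A = (\<Oplus>\<^bsub>Ext1 R X Y\<^esub>b\<in>F. c b \<odot>\<^bsub>Ext1 R X Y\<^esub> ext_class R X Y b)"
      using basis [OF X] unfolding lmod_basis_def by (elim conjE)
    from bspec [OF this ext_class_in_Ext1 [OF P]] show thesis
      using that by (elim exE conjE)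
  qed
  obtain G :: "('a, 'y, 'x) ext" and k where G: "extension R Y G X"
    "(\<Oplus>\<^bsub>Ext1 R X Y\<^esub>b\<in>F. c b \<odot>\<^bsub>Ext1 R X Y\<^esub> ext_class R X Y b) = ext_class R X Y G"
    and k: "k \<in> lmod_hom R (mid G) (mid E)" "\<And>y. y \<in> carrier Y \<Longrightarrow> k (incl G y) = incl E y"
    using X F by (rule linear_combination) blast
  have "ses_equiv R Y P G"
  proof -
    have "G \<in> ext_class R X Y P"
      using sum G ext_class_self [OF G(1)] by simp
    then show ?thesis
      by (simp add: ext_class_iff)
  qed
  then obtain h where h: "h \<in> lmod_hom R (mid P) (mid G)"
    "\<And>y. y \<in> carrier Y \<Longrightarrow> h (incl P y) = incl G y"
    by (rule ses_equivE) blast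
  show thesis
    by (rule that [of "\<lambda>m. k (h m)"])
      (auto intro!: lmod_homI simp: lmod_homD [OF k(1)] lmod_homD [OF h(1)] k(2) h(2))
qed

text \<open>The components of \<open>\<sigma>\<close> at the summands equal to \<open>X\<close> are
  taken as coefficients. The resulting extension \<open>G\<close> maps to \<open>mid E\<close> in
  two ways over the same map to the direct sum, by \<open>k\<close> and through
  \<open>\<sigma>\<close>; their difference is a retraction onto \<open>Y\<close>. Hence
  \<open>G\<close> splits and independence makes the coefficients zero.\<close>

lemma hom_into_base:
  assumes X: "X \<in> \<X>" and \<sigma>: "\<sigma> \<in> lmod_hom R X (mid E)" and x: "x \<in> carrier X"
  shows "\<sigma> x \<in> incl E ` carrier Y"
proof -
  interpret X: left_module R X
    by (rule left_module_X) fact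
  interpret \<sigma>: lmod_map R X "mid E" \<sigma>
    using \<sigma> by unfold_locales
  let ?J = "Sigma \<X> B"
  have val: "proj E (\<sigma> x) j \<in> carrier (fst j)" if "x \<in> carrier X" "j \<in> ?J" for x j
    using that by (intro direct_sum_val [of _ ?J fst]) simp_all
  have comp: "(\<lambda>x. proj E (\<sigma> x) j) \<in> lmod_hom R X (fst j)" if "j \<in> ?J" for j
    using that val by (intro lmod_homI) simp_all
  \<comment> \<open>Summands other than \<open>X\<close> receive nothing, by orthogonality in the
    semibrick.\<close>
  have vanish: "proj E (\<sigma> x) j = \<zero>\<^bsub>fst j\<^esub>" if "j \<in> ?J" "fst j \<noteq> X" "x \<in> carrier X" for j x
  proof -
    have "fst j \<in> \<X>"
      using \<open>j \<in> ?J\<close> by auto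
    moreover have "\<forall>X\<in>\<X>. \<forall>X'\<in>\<X>. X \<noteq> X' \<longrightarrow>
        (\<forall>f\<in>lmod_hom R X X'. \<forall>x\<in>carrier X. f x = \<zero>\<^bsub>X'\<^esub>)"
      using semibrick unfolding semibrick_def by (elim conjE)
    ultimately have "\<forall>f\<in>lmod_hom R X (fst j). \<forall>x\<in>carrier X. f x = \<zero>\<^bsub>fst j\<^esub>"
      using X \<open>fst j \<noteq> X\<close> by metis
    from bspec [OF this comp [OF \<open>j \<in> ?J\<close>]] show ?thesis
      using \<open>x \<in> carrier X\<close> by simp
  qed
  \<comment> \<open>The restriction to \<open>carrier X\<close> makes the component extensional, as
    elements of \<open>End_ring R X\<close> have to be.\<close>
  define c where "c b = (\<lambda>x\<in>carrier X. proj E (\<sigma> x) (X, b))" for b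
  have c: "c b \<in> carrier (End_ring R X)" if "b \<in> B X" for b
  proof -
    have "(X, b) \<in> ?J"
      using X that by simp
    from lmod_homD [OF comp [OF this]] show ?thesis
      by (auto simp: End_ring_def c_def intro!: lmod_homI)
  qed
  define F where "F = {b \<in> B X. c b \<noteq> \<zero>\<^bsub>End_ring R X\<^esub>}"
  have "finite F"
  proof -
    obtain Gs where Gs: "finite Gs" "Gs \<subseteq> carrier X"
      and gen: "\<And>S. \<lbrakk>submodule S R X; Gs \<subseteq> S\<rbrakk> \<Longrightarrow> carrier X \<subseteq> S"
      using finitely_presented_generators [OF incl.source.R.ring_axioms finitely_presented [OF X]] by blast
    \<comment> \<open>The supports of the images of finitely many generators. Their union contains
      the support of every \<open>proj E (\<sigma> x)\<close>, so only finitely many coefficients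
      are nonzero and independence, a statement about finite sums, applies.\<close>
    define T where "T = (\<Union>x\<in>Gs. {j \<in> ?J. proj E (\<sigma> x) j \<noteq> \<zero>\<^bsub>fst j\<^esub>})"
    have "finite {j \<in> ?J. proj E (\<sigma> x) j \<noteq> \<zero>\<^bsub>fst j\<^esub>}" if "x \<in> carrier X" for x
    proof -
      have "proj E (\<sigma> x) \<in> carrier (direct_sum ?J fst)"
        using that by simp
      then show ?thesis
        by (simp only: carrier_direct_sum)
    qed
    then have "finite T"
      using Gs by (auto simp: T_def)
    have zeroJ: "a \<odot>\<^bsub>fst j\<^esub> \<zero>\<^bsub>fst j\<^esub> = \<zero>\<^bsub>fst j\<^esub>" if "a \<in> carrier R" "j \<in> ?J" for a j
      using that left_module.smult_zero_right [OF J.N] by blast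
    let ?S = "{x \<in> carrier X. \<forall>j\<in>?J - T. proj E (\<sigma> x) j = \<zero>\<^bsub>fst j\<^esub>}"
    have "submodule ?S R X"
    proof (rule X.submoduleI)
      show "\<zero>\<^bsub>X\<^esub> \<in> ?S"
        by simp
      show "x \<oplus>\<^bsub>X\<^esub> x' \<in> ?S" if "x \<in> ?S" "x' \<in> ?S" for x x'
        using that by simp
      show "a \<odot>\<^bsub>X\<^esub> x \<in> ?S" if "a \<in> carrier R" "x \<in> ?S" for a x
        using that zeroJ by simp
    qed auto
    moreover have "Gs \<subseteq> ?S"
      using Gs by (auto simp: T_def)
    ultimately have "carrier X \<subseteq> ?S"
      by (rule gen)
    have "b \<in> snd ` T" if "b \<in> F" for b
    proof (rule ccontr)
      assume "b \<notin> snd ` T"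
      then have "(X, b) \<in> ?J - T"
        using that X by (force simp: F_def)
      then have "proj E (\<sigma> x) (X, b) = \<zero>\<^bsub>X\<^esub>" if "x \<in> carrier X" for x
        using \<open>carrier X \<subseteq> ?S\<close> that by fastforce
      then have "c b = \<zero>\<^bsub>End_ring R X\<^esub>"
        by (auto simp: c_def End_ring_def)
      then show False
        using that by (simp add: F_def)
    qed
    then have "F \<subseteq> snd ` T"
      by blast
    then show ?thesis
      using \<open>finite T\<close> by (meson finite_imageI finite_subset)
  qed
  have F: "F \<subseteq> B X" "c \<in> F \<rightarrow> carrier (End_ring R X)"
    using c by (auto simp: F_def)
  obtain G :: "('a, 'y, 'x) ext" and k where G: "extension R Y G X"
    "(\<Oplus>\<^bsub>Ext1 R X Y\<^esub>b\<in>F. c b \<odot>\<^bsub>Ext1 R X Y\<^esub> ext_class R X Y b) = ext_class R X Y G"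
    and k: "k \<in> lmod_hom R (mid G) (mid E)" "\<And>y. y \<in> carrier Y \<Longrightarrow> k (incl G y) = incl E y"
    and proj_k: "\<And>m j. \<lbrakk>m \<in> carrier (mid G); j \<in> ?J\<rbrakk> \<Longrightarrow> proj E (k m) j =
        (if fst j = X \<and> snd j \<in> F then c (snd j) (proj G m) else \<zero>\<^bsub>fst j\<^esub>)"
    using X \<open>finite F\<close> F by (rule linear_combination) blast
  interpret G: extension R Y G X
    by (rule G(1))
  interpret k: lmod_map R "mid G" "mid E" k
    using k(1) by unfold_locales
  have proj_eq: "proj E (k m) = proj E (\<sigma> (proj G m))" if m: "m \<in> carrier (mid G)" for m
  proof (rule extensionalityI [of _ ?J])
    have "proj E (k m) \<in> carrier (direct_sum ?J fst)" "proj E (\<sigma> (proj G m)) \<in> carrier (direct_sum ?J fst)"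
      using m by simp_all
    then show "proj E (k m) \<in> extensional ?J" "proj E (\<sigma> (proj G m)) \<in> extensional ?J"
      by (simp_all only: carrier_direct_sum)
    fix j assume j: "j \<in> ?J"
    have x: "proj G m \<in> carrier X"
      using m by simp
    show "proj E (k m) j = proj E (\<sigma> (proj G m)) j"
    proof (cases "fst j = X")
      case False
      then show ?thesis
        using proj_k [OF m j] vanish [OF j False x] by simp
    next
      case True
      then have Xj: "(X, snd j) = j"
        by auto
      show ?thesis
      proof (cases "snd j \<in> F")
        case True
        then show ?thesis
          using proj_k [OF m j] \<open>fst j = X\<close> x Xj by (simp add: c_def)
      next
        case False
        then have "c (snd j) = \<zero>\<^bsub>End_ring R X\<^esub>"
          using j \<open>fst j = X\<close> by (auto simp: F_def)
        then have "c (snd j) (proj G m) = \<zero>\<^bsub>X\<^esub>"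
          using x by (simp add: End_ring_def)
        then show ?thesis
          using proj_k [OF m j] \<open>fst j = X\<close> x False Xj by (simp add: c_def)
      qed
    qed
  qed
  \<comment> \<open>This difference projects to zero, so it takes values in \<open>Y\<close>. On the
    image of \<open>Y\<close> the part coming from \<open>\<sigma>\<close> vanishes and
    \<open>k\<close> is the inclusion, so it is the identity there.\<close>
  let ?d = "\<lambda>m. k m \<ominus>\<^bsub>mid E\<^esub> \<sigma> (proj G m)"
  have "\<exists>y\<in>carrier Y. incl E y = ?d m" if m: "m \<in> carrier (mid G)" for m
  proof -
    have "?d m \<in> carrier (mid E)" "proj E (?d m) = \<zero>\<^bsub>direct_sum ?J fst\<^esub>"
      using m proj_eq [OF m] by (simp_all del: direct_sum_simps)
    then obtain y where "y \<in> carrier Y" "?d m = incl E y"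
      by (rule proj_eq_zeroE)
    then show ?thesis
      by auto
  qed
  then obtain \<rho> where \<rho>: "\<And>m. m \<in> carrier (mid G) \<Longrightarrow> \<rho> m \<in> carrier Y"
    "\<And>m. m \<in> carrier (mid G) \<Longrightarrow> incl E (\<rho> m) = ?d m"
    by metis
  note Z = incl.target.M.minus_eq incl.target.M.a_ac incl.target.M.minus_add
  have "(\<lambda>m. (\<rho> m, proj G m)) \<in> lmod_hom R (mid G) (mid (split_ses Y X))"
  proof (rule lmod_homI)
    fix m assume m: "m \<in> carrier (mid G)"
    show "(\<rho> m, proj G m) \<in> carrier (mid (split_ses Y X))"
      using m \<rho>(1) by (simp add: split_ses_def)
    have "\<rho> (a \<odot>\<^bsub>mid G\<^esub> m) = a \<odot>\<^bsub>Y\<^esub> \<rho> m" if a: "a \<in> carrier R" for a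
    proof -
      have "incl E (\<rho> (a \<odot>\<^bsub>mid G\<^esub> m)) = a \<odot>\<^bsub>mid E\<^esub> k m \<ominus>\<^bsub>mid E\<^esub> a \<odot>\<^bsub>mid E\<^esub> \<sigma> (proj G m)"
        using a m \<rho>(2) by simp
      also have "\<dots> = a \<odot>\<^bsub>mid E\<^esub> ?d m"
        using a m incl.target.smult_diff by simp
      also have "\<dots> = incl E (a \<odot>\<^bsub>Y\<^esub> \<rho> m)"
        using a m \<rho> by simp
      finally show ?thesis
        using a m \<rho>(1) by (simp del: incl.map_smult)
    qed
    then show "(\<rho> (a \<odot>\<^bsub>mid G\<^esub> m), proj G (a \<odot>\<^bsub>mid G\<^esub> m)) =
        a \<odot>\<^bsub>mid (split_ses Y X)\<^esub> (\<rho> m, proj G m)" if "a \<in> carrier R" for a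
      using that m by (simp add: split_ses_def)
    fix m' assume m': "m' \<in> carrier (mid G)"
    have "incl E (\<rho> (m \<oplus>\<^bsub>mid G\<^esub> m')) = ?d m \<oplus>\<^bsub>mid E\<^esub> ?d m'"
      using m m' \<rho>(2) by (simp add: Z)
    also have "\<dots> = incl E (\<rho> m \<oplus>\<^bsub>Y\<^esub> \<rho> m')"
      using m m' \<rho> by simp
    finally have "\<rho> (m \<oplus>\<^bsub>mid G\<^esub> m') = \<rho> m \<oplus>\<^bsub>Y\<^esub> \<rho> m'"
      using m m' \<rho>(1) by (simp del: incl.map_add)
    then show "(\<rho> (m \<oplus>\<^bsub>mid G\<^esub> m'), proj G (m \<oplus>\<^bsub>mid G\<^esub> m')) =
        (\<rho> m, proj G m) \<oplus>\<^bsub>mid (split_ses Y X)\<^esub> (\<rho> m', proj G m')"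
      using m m' by (simp add: split_ses_def)
  qed
  moreover have "\<rho> (incl G y) = y" if "y \<in> carrier Y" for y
  proof -
    have "incl E (\<rho> (incl G y)) = incl E y"
      using that \<rho>(2) [of "incl G y"] k(2) [OF that] by (simp add: incl.target.M.minus_eq)
    then show ?thesis
      using that \<rho>(1) by simp
  qed
  moreover have split: "extension R Y (split_ses Y X) X"
    by (rule extension_split_ses [OF incl.source.left_module_axioms X.left_module_axioms])
  ultimately have "ses_equiv R Y G (split_ses Y X)"
    using G(1) by (intro ses_equiv_of_hom [where g = "\<lambda>m. (\<rho> m, proj G m)"])
      (auto simp: split_ses_def)
  then have "ext_class R X Y G = \<zero>\<^bsub>Ext1 R X Y\<^esub>"
    using G(1) split by (simp add: zero_Ext1 ext_class_eqI)
  then have "\<forall>b\<in>F. c b = \<zero>\<^bsub>End_ring R X\<^esub>"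
  proof -
    have "\<forall>F c. finite F \<longrightarrow> F \<subseteq> B X \<longrightarrow> c \<in> F \<rightarrow> carrier (End_ring R X) \<longrightarrow>
        (\<Oplus>\<^bsub>Ext1 R X Y\<^esub>b\<in>F. c b \<odot>\<^bsub>Ext1 R X Y\<^esub> ext_class R X Y b) = \<zero>\<^bsub>Ext1 R X Y\<^esub> \<longrightarrow>
        (\<forall>b\<in>F. c b = \<zero>\<^bsub>End_ring R X\<^esub>)"
      using basis [OF X] unfolding lmod_basis_def by (elim conjE)
    from this [rule_format, OF \<open>finite F\<close> F] show ?thesis
      using G(2) \<open>ext_class R X Y G = \<zero>\<^bsub>Ext1 R X Y\<^esub>\<close> by simp
  qed
  \<comment> \<open>\<open>F\<close> was chosen to contain exactly the indices with nonzero
    coefficient.\<close>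
  then have "F = {}"
    by (auto simp: F_def)
  obtain m where m: "m \<in> carrier (mid G)" "proj G m = x"
    using x by (rule G.proj_lift)
  have "proj E (\<sigma> x) = \<zero>\<^bsub>direct_sum ?J fst\<^esub>"
  proof (rule extensionalityI [of _ ?J])
    have "proj E (\<sigma> x) \<in> carrier (direct_sum ?J fst)"
      using x by simp
    then show "proj E (\<sigma> x) \<in> extensional ?J"
      by (simp only: carrier_direct_sum)
    show "proj E (\<sigma> x) j = \<zero>\<^bsub>direct_sum ?J fst\<^esub> j" if "j \<in> ?J" for j
      using that m proj_eq [OF m(1)] proj_k [OF m(1) that] \<open>F = {}\<close> by simp
  qed simp
  moreover have "\<sigma> x \<in> carrier (mid E)"
    using x by simp
  ultimately obtain y where "y \<in> carrier Y" "\<sigma> x = incl E y"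
    by (elim proj_eq_zeroE [rotated])
  then show ?thesis
    by simp
qed

end

section \<open>Towers of universal sequences\<close>

text \<open>Finitely many generators lie in a common member of an increasing chain. The chain starts
  at \<open>j\<close>, since nothing is known about the terms of a tower at index 0.\<close>

lemma finitely_presented_chain:
  fixes S :: "nat \<Rightarrow> 'x set"
  assumes "ring R" and "finitely_presented R X"
    and sub: "\<And>k. k \<ge> j \<Longrightarrow> submodule (S k) R X"
    and mono: "\<And>k l. \<lbrakk>j \<le> k; k \<le> l\<rbrakk> \<Longrightarrow> S k \<subseteq> S l"
    and union: "\<And>x. x \<in> carrier X \<Longrightarrow> \<exists>k\<ge>j. x \<in> S k"
  shows "\<exists>k\<ge>j. carrier X \<subseteq> S k"
proof -
  obtain G where G: "finite G" "G \<subseteq> carrier X"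
    and gen: "\<And>S. \<lbrakk>submodule S R X; G \<subseteq> S\<rbrakk> \<Longrightarrow> carrier X \<subseteq> S"
    using finitely_presented_generators [OF assms(1,2)] by blast
  from G have "\<exists>k\<ge>j. G \<subseteq> S k"
  proof (induction G rule: finite_induct)
    case (insert x G)
    then obtain k l where "k \<ge> j" "G \<subseteq> S k" "l \<ge> j" "x \<in> S l"
      using union [of x] by blast
    then have "insert x G \<subseteq> S (max k l)"
      using mono [of k "max k l"] mono [of l "max k l"] by auto
    then show ?case
      using \<open>k \<ge> j\<close> by (intro exI [of _ "max k l"]) auto
  qed auto
  then show ?thesis
    using gen sub by blast
qed

section \<open>Homomorphisms into the limit of a tower\<close>

locale tower =
  fixes R :: "('a, 'k) ring_scheme" and \<X> :: "('a, 'x) module set" and V :: "('a, 'v) module"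
    and e :: "'v \<Rightarrow> 'n" and VX :: "nat \<Rightarrow> 'n set" and Vinf :: "('a, 'n) module"
  assumes semibrick: "semibrick R \<X>" and tower: "universal_tower R \<X> V e VX Vinf"
begin

sublocale Vinf: left_module R Vinf
  using tower by (simp add: universal_tower_def)

lemma submodule_VX: "i \<ge> 1 \<Longrightarrow> submodule (VX i) R Vinf"
  using tower by (simp add: universal_tower_def)

lemmas VX_D = Vinf.submoduleD [OF submodule_VX]

lemma VX_diff: "\<lbrakk>i \<ge> 1; x \<in> VX i; y \<in> VX i\<rbrakk> \<Longrightarrow> x \<ominus>\<^bsub>Vinf\<^esub> y \<in> VX i"
  unfolding Vinf.M.minus_eq by (intro VX_D)

lemma carrier_Vinf: "v \<in> carrier Vinf \<Longrightarrow> \<exists>i\<ge>1. v \<in> VX i"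
  using tower by (auto simp: universal_tower_def)

lemma finitely_presented: "X \<in> \<X> \<Longrightarrow> finitely_presented R X"
  using semibrick by (simp add: semibrick_def brick_def)

lemma left_module_X: "X \<in> \<X> \<Longrightarrow> left_module R X"
  using finitely_presented by (simp add: finitely_presented_def)

lemma universalE:
  assumes "i \<ge> 1"
  obtains B E g where "universal R \<X> (restrict_mod Vinf (VX i)) B E g"
    and "mid E = restrict_mod Vinf (VX (Suc i))" and "\<And>y. y \<in> VX i \<Longrightarrow> incl E y = y"
proof -
  obtain E where E: "universal_ses R \<X> (restrict_mod Vinf (VX i)) E"
    "mid E = restrict_mod Vinf (VX (Suc i))" "\<And>y. y \<in> VX i \<Longrightarrow> incl E y = y"
    using tower assms unfolding universal_tower_def by auto
  obtain B g where "universal R \<X> (restrict_mod Vinf (VX i)) B E g"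
    using semibrick E(1) by (rule universal_sesE)
  then show thesis
    using E(2,3) by (rule that)
qed

lemma VX_Suc: "i \<ge> 1 \<Longrightarrow> VX i \<subseteq> VX (Suc i)"
proof
  fix y assume i: "i \<ge> 1" and y: "y \<in> VX i"
  obtain B E g where u: "universal R \<X> (restrict_mod Vinf (VX i)) B E g"
    and E: "mid E = restrict_mod Vinf (VX (Suc i))" "\<And>y. y \<in> VX i \<Longrightarrow> incl E y = y"
    using i by (rule universalE) blast
  interpret universal R \<X> "restrict_mod Vinf (VX i)" B E g by (rule u)
  show "y \<in> VX (Suc i)"
    using incl.map_closed [of y] y E by simp
qed

lemma VX_mono:
  assumes "1 \<le> i" and "i \<le> j"
  shows "VX i \<subseteq> VX j"
  using assms(2)
proof (induction j rule: dec_induct)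
  case (step j)
  then show ?case
    using VX_Suc [of j] assms(1) by simp
qed simp

lemma hom_from_X_step:
  assumes "X \<in> \<X>" and "i \<ge> 1" and "\<sigma> \<in> lmod_hom R X Vinf"
    and "\<sigma> ` carrier X \<subseteq> VX (Suc i)"
  shows "\<sigma> ` carrier X \<subseteq> VX i"
proof -
  obtain B E g where u: "universal R \<X> (restrict_mod Vinf (VX i)) B E g"
    and E: "mid E = restrict_mod Vinf (VX (Suc i))" "\<And>y. y \<in> VX i \<Longrightarrow> incl E y = y"
    using \<open>i \<ge> 1\<close> by (rule universalE) blast
  interpret universal R \<X> "restrict_mod Vinf (VX i)" B E g by (rule u)
  have "\<sigma> \<in> lmod_hom R X (mid E)"
    using assms(3,4) by (auto simp: E(1) lmod_hom_def)
  then have "\<sigma> x \<in> incl E ` VX i" if "x \<in> carrier X" for x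
    using hom_into_base [OF assms(1) _ that] by simp
  then show ?thesis
    using E(2) by force
qed

text \<open>Finite generation confines the image to some \<open>VX k\<close>; from there it is
  pushed down one term at a time.\<close>

lemma hom_from_X:
  assumes X: "X \<in> \<X>" and \<sigma>: "\<sigma> \<in> lmod_hom R X Vinf"
  shows "\<sigma> ` carrier X \<subseteq> VX 1"
proof -
  interpret X: left_module R X
    by (rule left_module_X) fact
  interpret \<sigma>: lmod_map R X Vinf \<sigma>
    using \<sigma> by unfold_locales
  have "\<exists>k\<ge>1. carrier X \<subseteq> {x \<in> carrier X. \<sigma> x \<in> VX k}"
  proof (rule finitely_presented_chain [OF Vinf.R.ring_axioms finitely_presented [OF X]])
    show "submodule {x \<in> carrier X. \<sigma> x \<in> VX k} R X" if "k \<ge> 1" for k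
      using VX_D [OF that] by (intro X.submoduleI) auto
    show "{x \<in> carrier X. \<sigma> x \<in> VX k} \<subseteq> {x \<in> carrier X. \<sigma> x \<in> VX l}" if "1 \<le> k" "k \<le> l" for k l
      using VX_mono [OF that] by blast
    show "\<exists>k\<ge>1. x \<in> {x \<in> carrier X. \<sigma> x \<in> VX k}" if "x \<in> carrier X" for x
      using carrier_Vinf [of "\<sigma> x"] that by simp
  qed
  then obtain k where k: "k \<ge> 1" "\<sigma> ` carrier X \<subseteq> VX k"
    by auto
  then show ?thesis
  \<comment> \<open>The containment in \<open>VX k\<close> is a premise of the statement under
    induction, so the step passes from \<open>Suc k\<close> down to \<open>k\<close>.\<close>
  proof (induction k rule: dec_induct)
    case (step k)
    show ?case
      by (rule step.IH [OF hom_from_X_step [OF X step.hyps(1) \<sigma> step.prems]])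
  qed
qed

text \<open>
  The heart of the argument: a homomorphism from an extension of \<open>X\<close> by \<open>Y\<close> into \<open>V(i + 2)\<close> that maps
  \<open>Y\<close> into \<open>V(i)\<close> gives rise to an extension \<open>P\<close> of \<open>X\<close> by \<open>V(i)\<close>.  The inclusion of \<open>V(i)\<close> into
  \<open>V(i + 1)\<close> extends to \<open>P\<close>, and subtracting the extension yields a homomorphism from \<open>X\<close> to
  \<open>V(i + 2)\<close>, which must take values in \<open>V(i + 1)\<close>.
\<close>

lemma hom_from_extension_step:
  assumes X: "X \<in> \<X>" and E: "extension R Y E X" and i: "i \<ge> 1"
    and \<phi>: "\<phi> \<in> lmod_hom R (mid E) Vinf"
    and base: "\<And>y. y \<in> carrier Y \<Longrightarrow> \<phi> (incl E y) \<in> VX i"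
    and image: "\<phi> ` carrier (mid E) \<subseteq> VX (Suc (Suc i))"
  shows "\<phi> ` carrier (mid E) \<subseteq> VX (Suc i)"
proof -
  interpret E: extension R Y E X by (rule E)
  interpret \<phi>: lmod_map R "mid E" Vinf \<phi>
    using \<phi> by unfold_locales
  note W = VX_D [OF i]
  \<comment> \<open>\<open>C\<close> is the pull-back of \<open>Vinf\<close> along the homomorphism
    from \<open>X\<close> to the quotient of \<open>Vinf\<close> by \<open>VX i\<close> that
    \<open>\<phi>\<close> induces, written without the quotient. As a set of pairs it has the type
    that \<open>extend_incl\<close> expects of a middle term.\<close>
  define C where "C = {(\<phi> m \<oplus>\<^bsub>Vinf\<^esub> w, proj E m) |m w. m \<in> carrier (mid E) \<and> w \<in> VX i}"
  have C_I: "(\<phi> m \<oplus>\<^bsub>Vinf\<^esub> w, proj E m) \<in> C" if "m \<in> carrier (mid E)" "w \<in> VX i" for m w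
    using that by (auto simp: C_def)
  have wV: "w \<in> carrier Vinf" if "w \<in> VX i" for w
    using W(1) that by blast
  interpret prod: left_module R "prod_mod Vinf X"
    by (intro left_module_prod_mod Vinf.left_module_axioms E.proj.target.left_module_axioms)
  have subC: "submodule C R (prod_mod Vinf X)"
  proof (rule prod.submoduleI)
    show "C \<subseteq> carrier (prod_mod Vinf X)"
      using wV by (auto simp: C_def)
    show "\<zero>\<^bsub>prod_mod Vinf X\<^esub> \<in> C"
      using C_I [of "\<zero>\<^bsub>mid E\<^esub>" "\<zero>\<^bsub>Vinf\<^esub>"] W(2) by simp
    show "p \<oplus>\<^bsub>prod_mod Vinf X\<^esub> q \<in> C" if pq: "p \<in> C" "q \<in> C" for p q
    proof -
      obtain m w where p: "m \<in> carrier (mid E)" "w \<in> VX i" "p = (\<phi> m \<oplus>\<^bsub>Vinf\<^esub> w, proj E m)"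
        using pq(1) by (auto simp: C_def)
      obtain m' w' where q: "m' \<in> carrier (mid E)" "w' \<in> VX i" "q = (\<phi> m' \<oplus>\<^bsub>Vinf\<^esub> w', proj E m')"
        using pq(2) by (auto simp: C_def)
      show ?thesis
        using C_I [of "m \<oplus>\<^bsub>mid E\<^esub> m'" "w \<oplus>\<^bsub>Vinf\<^esub> w'"] p q W(3) wV by (simp add: Vinf.M.a_ac)
    qed
    show "a \<odot>\<^bsub>prod_mod Vinf X\<^esub> p \<in> C" if a: "a \<in> carrier R" and pC: "p \<in> C" for a p
    proof -
      obtain m w where p: "m \<in> carrier (mid E)" "w \<in> VX i" "p = (\<phi> m \<oplus>\<^bsub>Vinf\<^esub> w, proj E m)"
        using pC by (auto simp: C_def)
      show ?thesis
        using C_I [of "a \<odot>\<^bsub>mid E\<^esub> m" "a \<odot>\<^bsub>Vinf\<^esub> w"] p a W(4) wV by (simp add: Vinf.smult_r_distr)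
    qed
  qed
  define P :: "('a, 'n, 'x) ext" where
    "P = \<lparr>mid = restrict_mod (prod_mod Vinf X) C, incl = (\<lambda>w. (w, \<zero>\<^bsub>X\<^esub>)), proj = snd\<rparr>"
  have [simp]: "mid P = restrict_mod (prod_mod Vinf X) C" "incl P = (\<lambda>w. (w, \<zero>\<^bsub>X\<^esub>))" "proj P = snd"
    by (simp_all add: P_def)
  have P: "extension R (restrict_mod Vinf (VX i)) P X"
  proof (rule extensionI)
    show "left_module R (restrict_mod Vinf (VX i))"
      by (intro left_module_restrict_mod Vinf.left_module_axioms submodule_VX i)
    show "left_module R (mid P)"
      using left_module_restrict_mod [OF prod.left_module_axioms subC] by simp
    show "incl P \<in> lmod_hom R (restrict_mod Vinf (VX i)) (mid P)"
    proof (rule lmod_homI)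
      show "incl P w \<in> carrier (mid P)" if "w \<in> carrier (restrict_mod Vinf (VX i))" for w
        using that C_I [of "\<zero>\<^bsub>mid E\<^esub>" w] wV by simp
    qed simp_all
    show "proj P \<in> lmod_hom R (mid P) X"
      by (rule lmod_homI) (auto simp: C_def)
    show "\<exists>w\<in>carrier (restrict_mod Vinf (VX i)). p = incl P w"
      if p: "p \<in> carrier (mid P)" "proj P p = \<zero>\<^bsub>X\<^esub>" for p
    proof -
      obtain m w where m: "m \<in> carrier (mid E)" "w \<in> VX i" "p = (\<phi> m \<oplus>\<^bsub>Vinf\<^esub> w, proj E m)"
        using p by (auto simp: C_def)
      moreover have "proj E m = \<zero>\<^bsub>X\<^esub>"
        using m p by simp
      ultimately obtain y where "y \<in> carrier Y" "m = incl E y"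
        by (elim E.proj_eq_zeroE)
      then have "\<phi> m \<oplus>\<^bsub>Vinf\<^esub> w \<in> VX i"
        using base W(3) m by simp
      then show ?thesis
        using m \<open>proj E m = \<zero>\<^bsub>X\<^esub>\<close> by auto
    qed
    show "\<exists>p\<in>carrier (mid P). proj P p = x" if x: "x \<in> carrier X" for x
    proof -
      obtain m where "m \<in> carrier (mid E)" "proj E m = x"
        using x by (rule E.proj_lift)
      then show ?thesis
        using C_I [of m "\<zero>\<^bsub>Vinf\<^esub>"] W(2) by force
    qed
  qed (auto intro: E.proj.target.left_module_axioms)
  obtain B F g where u: "universal R \<X> (restrict_mod Vinf (VX i)) B F g"
    and F: "mid F = restrict_mod Vinf (VX (Suc i))" "\<And>y. y \<in> VX i \<Longrightarrow> incl F y = y"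
    using i by (rule universalE) blast
  obtain t where t: "t \<in> lmod_hom R (mid P) (mid F)"
    "\<And>w. w \<in> carrier (restrict_mod Vinf (VX i)) \<Longrightarrow> t (incl P w) = incl F w"
    using universal.extend_incl [OF u X P] by blast
  have t_closed: "t p \<in> VX (Suc i)" if "p \<in> C" for p
    using lmod_homD(1) [OF t(1), of p] that by (simp add: F)
  have t_add: "t (p \<oplus>\<^bsub>prod_mod Vinf X\<^esub> q) = t p \<oplus>\<^bsub>Vinf\<^esub> t q" if "p \<in> C" "q \<in> C" for p q
    using lmod_homD(2) [OF t(1), of p q] that by (simp add: F)
  have t_smult: "t (a \<odot>\<^bsub>prod_mod Vinf X\<^esub> p) = a \<odot>\<^bsub>Vinf\<^esub> t p" if "a \<in> carrier R" "p \<in> C" for a p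
    using lmod_homD(3) [OF t(1), of a p] that by (simp add: F)
  have t_W: "t (w, \<zero>\<^bsub>X\<^esub>) = w" if "w \<in> VX i" for w
    using t(2) [of w] F(2) that by simp
  have i': "Suc i \<ge> 1"
    by simp
  have C': "(\<phi> m, proj E m) \<in> C" if "m \<in> carrier (mid E)" for m
    using C_I [OF that W(2)] that by simp
  have tV: "t (\<phi> m, proj E m) \<in> VX (Suc i)" "t (\<phi> m, proj E m) \<in> carrier Vinf"
    if "m \<in> carrier (mid E)" for m
    using t_closed [OF C' [OF that]] VX_D(1) [OF i'] by auto
  \<comment> \<open>On elements coming from \<open>Y\<close> the map \<open>t\<close> returns
    \<open>\<phi> m\<close>, because \<open>t\<close> is the identity on \<open>VX i\<close>. So
    \<open>\<tau>\<close> vanishes there and descends to \<open>X\<close>.\<close>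
  define \<tau> where "\<tau> m = \<phi> m \<ominus>\<^bsub>Vinf\<^esub> t (\<phi> m, proj E m)" for m
  have "lmod_map R (mid E) Vinf \<tau>"
  proof (intro lmod_map.intro lmod_map_axioms.intro E.incl.target.left_module_axioms
      Vinf.left_module_axioms lmod_homI)
    fix m assume m: "m \<in> carrier (mid E)"
    show "\<tau> m \<in> carrier Vinf"
      using m tV by (simp add: \<tau>_def)
    show "\<tau> (a \<odot>\<^bsub>mid E\<^esub> m) = a \<odot>\<^bsub>Vinf\<^esub> \<tau> m" if "a \<in> carrier R" for a
      using that m tV t_smult [OF that C' [OF m]] by (simp add: \<tau>_def Vinf.smult_diff)
    show "\<tau> (m \<oplus>\<^bsub>mid E\<^esub> m') = \<tau> m \<oplus>\<^bsub>Vinf\<^esub> \<tau> m'" if m': "m' \<in> carrier (mid E)" for m'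
      using m m' tV t_add [OF C' [OF m] C' [OF m']]
      by (simp add: \<tau>_def Vinf.M.minus_eq Vinf.M.minus_add Vinf.M.a_ac)
  qed
  then interpret \<tau>: lmod_map R "mid E" Vinf \<tau> .
  have surj: "\<exists>m\<in>carrier (mid E). proj E m = x" if "x \<in> carrier X" for x
    using that by (blast elim: E.proj_lift)
  have ker: "\<tau> m = \<zero>\<^bsub>Vinf\<^esub>" if m: "m \<in> carrier (mid E)" "proj E m = \<zero>\<^bsub>X\<^esub>" for m
  proof -
    obtain y where "y \<in> carrier Y" "m = incl E y"
      using m by (rule E.proj_eq_zeroE)
    then have "t (\<phi> m, proj E m) = \<phi> m"
      using t_W base m by simp
    then show ?thesis
      using m by (simp add: \<tau>_def)
  qed
  obtain \<sigma> where \<sigma>: "\<sigma> \<in> lmod_hom R X Vinf" "\<And>m. m \<in> carrier (mid E) \<Longrightarrow> \<sigma> (proj E m) = \<tau> m"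
    using lmod_hom_factor [OF E.proj.lmod_map_axioms \<tau>.lmod_map_axioms surj ker] by blast
  \<comment> \<open>Both parts of \<open>\<tau>\<close> lie in \<open>VX (Suc (Suc i))\<close>,
    which is the bound that \<open>hom_from_X_step\<close> at \<open>Suc i\<close> asks for.\<close>
  have "\<sigma> ` carrier X \<subseteq> VX (Suc (Suc i))"
  proof clarify
    fix x assume x: "x \<in> carrier X"
    obtain m where m: "m \<in> carrier (mid E)" "proj E m = x"
      using x by (rule E.proj_lift)
    have "\<phi> m \<in> VX (Suc (Suc i))" "t (\<phi> m, proj E m) \<in> VX (Suc (Suc i))"
      using image m tV(1) [OF m(1)] VX_Suc [OF i'] by auto
    then show "\<sigma> x \<in> VX (Suc (Suc i))"
      using \<sigma>(2) [OF m(1)] m VX_diff [of "Suc (Suc i)"] by (simp add: \<tau>_def)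
  qed
  then have \<sigma>_image: "\<sigma> ` carrier X \<subseteq> VX (Suc i)"
    by (rule hom_from_X_step [OF X i' \<sigma>(1)])
  show ?thesis
  proof clarify
    fix m assume m: "m \<in> carrier (mid E)"
    have "\<sigma> (proj E m) \<in> VX (Suc i)"
      using \<sigma>_image m by auto
    then have "\<tau> m \<oplus>\<^bsub>Vinf\<^esub> t (\<phi> m, proj E m) \<in> VX (Suc i)"
      using \<sigma>(2) [OF m] tV(1) [OF m] VX_D(3) [OF i'] by simp
    moreover have "\<tau> m \<oplus>\<^bsub>Vinf\<^esub> t (\<phi> m, proj E m) = \<phi> m"
      using m tV(2) [OF m] by (simp add: \<tau>_def Vinf.M.minus_eq Vinf.M.a_assoc Vinf.M.l_neg)
    ultimately show "\<phi> m \<in> VX (Suc i)"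
      by simp
  qed
qed

text \<open>The analogue of \<open>hom_from_X\<close> relative to \<open>VX i\<close>. As
  \<open>mid E\<close> need not be finitely generated, the chain argument takes place in
  \<open>X\<close>; the part of the middle term coming from \<open>Y\<close> is under control by
  \<open>base\<close>.\<close>

lemma hom_from_extension:
  assumes X: "X \<in> \<X>" and E: "extension R Y E X" and i: "i \<ge> 1"
    and \<phi>: "\<phi> \<in> lmod_hom R (mid E) Vinf"
    and base: "\<And>y. y \<in> carrier Y \<Longrightarrow> \<phi> (incl E y) \<in> VX i"
  shows "\<phi> ` carrier (mid E) \<subseteq> VX (Suc i)"
proof -
  interpret E: extension R Y E X by (rule E)
  interpret \<phi>: lmod_map R "mid E" Vinf \<phi>
    using \<phi> by unfold_locales
  \<comment> \<open>The image in \<open>X\<close> of the preimage of \<open>VX k\<close> under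
    \<open>\<phi>\<close>; these submodules exhaust \<open>X\<close> as \<open>k\<close>
    grows.\<close>
  let ?S = "\<lambda>k. {proj E m |m. m \<in> carrier (mid E) \<and> \<phi> m \<in> VX k}"
  have S_I: "proj E m \<in> ?S k" if "m \<in> carrier (mid E)" "\<phi> m \<in> VX k" for m k
    using that by blast
  have "\<exists>k\<ge>Suc i. carrier X \<subseteq> ?S k"
  proof (rule finitely_presented_chain [OF Vinf.R.ring_axioms finitely_presented [OF X]])
    show "submodule (?S k) R X" if k: "k \<ge> Suc i" for k
    proof (rule E.proj.target.submoduleI)
      have k1: "k \<ge> 1"
        using k by simp
      note D = VX_D [OF k1]
      show "\<zero>\<^bsub>X\<^esub> \<in> ?S k"
        using S_I [of "\<zero>\<^bsub>mid E\<^esub>" k] D(2) by simp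
      show "x \<oplus>\<^bsub>X\<^esub> x' \<in> ?S k" if xx: "x \<in> ?S k" "x' \<in> ?S k" for x x'
      proof -
        obtain m m' where "m \<in> carrier (mid E)" "\<phi> m \<in> VX k" "x = proj E m"
            "m' \<in> carrier (mid E)" "\<phi> m' \<in> VX k" "x' = proj E m'"
          using xx by blast
        then show ?thesis
          using S_I [of "m \<oplus>\<^bsub>mid E\<^esub> m'" k] D(3) by simp
      qed
      show "a \<odot>\<^bsub>X\<^esub> x \<in> ?S k" if a: "a \<in> carrier R" and x: "x \<in> ?S k" for a x
      proof -
        obtain m where "m \<in> carrier (mid E)" "\<phi> m \<in> VX k" "x = proj E m"
          using x by blast
        then show ?thesis
          using a S_I [of "a \<odot>\<^bsub>mid E\<^esub> m" k] D(4) by simp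
      qed
    qed auto
    show "?S k \<subseteq> ?S l" if "Suc i \<le> k" "k \<le> l" for k l
      using VX_mono [of k l] that by auto
    show "\<exists>k\<ge>Suc i. x \<in> ?S k" if x: "x \<in> carrier X" for x
    proof -
      obtain m where m: "m \<in> carrier (mid E)" "proj E m = x"
        using x by (rule E.proj_lift)
      then obtain k where k: "k \<ge> 1" "\<phi> m \<in> VX k"
        using carrier_Vinf [of "\<phi> m"] by auto
      have "\<phi> m \<in> VX (max k (Suc i))"
        using k VX_mono [of k "max k (Suc i)"] by auto
      then show ?thesis
        using S_I m by (intro exI [of _ "max k (Suc i)"]) auto
    qed
  qed
  then obtain k where k: "k \<ge> Suc i" "carrier X \<subseteq> ?S k"
    by blast
  have "\<phi> ` carrier (mid E) \<subseteq> VX k"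
  proof clarify
    fix m assume m: "m \<in> carrier (mid E)"
    have "proj E m \<in> ?S k"
      by (rule subsetD [OF k(2) E.proj.map_closed [OF m]])
    then obtain m' where m': "m' \<in> carrier (mid E)" "\<phi> m' \<in> VX k" "proj E m = proj E m'"
      by blast
    \<comment> \<open>Only some lift of \<open>proj E m\<close> is known to go to
      \<open>VX k\<close>; \<open>m\<close> differs from it by an element of \<open>Y\<close>, which
      goes to \<open>VX i\<close>.\<close>
    obtain y where y: "y \<in> carrier Y" "m = m' \<oplus>\<^bsub>mid E\<^esub> incl E y"
      using m m'(1,3) by (rule E.proj_eqE)
    have "\<phi> (incl E y) \<in> VX k"
      using base y VX_mono [OF i, of k] k(1) by auto
    then show "\<phi> m \<in> VX k"
      using m' y VX_D(3) [of k] k(1) by simp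
  qed
  with k(1) show ?thesis
  proof (induction k rule: dec_induct)
    case (step l)
    have "\<phi> ` carrier (mid E) \<subseteq> VX l"
    proof -
      \<comment> \<open>The step lemma descends from \<open>Suc (Suc l')\<close> to
        \<open>Suc l'\<close> with \<open>l'\<close> in the role of \<open>i\<close>, where the
        assumption on \<open>Y\<close> holds because \<open>VX i\<close> is contained in
        \<open>VX l'\<close>.\<close>
      obtain l' where l: "l = Suc l'" "l' \<ge> 1" "l' \<ge> i"
        using step.hyps i by (cases l) auto
      have "\<phi> (incl E y) \<in> VX l'" if "y \<in> carrier Y" for y
        using base [OF that] VX_mono [OF i l(3)] by blast
      then show ?thesis
        using hom_from_extension_step [OF X E l(2) \<phi>] step.prems l(1) by simp
    qed
    then show ?case
      by (rule step.IH)
  qed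
qed

text \<open>\<open>hom_from_X\<close> settles each summand, and the elements sent to
  \<open>VX 1\<close> are closed under addition.\<close>

lemma hom_from_semisimple:
  fixes U :: "('a, 'u) module"
  assumes U: "X_semisimple R \<X> U" and \<phi>: "\<phi> \<in> lmod_hom R U Vinf"
  shows "\<phi> ` carrier U \<subseteq> VX 1"
proof -
  obtain I :: "'u set" and S h where S: "S \<in> I \<rightarrow> \<X>" and h: "h \<in> lmod_hom R U (direct_sum I S)"
    "bij_betw h (carrier U) (carrier (direct_sum I S))" and modU: "left_module R U"
    using U by (auto simp: X_semisimple_def lmod_isomorphic_def lmod_iso_def)
  interpret S: lmod_family R I S
    using Vinf.R.ring_axioms S left_module_X by (intro lmod_family.intro) auto
  interpret U: left_module R U
    by (rule modU)
  interpret h: lmod_map R U "direct_sum I S" h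
    using h by unfold_locales
  interpret \<phi>: lmod_map R U Vinf \<phi>
    using \<phi> by unfold_locales
  have surj: "\<exists>u\<in>carrier U. h u = f" if "f \<in> carrier (direct_sum I S)" for f
    using h(2) that unfolding bij_betw_def by (metis imageE)
  have ker: "\<phi> u = \<zero>\<^bsub>Vinf\<^esub>" if "u \<in> carrier U" "h u = \<zero>\<^bsub>direct_sum I S\<^esub>" for u
  proof -
    have "u = \<zero>\<^bsub>U\<^esub>"
      by (rule inj_onD [OF bij_betw_imp_inj_on [OF h(2)]])
        (use that in \<open>simp_all del: direct_sum_simps\<close>)
    then show ?thesis
      by simp
  qed
  obtain \<psi> where \<psi>: "\<psi> \<in> lmod_hom R (direct_sum I S) Vinf" "\<And>u. u \<in> carrier U \<Longrightarrow> \<psi> (h u) = \<phi> u"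
    using lmod_hom_factor [OF h.lmod_map_axioms \<phi>.lmod_map_axioms surj ker] by blast
  interpret \<psi>: lmod_map R "direct_sum I S" Vinf \<psi>
    using \<psi>(1) by unfold_locales
  have "f \<in> {f \<in> carrier (direct_sum I S). \<psi> f \<in> VX 1}" if "f \<in> carrier (direct_sum I S)" for f
    using that
  proof (rule S.direct_sum_induct)
    note D = VX_D [OF order.refl]
    show "\<zero>\<^bsub>direct_sum I S\<^esub> \<in> {f \<in> carrier (direct_sum I S). \<psi> f \<in> VX 1}"
      using D(2) by (simp del: direct_sum_simps)
    show "f \<oplus>\<^bsub>direct_sum I S\<^esub> f' \<in> {f \<in> carrier (direct_sum I S). \<psi> f \<in> VX 1}"
      if "f \<in> {f \<in> carrier (direct_sum I S). \<psi> f \<in> VX 1}"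
        "f' \<in> {f \<in> carrier (direct_sum I S). \<psi> f \<in> VX 1}" for f f'
      using that D(3) by (simp del: direct_sum_simps)
    show "single I S j x \<in> {f \<in> carrier (direct_sum I S). \<psi> f \<in> VX 1}"
      if j: "j \<in> I" and x: "x \<in> carrier (S j)" for j x
    proof -
      note s = lmod_homD [OF S.single_hom [OF j]]
      have "(\<lambda>x. \<psi> (single I S j x)) \<in> lmod_hom R (S j) Vinf"
        using s j by (intro lmod_homI) (simp_all del: direct_sum_simps)
      moreover have "S j \<in> \<X>"
        using S j by blast
      ultimately have "\<psi> (single I S j x) \<in> VX 1"
        using hom_from_X x by blast
      then show ?thesis
        using j x by simp
    qed
  qed
  then have "\<psi> (h u) \<in> VX 1" if "u \<in> carrier U" for u
    using h.map_closed [OF that] by blast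
  then show ?thesis
    using \<psi>(2) by auto
qed

end

text \<open>Composing \<open>f\<close> with \<open>g X b\<close> gives a homomorphism from an
  extension of \<open>X\<close> by \<open>UX i\<close>. It sends \<open>UX i\<close> into the term
  reached so far, so by \<open>hom_from_extension\<close> its whole image gains only one index; such
  images together with \<open>UX i\<close> generate \<open>UX (Suc i)\<close>.\<close>

lemma tower_hom_shift:
  assumes "tower R \<X> U eU UX Uinf" and "tower R \<X> V eV VX Vinf"
    and f: "f \<in> lmod_hom R Uinf Vinf" and r: "r \<ge> 1" and base: "f ` UX 1 \<subseteq> VX r" and "i \<ge> 1"
  shows "f ` UX i \<subseteq> VX (i + r - 1)"
  using \<open>i \<ge> 1\<close>
proof (induction i rule: dec_induct)
  case base
  then show ?case
    using assms by simp
next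
  case (step i)
  interpret U: tower R \<X> U eU UX Uinf by fact
  interpret V: tower R \<X> V eV VX Vinf by fact
  interpret f: lmod_map R Uinf Vinf f
    using f by unfold_locales
  \<comment> \<open>The subtraction on natural numbers is harmless: \<open>i\<close> and
    \<open>r\<close> are at least 1, so \<open>?j\<close> is at least 1 and its successor is the
    index wanted for \<open>Suc i\<close>.\<close>
  let ?j = "i + r - 1"
  have j: "?j \<ge> 1" "Suc ?j = Suc i + r - 1"
    using step.hyps r by auto
  obtain B E g where u: "universal R \<X> (restrict_mod Uinf (UX i)) B E g"
    and E: "mid E = restrict_mod Uinf (UX (Suc i))" "\<And>y. y \<in> UX i \<Longrightarrow> incl E y = y"
    using step.hyps(1) by (rule U.universalE) blast
  interpret universal R \<X> "restrict_mod Uinf (UX i)" B E g by (rule u)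
  have sub: "UX (Suc i) \<subseteq> carrier Uinf"
    by (rule U.VX_D) simp
  have D: "x \<oplus>\<^bsub>Vinf\<^esub> y \<in> VX (Suc ?j)" if "x \<in> VX (Suc ?j)" "y \<in> VX (Suc ?j)" for x y
    using V.VX_D(3) [of "Suc ?j"] that by simp
  have "x \<in> {x \<in> UX (Suc i). f x \<in> VX (Suc ?j)}" if "x \<in> UX (Suc i)" for x
  proof (rule generated)
    show "x \<in> carrier (mid E)"
      using that E by simp
    show "x \<oplus>\<^bsub>mid E\<^esub> y \<in> {x \<in> UX (Suc i). f x \<in> VX (Suc ?j)}"
      if "x \<in> {x \<in> UX (Suc i). f x \<in> VX (Suc ?j)}" "y \<in> {x \<in> UX (Suc i). f x \<in> VX (Suc ?j)}" for x y
    proof -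
      have "x \<oplus>\<^bsub>Uinf\<^esub> y \<in> UX (Suc i)" "x \<in> carrier Uinf" "y \<in> carrier Uinf"
        using that sub U.VX_D(3) [of "Suc i"] by auto
      then show ?thesis
        using that D by (simp add: E)
    qed
    show "incl E y \<in> {x \<in> UX (Suc i). f x \<in> VX (Suc ?j)}"
      if "y \<in> carrier (restrict_mod Uinf (UX i))" for y
      using that E(2) U.VX_Suc [OF step.hyps(1)] V.VX_Suc [OF j(1)] step.IH by auto
    show "g X b m \<in> {x \<in> UX (Suc i). f x \<in> VX (Suc ?j)}"
      if X: "X \<in> \<X>" and b: "b \<in> B X" and m: "m \<in> carrier (mid b)" for X b m
    proof -
      note gD = lmod_homD [OF g_hom [OF X b]]
      have gU: "g X b m \<in> UX (Suc i)" "g X b m \<in> carrier Uinf" if "m \<in> carrier (mid b)" for m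
        using gD(1) [OF that] E sub by auto
      have "(\<lambda>m. f (g X b m)) ` carrier (mid b) \<subseteq> VX (Suc ?j)"
      proof (rule V.hom_from_extension [OF X ext_B [OF X b] j(1)])
        show "(\<lambda>m. f (g X b m)) \<in> lmod_hom R (mid b) Vinf"
          using gU gD(2,3) by (intro lmod_homI) (simp_all add: E)
        show "f (g X b (incl b y)) \<in> VX ?j" if "y \<in> carrier (restrict_mod Uinf (UX i))" for y
          using that g_incl [OF X b that] E(2) step.IH by auto
      qed
      then show ?thesis
        using m gU by auto
    qed
  qed
  then show ?case
    unfolding j(2) [symmetric] by blast
qed

theorem corollary4p8:
  fixes R :: "('a, 'k) ring_scheme"
    and \<X> :: "('a, 'x) module set"
    and U :: "('a, 'u) module" and V :: "('a, 'v) module"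
    and Uinf :: "('a, 'm) module" and Vinf :: "('a, 'n) module"
    and UX :: "nat \<Rightarrow> 'm set" and VX :: "nat \<Rightarrow> 'n set"
    and eU :: "'u \<Rightarrow> 'm" and eV :: "'v \<Rightarrow> 'n"
  assumes "ring R"
    and "semibrick R \<X>"
    and "\<forall>X\<in>\<X>. proj_dim_le_one R X"
    and "left_module R U" and "left_module R V"
    and "universal_tower R \<X> U eU UX Uinf"
    and "universal_tower R \<X> V eV VX Vinf"
  shows "(\<forall>f\<in>lmod_hom R Uinf Vinf. \<forall>r\<ge>1. f ` eU ` carrier U \<subseteq> VX r \<longrightarrow>
            (\<forall>i\<ge>1. f ` UX i \<subseteq> VX (i + r - 1))) \<and>
         (Filt R \<X> U \<longrightarrow> Filt R \<X> V \<longrightarrow> X_semisimple R \<X> U \<longrightarrow>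
            (\<forall>f\<in>lmod_hom R Uinf Vinf. \<forall>i\<ge>1. f ` UX i \<subseteq> VX i))"
proof -
  have U: "tower R \<X> U eU UX Uinf" and V: "tower R \<X> V eV VX Vinf"
    using assms by (auto intro: tower.intro)
  interpret U: tower R \<X> U eU UX Uinf by (rule U)
  interpret V: tower R \<X> V eV VX Vinf by (rule V)
  have eU: "eU \<in> lmod_hom R U (restrict_mod Uinf (UX 1))" "eU ` carrier U = UX 1"
    using assms(6) by (auto simp: universal_tower_def lmod_iso_def bij_betw_def)
  have shift: "f ` UX i \<subseteq> VX (i + r - 1)"
    if "f \<in> lmod_hom R Uinf Vinf" "r \<ge> 1" "f ` eU ` carrier U \<subseteq> VX r" "i \<ge> 1" for f r i
    using tower_hom_shift [OF U V that(1,2) _ that(4)] that(3) eU(2) by simp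
  \<comment> \<open>Restricted to \<open>U\<close>, the homomorphism \<open>f\<close> starts from a
    semisimple module and so lands in \<open>VX 1\<close>. This is the hypothesis of the first claim
    with \<open>r = 1\<close>, where \<open>i + r - 1\<close> is \<open>i\<close>.\<close>
  have "f ` UX i \<subseteq> VX i"
    if "X_semisimple R \<X> U" and f: "f \<in> lmod_hom R Uinf Vinf" and "i \<ge> 1" for f i
  proof -
    have "UX 1 \<subseteq> carrier Uinf"
      by (rule U.VX_D) simp
    then have carr: "eU u \<in> carrier Uinf" if "u \<in> carrier U" for u
      using eU(2) that by blast
    have "(\<lambda>u. f (eU u)) \<in> lmod_hom R U Vinf"
      using lmod_homD(2,3) [OF eU(1)] lmod_homD [OF f] carr by (intro lmod_homI) simp_all
    then have "(\<lambda>u. f (eU u)) ` carrier U \<subseteq> VX 1"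
      by (rule V.hom_from_semisimple [OF \<open>X_semisimple R \<X> U\<close>])
    then show ?thesis
      using shift [OF f, of 1 i] \<open>i \<ge> 1\<close> by (simp add: image_image)
  qed
  with shift show ?thesis
    by (intro conjI ballI allI impI)
qed

end
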